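(* In the mixture Cramér–Lundberg model described in the context, for each fixed $n\in\mathbb{N}$, the following relations hold: $$\frac{\mathrm{Var}\big(\hat\varphi^{n}_\kappa(u)\big)}{\mathrm{Var}\big(\hat\varphi^{\circ,n}_\kappa(u)\big)}\sim\left[\frac{\epsilon\theta}{1-\rho^\bullet}\bigg/\rho\right]^{n+2}\frac{1+n\left(\frac{1-\rho}{1-\rho^\bullet}\right)}{1+n(1-\rho)}\qquad\text{as }u\to\infty,$$ and $$\left[\frac{\mathrm{Var}\big(\hat\varphi^{n}_\kappa(u)\big)}{\mathrm{Var}\big(\hat z_\kappa(u)\big)}\right]\cdot\left[\frac{\mathrm{Var}\big(\hat\varphi^{\circ,n}_\kappa(u)\big)}{\mathrm{Var}\big(\hat z^\circ_\kappa(u)\big)}\right]^{-1}\to\left[\frac{\epsilon\theta}{1-\rho^\bullet}\bigg/\rho\right]^{n-1}\frac{1+n\left(\frac{1-\rho}{1-\rho^\bullet}\right)}{1+n(1-\rho)}\cdot\frac{1+(1-\rho)}{1+\left(\frac{1-\rho}{1-\rho^\bullet}\right)}\qquad\text{as }u\to\infty.$$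
   Context: Write $\overline F=1-F$ for tails; $f(u)\sim g(u)$ means $f(u)/g(u)\to1$. A distribution function $F$ on $[0,\infty)$ is subexponential if $\overline{F^{*n}}(u)\sim n\overline F(u)$ as $u\to\infty$ for every $n\in\mathbb{N}$ ($F^{*n}$ is the $n$-fold convolution). A phase-type distribution is the law of the absorption time of a finite-state Markov jump process with all states but one transient and the remaining one absorbing. Model. Claims arrive according to a homogeneous Poisson process with rate $\lambda$, the premium rate is $1$, the initial capital is $u$, and claim sizes are i.i.d. copies of a random variable $U$, independent of the arrivals, with distribution function $G=(1-\epsilon)F_p+\epsilon F_h$, where $\epsilon\in(0,1)$, $F_p$ is the phase-type distribution function of a random variable $B$ with finite mean $\mu_B$, and $F_h$ is the subexponential distribution function of a random variable $C$ with finite mean $\mu_C$. Put $\delta=\lambda\mu_B$, $\theta=\lambda\mu_C$, $\rho^\bullet=(1-\epsilon)\delta$, $\rho=\lambda\,\mathbb{E}U=\rho^\bullet+\epsilon\theta$, and assume the safety loading condition $\rho<1$. Stationary excess distributions: $F_p^e(u)=\frac1{\mu_B}\int_0^u(1-F_p(x))\,dx$, $F_h^e(u)=\frac1{\mu_C}\int_0^u(1-F_h(x))\,dx$, $G^e(u)=\frac1{\mathbb{E}U}\int_0^u(1-G(x))\,dx$. It is assumed that $F_h^e$ is subexponential. Control variate estimator built from a pair. Given a pair $(Z,W)$ of random variables with $\mathbb{E}W$ known, and i.i.d. copies $(Z^{(i)},W^{(i)})$, $i=1,\dots,\kappa$ ($\kappa$ is the number of simulations), put $\hat z_\kappa=\frac1\kappa\sum_{i=1}^\kappa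 Z^{(i)}$, $\hat w_\kappa=\frac1\kappa\sum_{i=1}^\kappa W^{(i)}$, $$\hat\alpha_\kappa=-\frac{\sum_{i=1}^\kappa(Z^{(i)}-\hat z_\kappa)(W^{(i)}-\hat w_\kappa)}{\sum_{i=1}^\kappa(W^{(i)}-\hat w_\kappa)^2},$$ and the estimator is $\hat z_\kappa+\hat\alpha_\kappa(\hat w_\kappa-\mathbb{E}W)$. (1) New series expansion. Let $C^e_1,C^e_2,\dots$ be i.i.d. with distribution function $F_h^e$; let $M^\bullet_0,M^\bullet_1,\dots$ be i.i.d. copies of $M^\bullet$, the supremum of the claim surplus process (aggregate claims minus premiums) of the compound Poisson risk model with premium rate $1$, arrival rate $(1-\epsilon)\lambda$ and claim size distribution $F_p$, i.e. $\mathbb{P}(M^\bullet\le u)=(1-\rho^\bullet)\sum_{k=0}^\infty(\rho^\bullet)^k(F_p^e)^{*k}(u)$; let $N$ satisfy $\mathbb{P}(N=k)=\frac{1-\rho}{1-\rho^\bullet}\left(\frac{\epsilon\theta}{1-\rho^\bullet}\right)^k$, $k\ge0$; all independent. Define $$V=M^\bullet_0+M^\bullet_1+C^e_1+\sum_{k=2}^{N+2}(M^\bullet_k+C^e_k),\qquad V_n=\max\{C^e_1,\dots,C^e_{N+2}\}\mathbf 1_{\{N+2\le n\}},$$ $$Z(u)=\left(\tfrac{\epsilon\theta}{1-\rho^\bullet}\right)^2\mathbf 1_{\{V>u\}},\qquad W_n(u)=\left(\tfrac{\epsilon\theta}{1-\rho^\bullet}\right)^2\mathbf 1_{\{V_n>u\}}.$$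 Then $\hat\varphi^n_\kappa(u)$ is the control variate estimator built from the pair $(Z(u),W_n(u))$, and $\hat z_\kappa(u)$ is the corresponding empirical mean of the copies of $Z(u)$. (2) Pollaczek–Khinchine expansion. Let $U^e_1,U^e_2,\dots$ be i.i.d. with distribution function $G^e$ and $N^\circ$ an independent variable with $\mathbb{P}(N^\circ=k)=(1-\rho)\rho^k$, $k\ge0$. Define $$V^\circ=\sum_{k=1}^{N^\circ+2}U^e_k,\qquad V^\circ_n=\max\{U^e_1,\dots,U^e_{N^\circ+2}\}\mathbf 1_{\{N^\circ\le n-2\}},$$ $$Z^\circ(u)=\rho^2\mathbf 1_{\{V^\circ>u\}},\qquad W^\circ_n(u)=\rho^2\mathbf 1_{\{V^\circ_n>u\}}.$$ Then $\hat\varphi^{\circ,n}_\kappa(u)$ is the control variate estimator built from the pair $(Z^\circ(u),W^\circ_n(u))$, and $\hat z^\circ_\kappa(u)$ is the corresponding empirical mean of the copies of $Z^\circ(u)$. *)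

theory Defs
  imports "HOL-Probability.Probability"
begin

section \<open>Distribution functions on the half-line\<close>

text \<open>
  This is the literal relation $f(u)/g(u) \to 1$.  The library relation \<open>asymp_equiv\<close> is not used
  because it counts $0/0$ as $1$, so that every distribution with bounded support would become
  subexponential.
\<close>

definition ratio_sim :: "(real \<Rightarrow> real) \<Rightarrow> (real \<Rightarrow> real) \<Rightarrow> bool" where
  "ratio_sim f g \<longleftrightarrow> ((\<lambda>u. f u / g u) \<longlongrightarrow> 1) at_top"

definition distribution_function :: "(real \<Rightarrow> real) \<Rightarrow> bool" where
  "distribution_function F \<longleftrightarrow>
     mono F \<and> (\<forall>x. continuous (at_right x) F) \<and> (F \<longlongrightarrow> 1) at_top \<and> (\<forall>x<0. F x = 0)"

definition conv_power :: "(real \<Rightarrow> real) \<Rightarrow> nat \<Rightarrow> real \<Rightarrow> real" where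
  "conv_power F k = cdf (((\<star>) (interval_measure F) ^^ k) (return borel 0))"

definition subexponential :: "(real \<Rightarrow> real) \<Rightarrow> bool" where
  "subexponential F \<longleftrightarrow> distribution_function F \<and>
     (\<forall>k\<ge>1. ratio_sim (\<lambda>u. 1 - conv_power F k u) (\<lambda>u. real k * (1 - F u)))"

text \<open>The stationary excess distribution of \<open>F\<close>, where \<open>\<mu>\<close> is the mean of \<open>F\<close>.\<close>

definition excess :: "real \<Rightarrow> (real \<Rightarrow> real) \<Rightarrow> real \<Rightarrow> real" where
  "excess \<mu> F u = 1 / \<mu> * (LINT x:{0..u}|lborel. 1 - F x)"


section \<open>Phase-type distributions\<close>

definition transition_semigroup :: "'s set \<Rightarrow> (real \<Rightarrow> 's \<Rightarrow> 's \<Rightarrow> real) \<Rightarrow> bool" where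
  "transition_semigroup S p \<longleftrightarrow>
     (\<forall>t\<ge>0. \<forall>i\<in>S. (\<forall>j\<in>S. 0 \<le> p t i j) \<and> (\<Sum>j\<in>S. p t i j) = 1) \<and>
     (\<forall>i\<in>S. \<forall>j\<in>S. p 0 i j = of_bool (i = j)) \<and>
     (\<forall>s\<ge>0. \<forall>t\<ge>0. \<forall>i\<in>S. \<forall>j\<in>S. p (s + t) i j = (\<Sum>k\<in>S. p s i k * p t k j)) \<and>
     (\<forall>i\<in>S. \<forall>j\<in>S. ((\<lambda>t. p t i j) \<longlongrightarrow> p 0 i j) (at_right 0))"

text \<open>
  The last two clauses say that the paths are right-continuous step functions with finitely many
  jumps in every bounded interval, and that \<open>X\<close> is a time-homogeneous Markov process with
  transition probabilities \<open>p\<close>: \<open>J\<close> ranges over the finite sets of observation times up to the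
  present time \<open>s\<close>, which belongs to \<open>J\<close>, and \<open>x\<close> is the observed trajectory.
\<close>

definition markov_jump_process ::
    "'w measure \<Rightarrow> (real \<Rightarrow> 'w \<Rightarrow> 's) \<Rightarrow> 's set \<Rightarrow> (real \<Rightarrow> 's \<Rightarrow> 's \<Rightarrow> real) \<Rightarrow> bool" where
  "markov_jump_process P X S p \<longleftrightarrow>
     prob_space P \<and> finite S \<and> transition_semigroup S p \<and>
     (\<forall>t\<ge>0. X t \<in> measurable P (count_space S)) \<and>
     (\<forall>\<omega>\<in>space P.
        (\<forall>t\<ge>0. \<forall>\<^sub>F s in at_right t. X s \<omega> = X t \<omega>) \<and>
        (\<forall>t>0. \<exists>i. \<forall>\<^sub>F s in at_left t. X s \<omega> = i)) \<and>
     (\<forall>s t J x j. 0 \<le> s \<and> s \<le> t \<and> finite J \<and> J \<subseteq> {0..s} \<and> s \<in> J \<and> (\<forall>r\<in>J. x r \<in> S) \<and> j \<in> S \<longrightarrow>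
        measure P {\<omega>\<in>space P. (\<forall>r\<in>J. X r \<omega> = x r) \<and> X t \<omega> = j} =
        measure P {\<omega>\<in>space P. \<forall>r\<in>J. X r \<omega> = x r} * p (t - s) (x s) j)"

definition absorbing_state :: "(real \<Rightarrow> 's \<Rightarrow> 's \<Rightarrow> real) \<Rightarrow> 's \<Rightarrow> bool" where
  "absorbing_state p d \<longleftrightarrow> (\<forall>t\<ge>0. p t d d = 1)"

text \<open>
  Transience: almost surely the set of times spent in the state is bounded.  This refers to the
  process with its given initial law, so a state that is never entered counts as transient;
  removing such states does not change the absorption time.
\<close>

definition transient_state :: "'w measure \<Rightarrow> (real \<Rightarrow> 'w \<Rightarrow> 's) \<Rightarrow> 's \<Rightarrow> bool" where
  "transient_state P X i \<longleftrightarrow> (AE \<omega> in P. bounded {t. 0 \<le> t \<and> X t \<omega> = i})"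

text \<open>
  \<open>B\<close> is the absorption time of such a process; the states are labelled by natural numbers.  On
  the null set of paths that are never absorbed the infimum of the empty set is an unspecified real.
\<close>

definition phase_type :: "'w measure \<Rightarrow> ('w \<Rightarrow> real) \<Rightarrow> bool" where
  "phase_type P B \<longleftrightarrow>
     (\<exists>(X :: real \<Rightarrow> 'w \<Rightarrow> nat) S p d.
        markov_jump_process P X S p \<and> d \<in> S \<and> absorbing_state p d \<and>
        (\<forall>i\<in>S - {d}. transient_state P X i) \<and>
        (\<forall>\<omega>\<in>space P. B \<omega> = Inf {t. 0 \<le> t \<and> X t \<omega> = d}))"


section \<open>Control variate estimators\<close>

definition emp_mean :: "nat \<Rightarrow> (nat \<Rightarrow> real) \<Rightarrow> real" where
  "emp_mean \<kappa> z = (\<Sum>i=1..\<kappa>. z i) / real \<kappa>"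

text \<open>
  If all observations of the control agree, the quotient is $0/0 = 0$: no correction is applied.
\<close>

definition cv_coefficient :: "nat \<Rightarrow> (nat \<Rightarrow> real) \<Rightarrow> (nat \<Rightarrow> real) \<Rightarrow> real" where
  "cv_coefficient \<kappa> z w =
     - ((\<Sum>i=1..\<kappa>. (z i - emp_mean \<kappa> z) * (w i - emp_mean \<kappa> w)) /
        (\<Sum>i=1..\<kappa>. (w i - emp_mean \<kappa> w)\<^sup>2))"

text \<open>The number \<open>m\<close> is the known expectation of the control.\<close>

definition cv_estimator :: "nat \<Rightarrow> real \<Rightarrow> (nat \<Rightarrow> real) \<Rightarrow> (nat \<Rightarrow> real) \<Rightarrow> real" where
  "cv_estimator \<kappa> m z w = emp_mean \<kappa> z + cv_coefficient \<kappa> z w * (emp_mean \<kappa> w - m)"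

text \<open>
  On \<open>Q\<close>, the pairs \<open>(Zs i, Ws i)\<close>, \<open>1 \<le> i \<le> \<kappa>\<close>, are i.i.d. copies of the pair \<open>(Z, W)\<close> on \<open>P\<close>.
\<close>

definition iid_copies ::
    "'w measure \<Rightarrow> ('w \<Rightarrow> real) \<Rightarrow> ('w \<Rightarrow> real) \<Rightarrow>
     'v measure \<Rightarrow> nat \<Rightarrow> (nat \<Rightarrow> 'v \<Rightarrow> real) \<Rightarrow> (nat \<Rightarrow> 'v \<Rightarrow> real) \<Rightarrow> bool" where
  "iid_copies P Z W Q \<kappa> Zs Ws \<longleftrightarrow>
     prob_space.indep_vars Q (\<lambda>_. borel \<Otimes>\<^sub>M borel) (\<lambda>i \<omega>. (Zs i \<omega>, Ws i \<omega>)) {1..\<kappa>} \<and>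
     (\<forall>i\<in>{1..\<kappa>}. distr Q (borel \<Otimes>\<^sub>M borel) (\<lambda>\<omega>. (Zs i \<omega>, Ws i \<omega>)) =
                  distr P (borel \<Otimes>\<^sub>M borel) (\<lambda>\<omega>. (Z \<omega>, W \<omega>)))"


section \<open>The two series expansions\<close>

text \<open>
  The input variables of an expansion are collected into one real-valued family, so that their
  joint independence can be expressed by \<open>indep_vars\<close>.
\<close>

datatype input = Count | Base nat | Excess nat

definition new_inputs ::
    "('w \<Rightarrow> nat) \<Rightarrow> (nat \<Rightarrow> 'w \<Rightarrow> real) \<Rightarrow> (nat \<Rightarrow> 'w \<Rightarrow> real) \<Rightarrow> input \<Rightarrow> 'w \<Rightarrow> real" where
  "new_inputs N Mb Ce s =
     (case s of Count \<Rightarrow> (\<lambda>\<omega>. real (N \<omega>)) | Base k \<Rightarrow> Mb k | Excess k \<Rightarrow> Ce k)"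

definition pk_inputs :: "('w \<Rightarrow> nat) \<Rightarrow> (nat \<Rightarrow> 'w \<Rightarrow> real) \<Rightarrow> nat \<Rightarrow> 'w \<Rightarrow> real" where
  "pk_inputs N Ue k = (if k = 0 then (\<lambda>\<omega>. real (N \<omega>)) else Ue k)"

definition V_new ::
    "('w \<Rightarrow> nat) \<Rightarrow> (nat \<Rightarrow> 'w \<Rightarrow> real) \<Rightarrow> (nat \<Rightarrow> 'w \<Rightarrow> real) \<Rightarrow> 'w \<Rightarrow> real" where
  "V_new N Mb Ce \<omega> = Mb 0 \<omega> + Mb 1 \<omega> + Ce 1 \<omega> + (\<Sum>k=2..N \<omega> + 2. Mb k \<omega> + Ce k \<omega>)"

definition Vn_new :: "nat \<Rightarrow> ('w \<Rightarrow> nat) \<Rightarrow> (nat \<Rightarrow> 'w \<Rightarrow> real) \<Rightarrow> 'w \<Rightarrow> real" where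
  "Vn_new n N Ce \<omega> = Max ((\<lambda>k. Ce k \<omega>) ` {1..N \<omega> + 2}) * of_bool (N \<omega> + 2 \<le> n)"

definition V_pk :: "('w \<Rightarrow> nat) \<Rightarrow> (nat \<Rightarrow> 'w \<Rightarrow> real) \<Rightarrow> 'w \<Rightarrow> real" where
  "V_pk N Ue \<omega> = (\<Sum>k=1..N \<omega> + 2. Ue k \<omega>)"

definition Vn_pk :: "nat \<Rightarrow> ('w \<Rightarrow> nat) \<Rightarrow> (nat \<Rightarrow> 'w \<Rightarrow> real) \<Rightarrow> 'w \<Rightarrow> real" where
  "Vn_pk n N Ue \<omega> = Max ((\<lambda>k. Ue k \<omega>) ` {1..N \<omega> + 2}) * of_bool (int (N \<omega>) \<le> int n - 2)"

end

theory Submission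
  imports Defs
begin

text \<open>
  Both expansions are geometric sums of independent summands whose tails are asymptotically
  multiples of the tail \<open>t\<close> of the excess distribution \<open>F\<^sub>h\<^sup>e\<close>: a phase-type law has an exponential
  tail, hence \<open>M\<^sup>\<bullet>\<close> is negligible, and \<open>G\<^sup>e\<close> has tail \<open>\<sim> (\<epsilon>\<theta>/\<rho>) t\<close>.  By the principle of the single
  big jump, with Kesten's bound as dominating function, \<open>P(V > u)\<close> and \<open>P(V\<^sub>n > u)\<close> are asymptotically
  \<open>E[N + 2]\<close> and \<open>E[N + 2; N + 2 \<le> n]\<close> times such a tail.

  For fixed \<open>\<kappa>\<close> the number of simulations with \<open>V > u\<close> is at most one up to probability \<open>O(t\<^sup>2)\<close>.
  If the only one has \<open>V\<^sub>n > u\<close>, the estimated coefficient is \<open>-1\<close> and the estimator collapses to the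
  expectation of the control, which is \<open>O(t)\<close>.  Hence the variance is that of the empirical mean of
  \<open>Z - W\<close> up to \<open>O(t\<^sup>2)\<close>, that is, \<open>P(V\<^sub>n \<le> u < V) / \<kappa>\<close> times the squared prefactor.
\<close>

section \<open>Tails of distributions on the half-line\<close>

text \<open>Everything is normalised by the tail of the one law \<open>interval_measure Fhe\<close>,
  so both claims become quotients of constants. If N is geometric with parameter r and the summands
  have tail ~ a t, then E[N + 2; N + 2 > n] = r^(n-1) (1 + n (1 - r)) / (1 - r), and the variance
  constant is r^4 a / \<kappa> times this. The new expansion has r = q and a = 1, the other one r =
  \<rho> and a = \<epsilon> \<theta> / \<rho>. Since (1 - \<rho>) / (1 - q) = 1 - \<rho>b and a = q
  (1 - \<rho>b) / \<rho>, the factor a takes one power off (q/\<rho>)^(n+3), which explains the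
  exponent n + 2. In the second claim r^4, a and \<kappa> cancel within each expansion, which leaves
  n - 1.

  The obstacle is that the estimated coefficient is a random quotient whose denominator is mostly 0
  for large u, and \<kappa> stays fixed, so averaging over many simulations does not help. Instead
  the estimator is shown to be bounded by twice the prefactor whatever the observations are; two or
  more hits, of probability O(t^2), then cannot disturb the variance at order t.\<close>

definition tail :: "real measure \<Rightarrow> real \<Rightarrow> real" where
  "tail M u = measure M {u<..}"

locale nonneg_distribution = real_distribution +
  assumes nonneg: "AE x in M. 0 \<le> x"
begin

lemma tail_eq: "tail M u = 1 - cdf M u"
proof -
  have "{u<..} = space M - {..u}" by auto
  then show ?thesis by (simp add: tail_def cdf_def prob_compl del: space_eq_univ)
qed

lemma tail_nonneg: "0 \<le> tail M u" by (simp add: tail_def)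

lemma tail_le_1: "tail M u \<le> 1" by (simp add: tail_def)

lemma tail_antimono: "u \<le> v \<Longrightarrow> tail M v \<le> tail M u"
  unfolding tail_def by (intro finite_measure_mono) auto

lemma tail_neg: "u < 0 \<Longrightarrow> tail M u = 1"
proof -
  assume "u < 0"
  then have "AE x in M. x \<in> {u<..}" using nonneg by auto
  moreover have "{u<..} \<in> sets M" by simp
  ultimately show ?thesis unfolding tail_def using prob_eq_1 by blast
qed

lemma tail_tendsto_0: "(tail M \<longlongrightarrow> 0) at_top"
proof -
  have "((\<lambda>u. 1 - cdf M u) \<longlongrightarrow> 1 - 1) at_top"
    by (intro tendsto_intros cdf_lim_at_top_prob)
  then show ?thesis by (simp add: tail_eq[abs_def])
qed

end

lemma nonneg_distributionI:
  assumes "real_distribution M" and neg: "\<And>x. x < 0 \<Longrightarrow> cdf M x = 0"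
  shows "nonneg_distribution M"
proof -
  interpret real_distribution M by fact
  \<comment> \<open>\<open>neg\<close> speaks of strictly negative points only, so the negative
    half-line is exhausted by the half-lines that end at -1/(n+1).\<close>
  have "AE x in M. - 1 / real (Suc n) < x" for n
  proof (rule AE_I[where N="{..- 1 / real (Suc n)}"])
    show "emeasure (M) {..- 1 / real (Suc n)} = 0"
      using neg[of "- 1 / real (Suc n)"] by (simp add: cdf_def2[symmetric] emeasure_eq_measure)
  qed auto
  then have "AE x in M. \<forall>n. - 1 / real (Suc n) < x"
    by (subst AE_all_countable) auto
  then have "AE x in M. 0 \<le> x"
  proof eventually_elim
    case (elim x)
    show ?case
    proof (rule ccontr)
      assume "\<not> 0 \<le> x"
      then obtain n where "inverse (real (Suc n)) < - x" using reals_Archimedean[of "- x"] by auto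
      with elim[rule_format, of n] show False by (simp add: field_simps)
    qed
  qed
  then show ?thesis by unfold_locales
qed

lemma (in prob_space) nonneg_distribution_distr:
  assumes "X \<in> borel_measurable M" "AE x in M. 0 \<le> X x"
  shows "nonneg_distribution (distr M borel X)"
proof -
  interpret D: real_distribution "distr M borel X" using assms by simp
  show ?thesis using assms by unfold_locales (simp add: AE_distr_iff)
qed

lemma tail_distr:
  assumes [measurable]: "X \<in> borel_measurable M"
  shows "tail (distr M borel X) u = measure M {x\<in>space M. u < X x}"
  unfolding tail_def by (subst measure_distr) (auto intro!: arg_cong[where f="measure M"])

lemma cdf_distr:
  assumes [measurable]: "X \<in> borel_measurable M"
  shows "cdf (distr M borel X) u = measure M {x\<in>space M. X x \<le> u}"
  unfolding cdf_def by (subst measure_distr) (auto intro!: arg_cong[where f="measure M"])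

lemma nonneg_distribution_return_0: "nonneg_distribution (return borel 0)"
proof -
  interpret prob_space "return borel (0::real)" by (rule prob_space_return) simp
  show ?thesis by unfold_locales (auto simp: AE_return)
qed

lemma tail_return_0: "tail (return borel 0) u = of_bool (u < 0)"
  by (simp add: tail_def measure_return)

section \<open>Sums of two independent nonnegative variables\<close>

lemma sum_events_borel [simp]:
  fixes u v :: real
  shows "{p. u < fst p + snd p} \<in> sets (borel \<Otimes>\<^sub>M borel)"
    and "{p. v < fst p \<and> v < snd p \<and> u < fst p + snd p} \<in> sets (borel \<Otimes>\<^sub>M borel)"
    and "{p. fst p \<le> u \<and> u < fst p + snd p} \<in> sets (borel \<Otimes>\<^sub>M borel)"
proof -
  have "{p \<in> space (borel \<Otimes>\<^sub>M borel). u < fst p + snd p} \<in> sets (borel \<Otimes>\<^sub>M borel)"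
    "{p \<in> space (borel \<Otimes>\<^sub>M borel). v < fst p \<and> v < snd p \<and> u < fst p + snd p} \<in> sets (borel \<Otimes>\<^sub>M borel)"
    "{p \<in> space (borel \<Otimes>\<^sub>M borel). fst p \<le> u \<and> u < fst p + snd p} \<in> sets (borel \<Otimes>\<^sub>M borel)"
    by measurable
  then show "{p. u < fst p + snd p} \<in> sets (borel \<Otimes>\<^sub>M borel)"
    "{p. v < fst p \<and> v < snd p \<and> u < fst p + snd p} \<in> sets (borel \<Otimes>\<^sub>M borel)"
    "{p. fst p \<le> u \<and> u < fst p + snd p} \<in> sets (borel \<Otimes>\<^sub>M borel)"
    by (simp_all add: space_pair_measure)
qed

locale nonneg_pair = X: nonneg_distribution H + Y: nonneg_distribution K for H K
begin

sublocale pair_prob_space H K ..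

lemma sets_pair [measurable_cong, simp]: "sets (H \<Otimes>\<^sub>M K) = sets (borel \<Otimes>\<^sub>M borel)"
  by (intro sets_pair_measure_cong) auto

lemma space_pair [simp]: "space (H \<Otimes>\<^sub>M K) = UNIV"
  by (simp add: space_pair_measure)

lemma tail_convolution: "tail (H \<star> K) u = prob {p. u < fst p + snd p}"
  unfolding tail_def convolution_def
  by (subst measure_distr) (auto intro!: arg_cong[where f=prob])

lemma AE_nonneg: "AE p in H \<Otimes>\<^sub>M K. 0 \<le> fst p \<and> 0 \<le> snd p"
proof (rule AE_pair_measure)
  show "AE x in H. AE y in K. 0 \<le> fst (x, y) \<and> 0 \<le> snd (x, y)"
    using X.nonneg Y.nonneg by simp
qed measurable

lemma prob_Times: "A \<in> sets borel \<Longrightarrow> B \<in> sets borel \<Longrightarrow> prob (A \<times> B) = measure H A * measure K B"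
  proof -
  assume "A \<in> sets borel" "B \<in> sets borel"
  then have "emeasure (H \<Otimes>\<^sub>M K) (A \<times> B) = emeasure H A * emeasure K B"
    by (intro Y.emeasure_pair_measure_Times) auto
  then show ?thesis
    by (simp add: emeasure_eq_measure X.emeasure_eq_measure Y.emeasure_eq_measure flip: ennreal_mult)
qed

lemma nonneg_distribution_convolution: "nonneg_distribution (H \<star> K)"
  unfolding convolution_def
proof (rule nonneg_distribution_distr)
  show "AE x in H \<Otimes>\<^sub>M K. 0 \<le> (case x of (x, y) \<Rightarrow> x + y)"
    using AE_nonneg by eventually_elim auto
qed measurable

lemma prob_le_tail_convolution:
  assumes "A \<in> events" "\<And>x y. (x, y) \<in> A \<Longrightarrow> 0 \<le> x \<Longrightarrow> 0 \<le> y \<Longrightarrow> u < x + y"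
  shows "prob A \<le> tail (H \<star> K) u"
  unfolding tail_convolution
proof (rule finite_measure_mono_AE)
  show "AE p in H \<Otimes>\<^sub>M K. p \<in> A \<longrightarrow> p \<in> {p. u < fst p + snd p}"
    using AE_nonneg by eventually_elim (use assms(2) in auto)
qed auto

text \<open>
  The probability that both summands contribute to the sum; it is monotone in either tail, so that
  it can be compared with the same quantity for two copies of a subexponential distribution.
\<close>

definition joint_tail :: "real \<Rightarrow> real \<Rightarrow> real" where
  "joint_tail v u = prob {p. v < fst p \<and> v < snd p \<and> u < fst p + snd p}"

text \<open>If a sum exceeds u while one summand is at most v, then the other one exceeds u -
  v.\<close>

lemma tail_convolution_le_joint: "tail (H \<star> K) u \<le> tail K (u - v) + tail H (u - v) + joint_tail v u"
proof -
  have "prob {p. u < fst p + snd p}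
      \<le> prob (UNIV \<times> {u - v<..} \<union> {u - v<..} \<times> UNIV \<union> {p. v < fst p \<and> v < snd p \<and> u < fst p + snd p})"
    by (rule finite_measure_mono) auto
  also have "\<dots> \<le> prob (UNIV \<times> {u - v<..} \<union> {u - v<..} \<times> UNIV) + joint_tail v u"
    unfolding joint_tail_def by (rule measure_Un_le) auto
  also have "prob (UNIV \<times> {u - v<..} \<union> {u - v<..} \<times> UNIV)
      \<le> prob (UNIV \<times> {u - v<..}) + prob ({u - v<..} \<times> UNIV)"
    by (rule measure_Un_le) auto
  also have "\<dots> = tail K (u - v) + tail H (u - v)"
    using X.prob_space Y.prob_space by (subst (1 2) prob_Times) (auto simp: tail_def)
  finally show ?thesis unfolding tail_convolution by simp
qed

text \<open>The terms belong to three events: one summand at most v and the other above u, in either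
  order, or both above v. For v \<ge> 0 the hypothesis gives v \<le> u, which separates the first
  two.\<close>

lemma tail_convolution_ge_joint:
  assumes "2 * v \<le> u"
  shows "cdf H v * tail K u + cdf K v * tail H u + joint_tail v u \<le> tail (H \<star> K) u"
proof -
  let ?A = "{..v} \<times> {u<..}" and ?B = "{u<..} \<times> {..v}"
  let ?J = "{p. v < fst p \<and> v < snd p \<and> u < fst p + snd p}"
  have sets: "?A \<in> events" "?B \<in> events" "?J \<in> events"
    by auto
  have "cdf H v * tail K u + cdf K v * tail H u + joint_tail v u = prob ?A + prob ?B + prob ?J"
    by (simp add: prob_Times tail_def cdf_def joint_tail_def)
  also have "\<dots> \<le> tail (H \<star> K) u"
  proof (cases "v < 0")
    \<comment> \<open>Below 0 the events may overlap, but the first two have probability 0.\<close>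
    case True
    have "cdf H v = 0" "cdf K v = 0"
      using True X.tail_neg[of v] Y.tail_neg[of v] by (simp_all add: X.tail_eq Y.tail_eq)
    then have "prob ?A = 0" "prob ?B = 0" by (simp_all add: prob_Times cdf_def)
    moreover have "prob ?J \<le> tail (H \<star> K) u"
      unfolding tail_convolution by (rule finite_measure_mono) auto
    ultimately show ?thesis by simp
  next
    case False
    with assms have "v \<le> u" by simp
    then have "prob ?A + prob ?B + prob ?J = prob (?A \<union> ?B \<union> ?J)"
      using sets by (subst finite_measure_Union, simp_all, force)
        (subst finite_measure_Union, simp_all, force)
    also have "\<dots> \<le> tail (H \<star> K) u"
      using sets False by (intro prob_le_tail_convolution) auto
    finally show ?thesis .
  qed
  finally show ?thesis .
qed

text \<open>A first summand in the middle range, above v and at most u, brings in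
  \<open>tail K (u - v)\<close>. With both laws equal to \<open>F\<close> the bound can be solved
  for that tail, which is how \<open>long_tailed\<close> arises.\<close>

lemma tail_convolution_ge_split:
  assumes "0 \<le> v" "v \<le> u"
  shows "tail H u + cdf H v * tail K u + (cdf H u - cdf H v) * tail K (u - v) \<le> tail (H \<star> K) u"
proof -
  let ?A = "{u<..} \<times> UNIV" and ?B = "{..v} \<times> {u<..}" and ?C = "{v<..u} \<times> {u - v<..}"
  have sets: "?A \<in> events" "?B \<in> events" "?C \<in> events" by auto
  have "measure H {v<..u} = cdf H u - cdf H v"
    using X.cdf_diff_eq[of v u] assms by (cases "v = u") auto
  then have "tail H u + cdf H v * tail K u + (cdf H u - cdf H v) * tail K (u - v) = prob ?A + prob ?B + prob ?C"
    using Y.prob_space by (simp add: prob_Times tail_def cdf_def)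
  also have "prob ?A + prob ?B = prob (?A \<union> ?B)"
    by (rule finite_measure_Union[symmetric]) (use sets assms in auto)
  also have "prob (?A \<union> ?B) + prob ?C = prob (?A \<union> ?B \<union> ?C)"
    by (rule finite_measure_Union[symmetric]) (use sets assms in auto)
  also have "\<dots> \<le> tail (H \<star> K) u"
    using sets assms by (intro prob_le_tail_convolution) auto
  finally show ?thesis .
qed

text \<open>Together with \<open>tail_convolution_ge_head\<close> this is an equality. Kesten's
  bound uses one half with second factor \<open>L k\<close> and the other with second factor
  \<open>F\<close>; in between, \<open>prob_pair_mono\<close> compares the two remainders.\<close>

lemma tail_convolution_le_head:
  "tail (H \<star> K) u \<le> tail H u + prob {p. fst p \<le> u \<and> u < fst p + snd p}"
proof -
  have "prob {p. u < fst p + snd p} \<le> prob ({u<..} \<times> UNIV \<union> {p. fst p \<le> u \<and> u < fst p + snd p})"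
    by (rule finite_measure_mono) auto
  also have "\<dots> \<le> prob ({u<..} \<times> UNIV) + prob {p. fst p \<le> u \<and> u < fst p + snd p}"
    by (rule measure_Un_le) auto
  finally show ?thesis using Y.prob_space by (simp add: tail_convolution prob_Times tail_def[of H])
qed

lemma tail_convolution_ge_head:
  "tail H u + prob {p. fst p \<le> u \<and> u < fst p + snd p} \<le> tail (H \<star> K) u"
proof -
  have "tail H u + prob {p. fst p \<le> u \<and> u < fst p + snd p}
      = prob ({u<..} \<times> UNIV \<union> {p. fst p \<le> u \<and> u < fst p + snd p})"
    using Y.prob_space
    by (subst finite_measure_Union) (auto simp: prob_Times tail_def)
  also have "\<dots> \<le> tail (H \<star> K) u"
    by (intro prob_le_tail_convolution) auto
  finally show ?thesis .
qed

end

text \<open>Domination of tails compares half-lines only, whence the condition on the sections of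
  \<open>A\<close>; Fubini then integrates the comparison over the common first factor.\<close>

lemma prob_pair_mono:
  assumes "nonneg_pair H K" "nonneg_pair H K'"
    and A [measurable]: "A \<in> sets (borel \<Otimes>\<^sub>M borel)"
    and sec: "\<And>x. Pair x -` A = {} \<or> (\<exists>w. Pair x -` A = {w<..})"
    and c: "0 \<le> c" "\<And>w. tail K w \<le> c * tail K' w"
  shows "measure (H \<Otimes>\<^sub>M K) A \<le> c * measure (H \<Otimes>\<^sub>M K') A"
proof -
  interpret HK: nonneg_pair H K by fact
  interpret HK': nonneg_pair H K' by fact
  have A1: "A \<in> sets (H \<Otimes>\<^sub>M K)" "A \<in> sets (H \<Otimes>\<^sub>M K')"
    using A by (simp_all add: HK.sets_pair HK'.sets_pair)
  have "emeasure K (Pair x -` A) \<le> ennreal c * emeasure K' (Pair x -` A)" for x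
  proof -
    have "emeasure K {w<..} \<le> ennreal c * emeasure K' {w<..}" for w
      using c(2)[of w] c(1)
      by (simp add: tail_def HK.Y.emeasure_eq_measure HK'.Y.emeasure_eq_measure
            flip: ennreal_mult)
    then show ?thesis using sec[of x] by auto
  qed
  then have "emeasure (H \<Otimes>\<^sub>M K) A \<le> (\<integral>\<^sup>+x. ennreal c * emeasure K' (Pair x -` A) \<partial>H)"
    unfolding HK.Y.emeasure_pair_measure_alt[OF A1(1)] by (intro nn_integral_mono)
  also have "\<dots> = ennreal c * emeasure (H \<Otimes>\<^sub>M K') A"
    unfolding HK'.Y.emeasure_pair_measure_alt[OF A1(2)]
    by (rule nn_integral_cmult) (rule HK'.Y.measurable_emeasure_Pair[OF A1(2)])
  finally show ?thesis
    using c(1) by (simp add: HK.emeasure_eq_measure HK'.emeasure_eq_measure flip: ennreal_mult)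
qed

lemma joint_tail_mono:
  assumes "nonneg_pair H K" "nonneg_pair H K'" "0 \<le> c" "\<And>w. tail K w \<le> c * tail K' w"
  shows "nonneg_pair.joint_tail H K v u \<le> c * nonneg_pair.joint_tail H K' v u"
  unfolding nonneg_pair.joint_tail_def[OF assms(1)] nonneg_pair.joint_tail_def[OF assms(2)]
proof (rule prob_pair_mono[OF assms(1,2) _ _ assms(3,4)])
  fix x
  have "Pair x -` {p. v < fst p \<and> v < snd p \<and> u < fst p + snd p} =
      (if v < x then {max v (u - x)<..} else {})"
    by (auto simp: algebra_simps)
  then show "Pair x -` {p. v < fst p \<and> v < snd p \<and> u < fst p + snd p} = {} \<or>
      (\<exists>w. Pair x -` {p. v < fst p \<and> v < snd p \<and> u < fst p + snd p} = {w<..})"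
    by auto
qed simp

text \<open>Allows \<open>joint_tail_mono\<close>, which exchanges the second factor, to be applied
  to the first one as well.\<close>

lemma joint_tail_commute:
  assumes "nonneg_pair H K"
  shows "nonneg_pair.joint_tail H K v u = nonneg_pair.joint_tail K H v u"
proof -
  interpret HK: nonneg_pair H K by fact
  interpret KH: nonneg_pair K H ..
  have "HK.joint_tail v u = measure (distr (K \<Otimes>\<^sub>M H) (H \<Otimes>\<^sub>M K) (\<lambda>(x, y). (y, x)))
      {p. v < fst p \<and> v < snd p \<and> u < fst p + snd p}"
    unfolding HK.joint_tail_def by (subst HK.distr_pair_swap[symmetric]) rule
  also have "\<dots> = KH.joint_tail v u"
    unfolding KH.joint_tail_def
    by (subst measure_distr) (auto intro!: arg_cong[where f="measure _"] simp: add.commute)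
  finally show ?thesis .
qed

section \<open>Passage between distribution functions and measures on the half-line\<close>

lemma distribution_function_cdf:
  assumes "nonneg_distribution M"
  shows "distribution_function (cdf M)"
proof -
  interpret nonneg_distribution M by fact
  show ?thesis
    unfolding distribution_function_def
    using cdf_nondecreasing cdf_is_right_cont cdf_lim_at_top_prob tail_neg
    by (auto intro!: monoI simp: tail_eq)
qed

lemma
  assumes "distribution_function F"
  shows nonneg_distribution_interval_measure: "nonneg_distribution (interval_measure F)"
    and cdf_interval_measure_distribution_function: "cdf (interval_measure F) = F"
proof -
  have F: "\<And>x y. x \<le> y \<Longrightarrow> F x \<le> F y" "\<And>a. continuous (at_right a) F" "(F \<longlongrightarrow> 1) at_top"
    and neg: "\<And>x. x < 0 \<Longrightarrow> F x = 0"
    using assms by (auto simp: distribution_function_def mono_def)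
  have bot: "(F \<longlongrightarrow> 0) at_bot"
    by (rule tendsto_eventually) (use eventually_gt_at_bot[of 0] neg in \<open>auto simp: eventually_at_bot_linorder intro!: exI[of _ "-1"]\<close>)
  interpret real_distribution "interval_measure F"
    using F bot by (intro real_distribution_interval_measure) auto
  show cdf: "cdf (interval_measure F) = F" using F bot by (intro cdf_interval_measure) auto
  show "nonneg_distribution (interval_measure F)"
    using cdf neg by (intro nonneg_distributionI real_distribution_axioms) simp
qed

section \<open>Subexponential distributions\<close>

text \<open>For bounds that depend on a truncation level v: u tends to infinity at fixed v, and only
  afterwards v does. At a single v the two limits may enclose \<open>x\<close> without being equal
  to it.\<close>

lemma tendsto_sandwich_iterated:
  fixes f :: "real \<Rightarrow> real"
  assumes "\<And>v. 0 < v \<Longrightarrow> \<forall>\<^sub>F u in at_top. L v u \<le> f u \<and> f u \<le> R v u"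
    and "\<And>v. 0 < v \<Longrightarrow> (L v \<longlongrightarrow> l v) at_top" "\<And>v. 0 < v \<Longrightarrow> (R v \<longlongrightarrow> r v) at_top"
    and l: "(l \<longlongrightarrow> x) at_top" and r: "(r \<longlongrightarrow> x) (at_top :: real filter)"
  shows "(f \<longlongrightarrow> x) at_top"
proof (rule order_tendstoI)
  fix a assume "a < x"
  then have "\<forall>\<^sub>F v in at_top. a < l v \<and> 0 < v"
    using order_tendstoD(1)[OF l] eventually_gt_at_top[of 0] by (auto intro: eventually_conj)
  then obtain v where v: "a < l v" "0 < v"
    using eventually_happens trivial_limit_at_top_linorder by blast
  from order_tendstoD(1)[OF assms(2)[OF v(2)] v(1)] assms(1)[OF v(2)]
  show "\<forall>\<^sub>F u in at_top. a < f u" by eventually_elim auto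
next
  fix a assume "x < a"
  then have "\<forall>\<^sub>F v in at_top. r v < a \<and> 0 < v"
    using order_tendstoD(2)[OF r] eventually_gt_at_top[of 0] by (auto intro: eventually_conj)
  then obtain v where v: "r v < a" "0 < v"
    using eventually_happens trivial_limit_at_top_linorder by blast
  from order_tendstoD(2)[OF assms(3)[OF v(2)] v(1)] assms(1)[OF v(2)]
  show "\<forall>\<^sub>F u in at_top. f u < a" by eventually_elim auto
qed

text \<open>Subexponentiality of a measure, expressed through two summands. Positivity of the tail
  makes every quotient by \<open>tail F u\<close> a genuine one.\<close>

locale subexponential_distribution = nonneg_distribution F for F +
  assumes tail_pos: "0 < tail F u"
    and tail_double: "((\<lambda>u. tail (F \<star> F) u / tail F u) \<longlongrightarrow> 2) at_top"
begin

sublocale FF: nonneg_pair F F ..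

lemma cdf_less_1: "cdf F u < 1"
  using tail_pos[of u] by (simp add: tail_eq)

text \<open>Monotonicity bounds the ratio below by 1. Solving
  \<open>tail_convolution_ge_split\<close> for it gives an upper bound with limit (2 - 1 - F(v)) /
  (1 - F(v)) = 1, where F(v) is \<open>cdf F v\<close>.\<close>

lemma long_tailed:
  assumes "0 < v"
  shows "((\<lambda>u. tail F (u - v) / tail F u) \<longlongrightarrow> 1) at_top"
proof (rule tendsto_sandwich)
  show "\<forall>\<^sub>F u in at_top. 1 \<le> tail F (u - v) / tail F u"
    using tail_antimono[of "u - v" u for u] tail_pos assms by (auto simp: field_simps)
  have lim: "(cdf F \<longlongrightarrow> 1) at_top" by (rule cdf_lim_at_top_prob)
  show "\<forall>\<^sub>F u in at_top. tail F (u - v) / tail F u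
      \<le> (tail (F \<star> F) u / tail F u - 1 - cdf F v) / (cdf F u - cdf F v)"
    using order_tendstoD(1)[OF lim cdf_less_1[of v]] eventually_ge_at_top[of v]
  proof eventually_elim
    case (elim u)
    have "(cdf F u - cdf F v) * tail F (u - v) / tail F u \<le> (tail (F \<star> F) u - tail F u - cdf F v * tail F u) / tail F u"
      using FF.tail_convolution_ge_split[of v u] assms elim tail_pos[of u] by (intro divide_right_mono) auto
    then have "(cdf F u - cdf F v) * (tail F (u - v) / tail F u) \<le> tail (F \<star> F) u / tail F u - 1 - cdf F v"
      using tail_pos[of u] by (simp add: diff_divide_distrib)
    then show ?case using elim(1) by (simp add: pos_le_divide_eq mult.commute)
  qed
  have "((\<lambda>u. (tail (F \<star> F) u / tail F u - 1 - cdf F v) / (cdf F u - cdf F v))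
      \<longlongrightarrow> (2 - 1 - cdf F v) / (1 - cdf F v)) at_top"
    using cdf_less_1[of v] by (intro tendsto_intros tail_double lim) auto
  then show "((\<lambda>u. (tail (F \<star> F) u / tail F u - 1 - cdf F v) / (cdf F u - cdf F v)) \<longlongrightarrow> 1) at_top"
    using cdf_less_1[of v] by simp
qed auto

lemma tail_shift:
  assumes "((\<lambda>u. tail H u / tail F u) \<longlongrightarrow> a) at_top" "0 < v"
  shows "((\<lambda>u. tail H (u - v) / tail F u) \<longlongrightarrow> a) at_top"
proof -
  have "filterlim (\<lambda>u. u - v) at_top at_top"
    using filterlim_tendsto_add_at_top[OF tendsto_const[of "-v"] filterlim_ident] by simp
  from filterlim_compose[OF assms(1) this]
  have "((\<lambda>u. tail H (u - v) / tail F (u - v) * (tail F (u - v) / tail F u)) \<longlongrightarrow> a * 1) at_top"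
    by (intro tendsto_mult long_tailed assms)
  moreover have "tail H (u - v) / tail F (u - v) * (tail F (u - v) / tail F u) = tail H (u - v) / tail F u" for u
    using tail_pos[of "u - v"] by simp
  ultimately show ?thesis by (simp only: mult_1_right)
qed

lemma tail_dominated:
  assumes H: "nonneg_distribution H" and lim: "((\<lambda>u. tail H u / tail F u) \<longlongrightarrow> a) at_top"
  obtains c where "0 < c" "\<And>u. tail H u \<le> c * tail F u"
proof -
  interpret H: nonneg_distribution H by fact
  from order_tendstoD(2)[OF lim, of "\<bar>a\<bar> + 1"]
  obtain T where T: "\<And>u. T \<le> u \<Longrightarrow> tail H u / tail F u < \<bar>a\<bar> + 1"
    by (fastforce simp: eventually_at_top_linorder)
  \<comment> \<open>Beyond T the part \<open>\<bar>a\<bar> + 1\<close> suffices. Below T the tail of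
    \<open>H\<close> is at most 1, while \<open>tail F u\<close> is at least
    \<open>tail F T\<close>.\<close>
  define c where "c = \<bar>a\<bar> + 1 + 1 / tail F T"
  have "tail H u \<le> c * tail F u" for u
  proof (cases "T \<le> u")
    case True
    then have "tail H u \<le> (\<bar>a\<bar> + 1) * tail F u"
      using T[OF True] tail_pos[of u] by (simp add: field_simps)
    also have "\<dots> \<le> c * tail F u"
      using tail_pos[of u] tail_pos[of T] by (intro mult_right_mono) (auto simp: c_def)
    finally show ?thesis .
  next
    case False
    then have "tail H u \<le> 1 / tail F T * tail F u"
      using H.tail_le_1[of u] tail_antimono[of u T] tail_pos[of T] order_trans[of "tail H u" 1 "tail F u / tail F T"]
      by simp
    also have "\<dots> \<le> c * tail F u"
      using tail_pos[of u] by (intro mult_right_mono) (auto simp: c_def)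
    finally show ?thesis .
  qed
  moreover have "0 < c" using tail_pos[of T] by (simp add: c_def add_pos_pos add_nonneg_pos)
  ultimately show thesis using that by blast
qed

text \<open>Single big jump: up to a shift by v, one summand does all the work. The event that both
  exceed v is compared with the same event for two copies of \<open>F\<close>, where the doubling of
  the tail leaves at most (2 - 2 F(v)) times the tail in the limit; this vanishes as v
  grows.\<close>

theorem tail_convolution_asymp:
  assumes H: "nonneg_distribution H" and K: "nonneg_distribution K"
    and a: "((\<lambda>u. tail H u / tail F u) \<longlongrightarrow> a) at_top"
    and b: "((\<lambda>u. tail K u / tail F u) \<longlongrightarrow> b) at_top"
  shows "((\<lambda>u. tail (H \<star> K) u / tail F u) \<longlongrightarrow> a + b) at_top"
proof -
  interpret H: nonneg_distribution H by fact
  interpret K: nonneg_distribution K by fact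
  interpret HK: nonneg_pair H K ..
  interpret HF: nonneg_pair H F ..
  interpret FH: nonneg_pair F H ..
  obtain c where c: "0 < c" "\<And>u. tail H u \<le> c * tail F u" using tail_dominated[OF H a] by blast
  obtain d where d: "0 < d" "\<And>u. tail K u \<le> d * tail F u" using tail_dominated[OF K b] by blast
  \<comment> \<open>The factors are replaced by \<open>F\<close> one at a time, with a swap in
    between; this costs the constants d and c.\<close>
  have J: "HK.joint_tail v u \<le> c * d * (tail (F \<star> F) u - 2 * (cdf F v * tail F u))" if "2 * v \<le> u" for v u
  proof -
    have "HK.joint_tail v u \<le> d * HF.joint_tail v u"
      by (rule joint_tail_mono) (use d in \<open>auto intro: HK.nonneg_pair_axioms HF.nonneg_pair_axioms\<close>)
    also have "HF.joint_tail v u = FH.joint_tail v u"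
      by (rule joint_tail_commute) (rule HF.nonneg_pair_axioms)
    also have "\<dots> \<le> c * FF.joint_tail v u"
      by (rule joint_tail_mono) (use c in \<open>auto intro: FH.nonneg_pair_axioms FF.nonneg_pair_axioms\<close>)
    also have "FF.joint_tail v u \<le> tail (F \<star> F) u - 2 * (cdf F v * tail F u)"
      using FF.tail_convolution_ge_joint[OF that] by linarith
    finally show ?thesis using c d by (simp add: mult_ac)
  qed
  show ?thesis
  proof (rule tendsto_sandwich_iterated)
    fix v :: real assume "0 < v"
    show "\<forall>\<^sub>F u in at_top.
        cdf H v * (tail K u / tail F u) + cdf K v * (tail H u / tail F u) \<le> tail (H \<star> K) u / tail F u \<and>
        tail (H \<star> K) u / tail F u \<le> tail K (u - v) / tail F u + tail H (u - v) / tail F u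
          + c * d * (tail (F \<star> F) u / tail F u - 2 * cdf F v)"
      using eventually_ge_at_top[of "2 * v"]
    proof eventually_elim
      case (elim u)
      have "cdf H v * tail K u + cdf K v * tail H u \<le> tail (H \<star> K) u"
        using HK.tail_convolution_ge_joint[OF elim] by (simp add: HK.joint_tail_def) (smt (verit) measure_nonneg)
      moreover have "tail (H \<star> K) u \<le> tail K (u - v) + tail H (u - v) + c * d * (tail (F \<star> F) u - 2 * (cdf F v * tail F u))"
        using HK.tail_convolution_le_joint[of u v] J[OF elim] by simp
      ultimately have "(cdf H v * tail K u + cdf K v * tail H u) / tail F u \<le> tail (H \<star> K) u / tail F u"
        "tail (H \<star> K) u / tail F u \<le> (tail K (u - v) + tail H (u - v) + c * d * (tail (F \<star> F) u - 2 * (cdf F v * tail F u))) / tail F u"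
        using tail_pos[of u] by (auto intro!: divide_right_mono)
      moreover have "(tail (F \<star> F) u - 2 * (cdf F v * tail F u)) / tail F u = tail (F \<star> F) u / tail F u - 2 * cdf F v"
        using tail_pos[of u] by (simp add: field_simps)
      ultimately show ?case by (simp add: add_divide_distrib flip: times_divide_eq_right)
    qed
    show "((\<lambda>u. cdf H v * (tail K u / tail F u) + cdf K v * (tail H u / tail F u))
        \<longlongrightarrow> cdf H v * b + cdf K v * a) at_top"
      by (intro tendsto_intros a b)
    show "((\<lambda>u. tail K (u - v) / tail F u + tail H (u - v) / tail F u
          + c * d * (tail (F \<star> F) u / tail F u - 2 * cdf F v))
        \<longlongrightarrow> b + a + c * d * (2 - 2 * cdf F v)) at_top"
      using \<open>0 < v\<close> by (intro tendsto_intros tail_shift a b tail_double)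
  next
    have "((\<lambda>v. cdf H v * b + cdf K v * a) \<longlongrightarrow> 1 * b + 1 * a) at_top"
      by (intro tendsto_intros H.cdf_lim_at_top_prob K.cdf_lim_at_top_prob)
    then show "((\<lambda>v. cdf H v * b + cdf K v * a) \<longlongrightarrow> a + b) at_top" by (simp add: add.commute)
    have "((\<lambda>v. b + a + c * d * (2 - 2 * cdf F v)) \<longlongrightarrow> b + a + c * d * (2 - 2 * 1)) at_top"
      by (intro tendsto_intros cdf_lim_at_top_prob)
    then show "((\<lambda>v. b + a + c * d * (2 - 2 * cdf F v)) \<longlongrightarrow> a + b) at_top" by (simp add: add.commute)
  qed
qed

section \<open>Iterated convolutions, Kesten's bound and geometric sums\<close>

text \<open>The initial law \<open>L 0\<close> is left free: it is the point mass at 0 for the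
  Pollaczek--Khinchine sum and for M, and the law of \<open>Mb 0\<close> for the new
  expansion.\<close>

lemma iterated_convolution:
  assumes H: "nonneg_distribution H" and L: "nonneg_distribution (L 0)"
    and L_Suc: "\<And>k. L (Suc k) = (H \<star> L k)"
    and a: "((\<lambda>u. tail H u / tail F u) \<longlongrightarrow> a) at_top"
    and b: "((\<lambda>u. tail (L 0) u / tail F u) \<longlongrightarrow> b) at_top"
  shows "nonneg_distribution (L k)" and "((\<lambda>u. tail (L k) u / tail F u) \<longlongrightarrow> b + real k * a) at_top"
proof -
  show Lk: "nonneg_distribution (L k)" for k
  proof (induction k)
    case (Suc k)
    interpret H: nonneg_distribution H by fact
    interpret L: nonneg_distribution "L k" by fact
    interpret nonneg_pair H "L k" ..
    show ?case unfolding L_Suc by (rule nonneg_distribution_convolution)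
  qed (rule L)
  show "((\<lambda>u. tail (L k) u / tail F u) \<longlongrightarrow> b + real k * a) at_top"
  proof (induction k)
    case (Suc k)
    have "((\<lambda>u. tail (H \<star> L k) u / tail F u) \<longlongrightarrow> a + (b + real k * a)) at_top"
      by (intro tail_convolution_asymp H Lk a Suc)
    then show ?case by (simp add: L_Suc algebra_simps)
  qed (use b in simp)
qed

text \<open>If \<alpha> dominates the ratio for \<open>L k\<close>, splitting at the head gives
  \<open>tail (L (Suc k)) u\<close> at most
  \<open>tail H u + \<alpha> * (tail (H \<star> F) u - tail H u)\<close>. The bracket divided by
  \<open>tail F u\<close> tends to (a + 1) - a = 1, so beyond some T each further convolution costs
  a factor 1 + \<delta> and an additive constant.\<close>

lemma kesten_bound:
  assumes H: "nonneg_distribution H" and L: "nonneg_distribution (L 0)"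
    and L_Suc: "\<And>k. L (Suc k) = (H \<star> L k)"
    and a: "((\<lambda>u. tail H u / tail F u) \<longlongrightarrow> a) at_top"
    and b: "((\<lambda>u. tail (L 0) u / tail F u) \<longlongrightarrow> b) at_top"
    and "0 < \<delta>"
  obtains A where "0 < A" "\<And>k u. tail (L k) u \<le> A * (1 + \<delta>) ^ k * tail F u"
proof -
  interpret H: nonneg_distribution H by fact
  interpret HF: nonneg_pair H F ..
  note Lk = iterated_convolution(1)[OF H L L_Suc a b]
  have "((\<lambda>u. tail (H \<star> F) u / tail F u) \<longlongrightarrow> a + 1) at_top"
    using tail_pos by (intro tail_convolution_asymp H a nonneg_distribution_axioms) (simp add: less_imp_neq[symmetric])
  from tendsto_diff[OF this a]
  have "((\<lambda>u. (tail (H \<star> F) u - tail H u) / tail F u) \<longlongrightarrow> 1) at_top"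
    by (simp add: diff_divide_distrib)
  from order_tendstoD(2)[OF this, of "1 + \<delta>"] \<open>0 < \<delta>\<close>
  obtain T where T: "\<And>u. T \<le> u \<Longrightarrow> (tail (H \<star> F) u - tail H u) / tail F u < 1 + \<delta>"
    by (fastforce simp: eventually_at_top_linorder)
  obtain c where c: "0 < c" "\<And>u. tail H u \<le> c * tail F u" using tail_dominated[OF H a] by blast
  obtain d where d: "0 < d" "\<And>u. tail (L 0) u \<le> d * tail F u" using tail_dominated[OF L b] by blast
  \<comment> \<open>The term c pays for \<open>tail H u\<close> beyond T, the other one for the
    trivial bound 1 below T.\<close>
  define R where "R = c + 1 / tail F T"
  have "0 < R" using c tail_pos[of T] by (simp add: R_def add_pos_pos)
  \<comment> \<open>The map x -> (1 + \<delta>) x + R has fixed point -R/\<delta>; A is chosen so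
    that A - R/\<delta> is the initial constant d.\<close>
  define A where "A = d + R / \<delta>"
  have "0 < A" using d \<open>0 < R\<close> \<open>0 < \<delta>\<close> by (simp add: A_def add_pos_pos)
  have dpos: "0 \<le> A * (1 + \<delta>) ^ k - R / \<delta>" for k
  proof -
    have "A * 1 \<le> A * (1 + \<delta>) ^ k"
      using \<open>0 < A\<close> \<open>0 < \<delta>\<close> by (intro mult_left_mono one_le_power) auto
    then show ?thesis using d by (simp add: A_def)
  qed
  \<comment> \<open>the coefficient solves the recursion \<open>\<alpha>' = (1 + \<delta>) \<alpha> + R\<close>\<close>
  have "tail (L k) u \<le> (A * (1 + \<delta>) ^ k - R / \<delta>) * tail F u" for k u
  proof (induction k arbitrary: u)
    case 0
    then show ?case using d by (simp add: A_def)
  next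
    case (Suc k)
    interpret Lk: nonneg_distribution "L k" by (rule Lk)
    interpret HL: nonneg_pair H "L k" ..
    define \<alpha> where "\<alpha> = A * (1 + \<delta>) ^ k - R / \<delta>"
    have \<alpha>: "0 \<le> \<alpha>" "\<And>u. tail (L k) u \<le> \<alpha> * tail F u"
      using dpos[of k] Suc by (simp_all add: \<alpha>_def)
    have eq: "A * (1 + \<delta>) ^ Suc k - R / \<delta> = (1 + \<delta>) * \<alpha> + R"
      using \<open>0 < \<delta>\<close> by (simp add: \<alpha>_def field_simps)
    show ?case
    proof (cases "T \<le> u")
      case True
      have "tail (L (Suc k)) u \<le> tail H u + HL.prob {p. fst p \<le> u \<and> u < fst p + snd p}"
        unfolding L_Suc by (rule HL.tail_convolution_le_head)
      also have "HL.prob {p. fst p \<le> u \<and> u < fst p + snd p} \<le> \<alpha> * HF.prob {p. fst p \<le> u \<and> u < fst p + snd p}"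
      proof (rule prob_pair_mono)
        fix x
        have "Pair x -` {p. fst p \<le> u \<and> u < fst p + snd p} = (if x \<le> u then {u - x<..} else {})"
          by (auto simp: algebra_simps)
        then show "Pair x -` {p. fst p \<le> u \<and> u < fst p + snd p} = {} \<or>
            (\<exists>w. Pair x -` {p. fst p \<le> u \<and> u < fst p + snd p} = {w<..})"
          by auto
      qed (use \<alpha> HL.nonneg_pair_axioms HF.nonneg_pair_axioms in auto)
      also have "\<dots> \<le> \<alpha> * (tail (H \<star> F) u - tail H u)"
        using HF.tail_convolution_ge_head[of u] \<alpha> by (intro mult_left_mono) auto
      also have "\<dots> \<le> \<alpha> * ((1 + \<delta>) * tail F u)"
        using T[OF True] tail_pos[of u] \<alpha> by (intro mult_left_mono) (auto simp: field_simps)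
      also have "tail H u \<le> R * tail F u"
        using c(2)[of u] tail_pos[of u] tail_pos[of T] by (simp add: R_def distrib_right add_increasing2)
      finally show ?thesis unfolding eq by (simp add: algebra_simps)
    next
      case False
      interpret LS: nonneg_distribution "L (Suc k)" by (rule Lk)
      have "tail (L (Suc k)) u \<le> 1 / tail F T * tail F u"
        using LS.tail_le_1[of u] False tail_antimono[of u T] tail_pos[of T]
          order_trans[of "tail (L (Suc k)) u" 1 "tail F u / tail F T"] by simp
      also have "\<dots> \<le> R * tail F u"
        using tail_pos[of u] c by (intro mult_right_mono) (auto simp: R_def)
      also have "\<dots> \<le> ((1 + \<delta>) * \<alpha> + R) * tail F u"
        using tail_pos[of u] \<alpha>(1) \<open>0 < \<delta>\<close> by (intro mult_right_mono) auto
      finally show ?thesis unfolding eq .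
    qed
  qed
  moreover have "(A * (1 + \<delta>) ^ k - R / \<delta>) * tail F u \<le> A * (1 + \<delta>) ^ k * tail F u" for k u
    using tail_pos[of u] \<open>0 < R\<close> \<open>0 < \<delta>\<close> by (intro mult_right_mono) auto
  ultimately have "tail (L k) u \<le> A * (1 + \<delta>) ^ k * tail F u" for k u
    using order_trans by blast
  then show thesis using that \<open>0 < A\<close> by blast
qed

text \<open>Dominated convergence for series: Kesten's bound with r (1 + \<delta>) < 1 makes the
  majorant geometric. The shift m is 0 for the law of M and 2 for sums with N + 2 terms.\<close>

theorem geometric_sum_tail_asymp:
  assumes H: "nonneg_distribution H" and L: "nonneg_distribution (L 0)"
    and L_Suc: "\<And>k. L (Suc k) = (H \<star> L k)"
    and a: "((\<lambda>u. tail H u / tail F u) \<longlongrightarrow> a) at_top"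
    and b: "((\<lambda>u. tail (L 0) u / tail F u) \<longlongrightarrow> b) at_top"
    and r: "0 \<le> r" "r < 1"
  shows "((\<lambda>u. (\<Sum>k. r ^ k * tail (L (k + m)) u) / tail F u)
    \<longlongrightarrow> (\<Sum>k. r ^ k * (b + real (k + m) * a))) at_top"
proof -
  \<comment> \<open>The choice (1 - r) / (2 r) makes r (1 + \<delta>) the midpoint of r and 1; r = 0
    is treated apart because of the division.\<close>
  obtain \<delta> where \<delta>: "0 < \<delta>" "r * (1 + \<delta>) < 1"
  proof (cases "r = 0")
    case True
    then show thesis using that[of 1] by simp
  next
    case False
    then show thesis using r that[of "(1 - r) / (2 * r)"] by (simp add: field_simps)
  qed
  obtain A where A: "0 < A" "\<And>k u. tail (L k) u \<le> A * (1 + \<delta>) ^ k * tail F u"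
    using kesten_bound[of H L, OF H L L_Suc a b \<delta>(1)] by blast
  note Lk = iterated_convolution[of H L, OF H L L_Suc a b]
  have dom: "\<bar>r ^ k * tail (L (k + m)) u / tail F u\<bar> \<le> A * (1 + \<delta>) ^ m * (r * (1 + \<delta>)) ^ k" for k u
  proof -
    interpret Lk: nonneg_distribution "L (k + m)" by (rule Lk)
    have "r ^ k * tail (L (k + m)) u / tail F u \<le> r ^ k * (A * (1 + \<delta>) ^ (k + m) * tail F u) / tail F u"
      using A r tail_pos[of u] by (intro divide_right_mono mult_left_mono) auto
    then show ?thesis
      using r tail_pos[of u] Lk.tail_nonneg[of u] by (simp add: power_add power_mult_distrib mult_ac)
  qed
  have sumd: "summable (\<lambda>k. A * (1 + \<delta>) ^ m * (r * (1 + \<delta>)) ^ k)"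
    using r \<delta> by (intro summable_mult summable_geometric) simp
  have "((\<lambda>u. \<Sum>k. r ^ k * tail (L (k + m)) u / tail F u)
      \<longlongrightarrow> (\<Sum>k. r ^ k * (b + real (k + m) * a))) at_top"
  proof (rule tannerys_theorem[where M="\<lambda>k. A * (1 + \<delta>) ^ m * (r * (1 + \<delta>)) ^ k" and F=at_top, THEN conjunct2, THEN conjunct2])
    fix k show "((\<lambda>u. r ^ k * tail (L (k + m)) u / tail F u) \<longlongrightarrow> r ^ k * (b + real (k + m) * a)) at_top"
      using tendsto_mult[OF tendsto_const[of "r ^ k"] Lk(2)[of "k + m"]] by simp
  next
    show "\<forall>\<^sub>F (k, u) in sequentially \<times>\<^sub>F at_top.
        norm (r ^ k * tail (L (k + m)) u / tail F u) \<le> A * (1 + \<delta>) ^ m * (r * (1 + \<delta>)) ^ k"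
      using dom by (intro always_eventually) auto
  qed (use sumd in auto)
  moreover have "(\<Sum>k. r ^ k * tail (L (k + m)) u / tail F u) = (\<Sum>k. r ^ k * tail (L (k + m)) u) / tail F u" for u
  proof (rule suminf_divide)
    have "summable (\<lambda>k. r ^ k * tail (L (k + m)) u)"
    proof (rule summable_comparison_test'[where g="\<lambda>k. r ^ k"])
      fix k
      interpret Lk: nonneg_distribution "L (k + m)" by (rule Lk)
      show "norm (r ^ k * tail (L (k + m)) u) \<le> r ^ k"
        using r Lk.tail_nonneg[of u] Lk.tail_le_1[of u] by (simp add: mult_left_le)
    qed (use r in \<open>simp add: summable_geometric\<close>)
    then show "summable (\<lambda>k. r ^ k * tail (L (k + m)) u)" .
  qed
  ultimately show ?thesis by simp
qed

text \<open>A long tail decays more slowly than any exponential, since far out a unit step costs a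
  factor as close to 1 as desired. Comparison with half the rate \<eta> leaves a factor that still
  tends to 0.\<close>

lemma exponential_tail_negligible:
  assumes "0 < \<eta>" and bound: "\<And>u. 0 \<le> u \<Longrightarrow> h u \<le> c * exp (- \<eta> * u)" and nn: "\<And>u. 0 \<le> h u"
  shows "((\<lambda>u. h u / tail F u) \<longlongrightarrow> 0) at_top"
proof -
  \<comment> \<open>The loss allowed per unit step, corresponding to decay at rate \<eta>/2.\<close>
  define \<beta> where "\<beta> = exp (- \<eta> / 2)"
  have \<beta>: "0 < \<beta>" "\<beta> < 1" using \<open>0 < \<eta>\<close> by (auto simp: \<beta>_def)
  have "\<forall>\<^sub>F u in at_top. tail F (u - 1) / tail F u < 1 / \<beta>"
    using \<beta> by (intro order_tendstoD(2)[OF long_tailed]) auto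
  then obtain T where T: "\<And>u. T \<le> u \<Longrightarrow> tail F (u - 1) / tail F u < 1 / \<beta>"
    by (auto simp: eventually_at_top_linorder)
  have step: "\<beta> ^ k * tail F T \<le> tail F (T + real k)" for k
  proof (induction k)
    case (Suc k)
    have "\<beta> * tail F (T + real k) \<le> tail F (T + real (Suc k))"
      using T[of "T + real (Suc k)"] tail_pos[of "T + real (Suc k)"] \<beta> by (simp add: field_simps)
    moreover have "\<beta> * (\<beta> ^ k * tail F T) \<le> \<beta> * tail F (T + real k)"
      using \<beta> by (intro mult_left_mono Suc) auto
    ultimately show ?case by (simp add: mult.assoc)
  qed simp
  \<comment> \<open>The factor \<beta> pays for rounding u - T up to an integer number of
    steps.\<close>
  define D where "D = \<beta> * exp (\<eta> / 2 * T) * tail F T"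
  have "0 < D" using \<beta> tail_pos by (simp add: D_def)
  have lower: "D * exp (- \<eta> / 2 * u) \<le> tail F u" if "T \<le> u" for u
  proof -
    define k where "k = nat \<lceil>u - T\<rceil>"
    have k: "u \<le> T + real k" "real k \<le> u - T + 1" using that unfolding k_def by linarith+
    have "D * exp (- \<eta> / 2 * u) = exp (- \<eta> / 2 * (u - T + 1)) * tail F T"
      by (simp add: D_def \<beta>_def field_simps flip: exp_add)
    also have "\<dots> \<le> exp (- \<eta> / 2 * real k) * tail F T"
      using k tail_pos[of T] \<open>0 < \<eta>\<close> by (intro mult_right_mono) auto
    also have "exp (- \<eta> / 2 * real k) = \<beta> ^ k"
      unfolding \<beta>_def by (simp add: exp_of_nat_mult[symmetric] mult.commute)
    also have "\<beta> ^ k * tail F T \<le> tail F (T + real k)" by (rule step)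
    also have "\<dots> \<le> tail F u" using k by (intro tail_antimono)
    finally show ?thesis .
  qed
  show ?thesis
  proof (rule tendsto_sandwich)
    show "\<forall>\<^sub>F u in at_top. 0 \<le> h u / tail F u"
      using nn tail_pos by (simp add: less_imp_le)
    show "\<forall>\<^sub>F u in at_top. h u / tail F u \<le> c / D * exp (- (\<eta> / 2) * u)"
      using eventually_ge_at_top[of T] eventually_ge_at_top[of 0]
    proof eventually_elim
      case (elim u)
      have "0 \<le> c * exp (- \<eta> * u)" using bound[OF elim(2)] nn[of u] by linarith
      have "h u / tail F u \<le> (c * exp (- \<eta> * u)) / (D * exp (- \<eta> / 2 * u))"
        using bound[OF elim(2)] lower[OF elim(1)] \<open>0 < D\<close> nn[of u] by (intro frac_le) auto
      also have "\<dots> = c / D * exp (- \<eta> * u - (- \<eta> / 2 * u))" unfolding exp_diff by simp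
      also have "- \<eta> * u - (- \<eta> / 2 * u) = - (\<eta> / 2) * u" by (simp add: field_simps)
      finally show ?case .
    qed
    have "((\<lambda>u. exp (- (\<eta> / 2) * u)) \<longlongrightarrow> 0) at_top"
    proof (rule filterlim_compose[OF exp_at_bot])
      show "LIM u at_top. - (\<eta> / 2) * u :> at_bot"
        using \<open>0 < \<eta>\<close> by (intro filterlim_tendsto_neg_mult_at_bot[OF tendsto_const _ filterlim_ident]) auto
    qed
    from tendsto_mult[OF tendsto_const[of "c / D"] this]
    show "((\<lambda>u. c / D * exp (- (\<eta> / 2) * u)) \<longlongrightarrow> 0) at_top" by simp
  qed simp
qed

end

section \<open>From the definition of subexponentiality to the locale\<close>

lemma convolution_return_0:
  assumes "real_distribution M"
  shows "(M \<star> return borel 0) = M"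
proof (rule measure_eqI)
  interpret real_distribution M by fact
  interpret R: prob_space "return borel (0::real)" by (rule prob_space_return) simp
  show "sets (M \<star> return borel 0) = sets M" by simp
  fix A assume "A \<in> sets (M \<star> return borel 0)"
  then have [measurable]: "A \<in> sets borel" by simp
  have "emeasure (M \<star> return borel 0) A = (\<integral>\<^sup>+x. \<integral>\<^sup>+y. indicator A (x + y) \<partial>return borel 0 \<partial>M)"
    by (rule convolution_emeasure') (auto intro: finite_measure_axioms R.finite_measure_axioms)
  also have "\<dots> = (\<integral>\<^sup>+x. indicator A x \<partial>M)"
    by (intro nn_integral_cong) (simp add: nn_integral_return)
  finally show "emeasure (M \<star> return borel 0) A = emeasure M A" by simp
qed

lemma subexponential_distribution_interval_measure:
  assumes "subexponential F"
  shows "subexponential_distribution (interval_measure F)"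
proof -
  have df: "distribution_function F" and sim: "\<And>k. 1 \<le> k \<Longrightarrow> ratio_sim (\<lambda>u. 1 - conv_power F k u) (\<lambda>u. real k * (1 - F u))"
    using assms by (auto simp: subexponential_def)
  interpret nonneg_distribution "interval_measure F" by (rule nonneg_distribution_interval_measure) fact
  have tail: "tail (interval_measure F) u = 1 - F u" for u
    by (simp add: tail_eq cdf_interval_measure_distribution_function[OF df])
  interpret FF: nonneg_pair "interval_measure F" "interval_measure F" ..
  interpret F2: nonneg_distribution "interval_measure F \<star> interval_measure F"
    by (rule FF.nonneg_distribution_convolution)
  have "conv_power F 2 = cdf (interval_measure F \<star> interval_measure F)"
    by (simp add: conv_power_def numeral_2_eq_2 convolution_return_0[OF real_distribution_axioms])
  then have tail2: "1 - conv_power F 2 u = tail (interval_measure F \<star> interval_measure F) u" for u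
    by (simp add: F2.tail_eq)
  show ?thesis
  proof
    fix u
    show "0 < tail (interval_measure F) u"
    proof (rule ccontr)
      \<comment> \<open>A tail that vanishes somewhere vanishes from there on; the quotients for k =
        1 are then 0/0 = 0 and cannot tend to 1.\<close>
      assume "\<not> 0 < tail (interval_measure F) u"
      then have "tail (interval_measure F) v = 0" if "u \<le> v" for v
        using tail_antimono[OF that] tail_nonneg[of v] by linarith
      then have "\<forall>\<^sub>F v in at_top. (1 - conv_power F 1 v) / (real 1 * (1 - F v)) = 0"
        by (intro eventually_mono[OF eventually_ge_at_top[of u]]) (auto simp: tail)
      then have "((\<lambda>v. (1 - conv_power F 1 v) / (real 1 * (1 - F v))) \<longlongrightarrow> 0) at_top"
        by (rule tendsto_eventually)
      with sim[of 1] show False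
        unfolding ratio_sim_def using tendsto_unique[OF trivial_limit_at_top_linorder] by fastforce
    qed
    have eq: "2 * (x / (real 2 * y)) = x / y" for x y :: real by simp
    have "((\<lambda>v. 2 * ((1 - conv_power F 2 v) / (real 2 * (1 - F v)))) \<longlongrightarrow> 2 * 1) at_top"
      using sim[of 2] unfolding ratio_sim_def by (intro tendsto_mult tendsto_const) simp
    then show "((\<lambda>u. tail (interval_measure F \<star> interval_measure F) u / tail (interval_measure F) u) \<longlongrightarrow> 2) at_top"
      unfolding eq tail tail2 mult_1_right .
  qed
qed

section \<open>Absorption times\<close>

text \<open>Transience is a pathwise statement under the given initial law. It yields that the
  probability \<alpha>(t) of not being in d tends to 0, hence a common time T after which every
  state that is ever charged has been left for d with conditional probability at least 1/2. The
  Markov property turns this into \<alpha>(s + T) \<le> \<alpha>(s) / 2, that is, geometric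
  decay.\<close>

lemma phase_type_tail:
  assumes "prob_space P" and B [measurable]: "B \<in> borel_measurable P" and "phase_type P B"
  shows "AE \<omega> in P. 0 \<le> B \<omega>"
    and "\<exists>c \<eta>. 0 < \<eta> \<and> (\<forall>u\<ge>0. measure P {\<omega>\<in>space P. u < B \<omega>} \<le> c * exp (- \<eta> * u))"
proof -
  interpret P: prob_space P by fact
  obtain X S p d where mjp: "markov_jump_process P X S p" and d: "d \<in> S" "absorbing_state p d"
    and trans: "\<And>i. i \<in> S - {d} \<Longrightarrow> transient_state P X i"
    and B_eq: "\<And>\<omega>. \<omega> \<in> space P \<Longrightarrow> B \<omega> = Inf {t. 0 \<le> t \<and> X t \<omega> = (d::nat)}"
    using \<open>phase_type P B\<close> unfolding phase_type_def by blast
  have finS: "finite S" and semi: "transition_semigroup S p"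
    and X: "\<And>t. 0 \<le> t \<Longrightarrow> X t \<in> measurable P (count_space S)"
    using mjp by (auto simp: markov_jump_process_def)
  have p: "0 \<le> p t i j" "(\<Sum>j\<in>S. p t i j) = 1" if "0 \<le> t" "i \<in> S" "j \<in> S" for t i j
    using semi that by (auto simp: transition_semigroup_def)
  have p_le: "p t i d \<le> 1" if "0 \<le> t" "i \<in> S" for t i
    using member_le_sum[of d S "p t i"] p[OF that] d finS by auto
  have markov: "P.prob {\<omega>\<in>space P. X s \<omega> = i \<and> X t \<omega> = j} = P.prob {\<omega>\<in>space P. X s \<omega> = i} * p (t - s) i j"
    if "0 \<le> s" "s \<le> t" "i \<in> S" "j \<in> S" for s t i j
  proof -
    have "\<forall>s t J x j. 0 \<le> s \<and> s \<le> t \<and> finite J \<and> J \<subseteq> {0..s} \<and> s \<in> J \<and> (\<forall>r\<in>J. x r \<in> S) \<and> j \<in> S \<longrightarrow>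
        P.prob {\<omega>\<in>space P. (\<forall>r\<in>J. X r \<omega> = x r) \<and> X t \<omega> = j} =
        P.prob {\<omega>\<in>space P. \<forall>r\<in>J. X r \<omega> = x r} * p (t - s) (x s) j"
      using mjp unfolding markov_jump_process_def by blast
    from this[rule_format, of s t "{s}" "\<lambda>_. i" j] that show ?thesis by simp
  qed
  have XS: "X t \<omega> \<in> S" if "0 \<le> t" "\<omega> \<in> space P" for t \<omega>
    using measurable_space[OF X[OF that(1)] that(2)] by simp
  have sets_X: "{\<omega>\<in>space P. X t \<omega> = i \<and> Q} \<in> P.events" if "0 \<le> t" for t i Q
  proof -
    note X[OF that, measurable]
    show ?thesis by (cases Q) (simp_all, measurable)
  qed
  define pr where "pr t i = P.prob {\<omega>\<in>space P. X t \<omega> = i}" for t i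
  define \<alpha> where "\<alpha> t = (\<Sum>i\<in>S - {d}. pr t i)" for t
  have pr_nonneg: "0 \<le> pr t i" for t i by (simp add: pr_def)
  have sum_pr: "(\<Sum>i\<in>S. P.prob {\<omega>\<in>space P. X t \<omega> = i \<and> \<omega> \<in> A}) = P.prob A"
    if "0 \<le> t" "A \<in> P.events" for t A
  proof -
    note X[OF that(1), measurable]
    note that(2)[measurable]
    have "P.prob A = P.prob (\<Union>i\<in>S. {\<omega>\<in>space P. X t \<omega> = i \<and> \<omega> \<in> A})"
      using XS[OF that(1)] sets.sets_into_space[OF that(2)] by (intro arg_cong[where f=P.prob]) auto
    also have "\<dots> = (\<Sum>i\<in>S. P.prob {\<omega>\<in>space P. X t \<omega> = i \<and> \<omega> \<in> A})"
      using finS by (intro P.finite_measure_finite_Union) (auto simp: disjoint_family_on_def)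
    finally show ?thesis by simp
  qed
  have sum_pr1: "(\<Sum>i\<in>S. pr t i) = 1" if "0 \<le> t" for t
    using sum_pr[OF that, of "space P"] P.prob_space by (simp add: pr_def cong: conj_cong)
  \<comment> \<open>Markov property at time s; the state d drops out because it is
    absorbing.\<close>
  have \<alpha>_add: "\<alpha> (s + t) = (\<Sum>i\<in>S - {d}. pr s i * (1 - p t i d))" if "0 \<le> s" "0 \<le> t" for s t
  proof -
    have "{\<omega>\<in>space P. X (s + t) \<omega> = d} \<in> P.events"
      using sets_X[of "s + t" d True] that by simp
    then have "pr (s + t) d = (\<Sum>i\<in>S. P.prob {\<omega>\<in>space P. X s \<omega> = i \<and> X (s + t) \<omega> = d})"
      using sum_pr[of s "{\<omega>\<in>space P. X (s + t) \<omega> = d}"] that by (simp add: pr_def cong: conj_cong)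
    also have "\<dots> = (\<Sum>i\<in>S. pr s i * p t i d)"
      using markov[of s "s + t" _ d] that d by (simp add: pr_def)
    finally have "1 - pr (s + t) d = (\<Sum>i\<in>S. pr s i) - (\<Sum>i\<in>S. pr s i * p t i d)"
      using that by (simp add: sum_pr1)
    moreover have "\<alpha> (s + t) = 1 - pr (s + t) d"
      using sum_pr1[of "s + t"] that finS d by (simp add: \<alpha>_def sum_diff1)
    ultimately have "\<alpha> (s + t) = (\<Sum>i\<in>S. pr s i * (1 - p t i d))"
      by (simp add: sum_subtractf right_diff_distrib)
    also have "\<dots> = (\<Sum>i\<in>S - {d}. pr s i * (1 - p t i d))"
      using finS d that by (intro sum.mono_neutral_right) (auto simp: absorbing_state_def)
    finally show ?thesis .
  qed
  have \<alpha>_antimono: "\<alpha> t \<le> \<alpha> s" if "0 \<le> s" "s \<le> t" for s t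
  proof -
    have "\<alpha> t = (\<Sum>i\<in>S - {d}. pr s i * (1 - p (t - s) i d))" using \<alpha>_add[of s "t - s"] that by simp
    also have "\<dots> \<le> \<alpha> s"
      unfolding \<alpha>_def using p(1)[of "t - s"] that d pr_nonneg
      by (intro sum_mono mult_left_le) (auto)
    finally show ?thesis .
  qed
  \<comment> \<open>Along almost every path each transient state has a last integer time, so the
    indicators vanish eventually and dominated convergence applies.\<close>
  have "(\<lambda>n. \<alpha> (real n)) \<longlonglongrightarrow> (\<Sum>i\<in>S - {d}. 0)"
    unfolding \<alpha>_def
  proof (rule tendsto_sum)
    fix i assume i: "i \<in> S - {d}"
    have [measurable]: "{\<omega>\<in>space P. X (real n) \<omega> = i} \<in> P.events" for n
      using sets_X[of "real n" i True] by simp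
    have "AE \<omega> in P. (\<lambda>n. indicator {\<omega>\<in>space P. X (real n) \<omega> = i} \<omega> :: real) \<longlonglongrightarrow> 0"
      using trans[OF i] unfolding transient_state_def
    proof eventually_elim
      case (elim \<omega>)
      then obtain b where b: "\<And>t. 0 \<le> t \<Longrightarrow> X t \<omega> = i \<Longrightarrow> norm t \<le> b" by (auto simp: bounded_iff)
      obtain m :: nat where m: "b < real m" using reals_Archimedean2 by blast
      have "\<forall>\<^sub>F n in sequentially. (indicator {\<omega>\<in>space P. X (real n) \<omega> = i} \<omega> :: real) = 0"
        using eventually_ge_at_top[of m]
      proof eventually_elim
        case (elim n)
        with m b[of "real n"] show ?case by (auto simp: indicator_def)
      qed
      then show ?case by (rule tendsto_eventually)
    qed
    then have "(\<lambda>n. \<integral>\<omega>. indicator {\<omega>\<in>space P. X (real n) \<omega> = i} \<omega> \<partial>P) \<longlonglongrightarrow> (\<integral>\<omega>. (0::real) \<partial>P)"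
      by (intro integral_dominated_convergence[where w="\<lambda>_. 1"]) (auto simp: indicator_def)
    then show "(\<lambda>n. pr (real n) i) \<longlonglongrightarrow> 0" by (simp add: pr_def)
  qed
  then have \<alpha>_lim: "(\<lambda>n. \<alpha> (real n)) \<longlonglongrightarrow> 0" by simp
  \<comment> \<open>Keeping the weight \<open>pr s i\<close> in the inequality makes it trivial for
    states that are never charged, about whose transition probabilities transience says nothing. For
    the others, one time s of positive weight bounds 1 - p t i d through the decay of
    \<alpha>.\<close>
  have "\<forall>i\<in>S - {d}. \<exists>T\<ge>0. \<forall>t\<ge>T. \<forall>s\<ge>0. pr s i * (1 - p t i d) \<le> pr s i / 2"
  proof
    fix i assume i: "i \<in> S - {d}"
    show "\<exists>T\<ge>0. \<forall>t\<ge>T. \<forall>s\<ge>0. pr s i * (1 - p t i d) \<le> pr s i / 2"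
    proof (cases "\<exists>s\<ge>0. pr s i > 0")
      case False
      then have "pr s i = 0" if "0 \<le> s" for s using pr_nonneg[of s i] that by force
      then show ?thesis by auto
    next
      case True
      then obtain s where s: "0 \<le> s" "0 < pr s i" by auto
      from order_tendstoD(2)[OF \<alpha>_lim, of "pr s i / 2"] s
      obtain n where n: "\<alpha> (real n) < pr s i / 2" by (auto simp: eventually_sequentially)
      have "1 - p t i d \<le> 1 / 2" if "real n \<le> t" for t
      proof -
        have "pr s i * (1 - p t i d) \<le> \<alpha> (s + t)"
          using that s i d finS p_le pr_nonneg by (subst \<alpha>_add) (auto intro!: member_le_sum)
        also have "\<dots> \<le> \<alpha> (real n)" using s that by (intro \<alpha>_antimono) auto
        finally have "pr s i * (1 - p t i d) < pr s i * (1 / 2)" using n by simp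
        then show ?thesis using s by (simp add: mult_less_cancel_left_pos del: mult_1_right)
      qed
      then have "\<forall>t\<ge>real n. \<forall>s\<ge>0. pr s i * (1 - p t i d) \<le> pr s i / 2"
        using pr_nonneg mult_left_mono[of "1 - p _ i d" "1 / 2" "pr _ i"] by force
      then show ?thesis using of_nat_0_le_iff by blast
    qed
  qed
  then obtain T' where T': "\<And>i. i \<in> S - {d} \<Longrightarrow> 0 \<le> T' i"
    "\<And>i t s. i \<in> S - {d} \<Longrightarrow> T' i \<le> t \<Longrightarrow> 0 \<le> s \<Longrightarrow> pr s i * (1 - p t i d) \<le> pr s i / 2"
    by (metis (full_types))
  \<comment> \<open>The sum exceeds each \<open>T' i\<close>; the 1 keeps T positive even if d is
    the only state.\<close>
  define T where "T = 1 + (\<Sum>i\<in>S - {d}. T' i)"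
  have T_ge: "T' i \<le> T" if "i \<in> S - {d}" for i
    using member_le_sum[of i "S - {d}" T'] T'(1) that finS by (auto simp: T_def)
  have "0 \<le> (\<Sum>i\<in>S - {d}. T' i)" by (rule sum_nonneg) (rule T'(1))
  then have "0 < T" by (simp add: T_def)
  have half: "\<alpha> (s + T) \<le> \<alpha> s / 2" if "0 \<le> s" for s
  proof -
    have "(\<Sum>i\<in>S - {d}. pr s i * (1 - p T i d)) \<le> (\<Sum>i\<in>S - {d}. pr s i / 2)"
      using T'(2)[OF _ T_ge that] by (intro sum_mono) blast
    then show ?thesis
      using \<open>0 < T\<close> that by (subst \<alpha>_add) (auto simp: \<alpha>_def sum_divide_distrib)
  qed
  have geo: "\<alpha> (real k * T) \<le> (1 / 2) ^ k" for k
  proof (induction k)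
    case 0
    have "\<alpha> 0 \<le> (\<Sum>i\<in>S. pr 0 i)" unfolding \<alpha>_def using finS pr_nonneg by (intro sum_mono2) auto
    then show ?case using sum_pr1[of 0] by simp
  next
    case (Suc k)
    then show ?case using half[of "real k * T"] \<open>0 < T\<close> by (simp add: algebra_simps)
  qed
  have B_le: "P.prob {\<omega>\<in>space P. u < B \<omega>} \<le> \<alpha> u" if "0 \<le> u" for u
  proof -
    have "P.prob {\<omega>\<in>space P. u < B \<omega>} \<le> P.prob (\<Union>i\<in>S - {d}. {\<omega>\<in>space P. X u \<omega> = i})"
    proof (rule P.finite_measure_mono)
      show "{\<omega>\<in>space P. u < B \<omega>} \<subseteq> (\<Union>i\<in>S - {d}. {\<omega>\<in>space P. X u \<omega> = i})"
      proof safe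
        fix \<omega> assume \<omega>: "\<omega> \<in> space P" "u < B \<omega>"
        have "X u \<omega> \<noteq> d"
        proof
          assume "X u \<omega> = d"
          then have "B \<omega> \<le> u"
            unfolding B_eq[OF \<omega>(1)] using that by (intro cInf_lower) (auto intro!: bdd_belowI[of _ 0])
          with \<omega> show False by simp
        qed
        with XS[OF that \<omega>(1)] \<omega> show "\<omega> \<in> (\<Union>i\<in>S - {d}. {\<omega>\<in>space P. X u \<omega> = i})" by auto
      qed
      show "(\<Union>i\<in>S - {d}. {\<omega>\<in>space P. X u \<omega> = i}) \<in> P.events"
        using finS sets_X[OF that, of _ True] by (intro sets.finite_UN) auto
    qed
    also have "\<dots> \<le> \<alpha> u"
      unfolding \<alpha>_def pr_def
      using finS sets_X[OF that, of _ True] by (intro P.finite_measure_subadditive_finite) auto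
    finally show ?thesis .
  qed
  \<comment> \<open>One halving per period T; the factor 2 pays for rounding u/T down.\<close>
  have "P.prob {\<omega>\<in>space P. u < B \<omega>} \<le> 2 * exp (- (ln 2 / T) * u)" if "0 \<le> u" for u
  proof -
    define k where "k = nat \<lfloor>u / T\<rfloor>"
    have "real k = of_int \<lfloor>u / T\<rfloor>" using that \<open>0 < T\<close> by (simp add: k_def)
    then have k: "real k \<le> u / T" "u / T \<le> real k + 1" by linarith+
    have "P.prob {\<omega>\<in>space P. u < B \<omega>} \<le> \<alpha> u" by (rule B_le) fact
    also have "\<dots> \<le> \<alpha> (real k * T)"
      using k \<open>0 < T\<close> that by (intro \<alpha>_antimono) (auto simp: field_simps)
    also have "\<dots> \<le> (1 / 2) ^ k" by (rule geo)
    also have "(1 / 2) ^ k = exp (- (ln 2 * real k))"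
      by (simp add: exp_minus power_one_over inverse_eq_divide exp_of_nat2_mult)
    also have "\<dots> \<le> exp (ln 2 - ln 2 * (u / T))"
      using mult_left_mono[OF k(2), of "ln 2"] by (simp add: algebra_simps)
    also have "\<dots> = 2 * exp (- (ln 2 / T) * u)" by (simp add: exp_diff exp_minus field_simps)
    finally show ?thesis .
  qed
  moreover have "0 < ln 2 / T" using \<open>0 < T\<close> by simp
  ultimately show "\<exists>c \<eta>. 0 < \<eta> \<and> (\<forall>u\<ge>0. P.prob {\<omega>\<in>space P. u < B \<omega>} \<le> c * exp (- \<eta> * u))" by blast
  \<comment> \<open>The infimum of an empty set has no known sign, so the path must be shown to
    reach d: almost surely all times in the finitely many other states lie below a common
    bound.\<close>
  have "AE \<omega> in P. \<forall>i\<in>S - {d}. bounded {t. 0 \<le> t \<and> X t \<omega> = i}"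
    using finS trans by (intro AE_finite_allI) (auto simp: transient_state_def)
  moreover have "AE \<omega> in P. \<omega> \<in> space P" by (rule AE_space)
  ultimately show "AE \<omega> in P. 0 \<le> B \<omega>"
  proof eventually_elim
    case (elim \<omega>)
    then have "bounded (\<Union>i\<in>S - {d}. {t. 0 \<le> t \<and> X t \<omega> = i})" using finS by (intro bounded_UN) auto
    then obtain b where b: "\<And>i t. i \<in> S - {d} \<Longrightarrow> 0 \<le> t \<Longrightarrow> X t \<omega> = i \<Longrightarrow> norm t \<le> b" by (auto simp: bounded_iff)
    have "X (\<bar>b\<bar> + 1) \<omega> = d"
      using XS[of "\<bar>b\<bar> + 1" \<omega>] elim b[of "X (\<bar>b\<bar> + 1) \<omega>" "\<bar>b\<bar> + 1"] by force
    then have "{t. 0 \<le> t \<and> X t \<omega> = d} \<noteq> {}" by (auto intro: exI[of _ "\<bar>b\<bar> + 1"])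
    then show ?case using elim by (subst B_eq) (auto intro!: cInf_greatest)
  qed
qed

section \<open>Stationary excess distributions\<close>

text \<open>Tonelli applied to the indicator of t < X(\<omega>). The extended-valued form
  presupposes no integrability, as required for U.\<close>

lemma (in prob_space) nn_integral_eq_integral_tail:
  assumes X [measurable]: "X \<in> borel_measurable M" and nonneg: "AE \<omega> in M. 0 \<le> X \<omega>"
  shows "(\<integral>\<^sup>+\<omega>. ennreal (X \<omega>) \<partial>M) = (\<integral>\<^sup>+t. ennreal (1 - cdf (distr M borel X) t) * indicator {0..} t \<partial>lborel)"
proof -
  interpret D: nonneg_distribution "distr M borel X" by (intro nonneg_distribution_distr X nonneg)
  interpret pair_sigma_finite M lborel ..
  have [measurable]: "(\<lambda>(\<omega>, t). indicator {0..<X \<omega>} t :: ennreal) \<in> borel_measurable (M \<Otimes>\<^sub>M lborel)"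
  proof -
    have "(\<lambda>(\<omega>, t). indicator {0..<X \<omega>} t :: ennreal) = (\<lambda>(\<omega>, t). if 0 \<le> t \<and> t < X \<omega> then 1 else 0)"
      by (auto simp: indicator_def fun_eq_iff)
    then show ?thesis by simp
  qed
  have "(\<integral>\<^sup>+\<omega>. ennreal (X \<omega>) \<partial>M) = (\<integral>\<^sup>+\<omega>. \<integral>\<^sup>+t. indicator {0..<X \<omega>} t \<partial>lborel \<partial>M)"
    using nonneg by (intro nn_integral_cong_AE) auto
  also have "\<dots> = (\<integral>\<^sup>+t. \<integral>\<^sup>+\<omega>. indicator {0..<X \<omega>} t \<partial>M \<partial>lborel)"
    by (rule Fubini'[symmetric]) simp
  also have "\<dots> = (\<integral>\<^sup>+t. ennreal (1 - cdf (distr M borel X) t) * indicator {0..} t \<partial>lborel)"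
  proof (rule nn_integral_cong)
    fix t :: real
    have "(\<integral>\<^sup>+\<omega>. indicator {0..<X \<omega>} t \<partial>M) = (\<integral>\<^sup>+\<omega>. indicator {0..} t * indicator {\<omega>\<in>space M. t < X \<omega>} \<omega> \<partial>M)"
      by (intro nn_integral_cong) (auto simp: indicator_def)
    also have "\<dots> = indicator {0..} t * emeasure M {\<omega>\<in>space M. t < X \<omega>}"
      by (simp add: nn_integral_cmult)
    also have "emeasure M {\<omega>\<in>space M. t < X \<omega>} = ennreal (1 - cdf (distr M borel X) t)"
      by (simp add: emeasure_eq_measure tail_distr flip: D.tail_eq)
    finally show "(\<integral>\<^sup>+\<omega>. indicator {0..<X \<omega>} t \<partial>M) = ennreal (1 - cdf (distr M borel X) t) * indicator {0..} t"
      by (simp add: mult.commute)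
  qed
  finally show ?thesis .
qed

text \<open>The law with distribution function \<open>excess \<mu> F\<close>, given by its density
  so that total mass and tails are plain integrals of 1 - F.\<close>

definition excess_measure :: "real \<Rightarrow> (real \<Rightarrow> real) \<Rightarrow> real measure" where
  "excess_measure \<mu> F = density lborel (\<lambda>x. ennreal ((1 - F x) / \<mu>) * indicator {0..} x)"

lemma (in prob_space) expectation_eq_integral_tail:
  assumes X: "integrable M X" and nonneg: "AE \<omega> in M. 0 \<le> X \<omega>"
  shows "ennreal (expectation X) = (\<integral>\<^sup>+t. ennreal (1 - cdf (distr M borel X) t) * indicator {0..} t \<partial>lborel)"
  using nn_integral_eq_integral_tail[OF borel_measurable_integrable[OF X] nonneg]
    nn_integral_eq_integral[OF X nonneg] by simp

lemma tail_measurable: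
  fixes F :: "real \<Rightarrow> real"
  assumes "mono F"
  shows "(\<lambda>x. 1 - F x) \<in> borel_measurable borel"
  using borel_measurable_mono[OF assms] by simp

lemma set_integrable_tail:
  fixes F :: "real \<Rightarrow> real"
  assumes "distribution_function F"
  shows "set_integrable lborel {0..u} (\<lambda>x. 1 - F x)"
  unfolding set_integrable_def
proof (rule integrableI_bounded_set_indicator[where B=1])
  interpret nonneg_distribution "interval_measure F"
    by (rule nonneg_distribution_interval_measure) fact
  have F: "0 \<le> F x" "F x \<le> 1" for x
    using cdf_nonneg[of x] cdf_bounded_prob[of x] cdf_interval_measure_distribution_function[OF assms] by auto
  show "AE x in lborel. x \<in> {0..u} \<longrightarrow> norm (1 - F x) \<le> 1" using F by auto
  show "(\<lambda>x. 1 - F x) \<in> borel_measurable lborel"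
    using assms tail_measurable[of F] by (simp add: distribution_function_def)
  show "emeasure lborel {0..u} < \<infinity>" by (cases "0 \<le> u") auto
qed simp

lemma (in prob_space) excess_measure:
  assumes X: "integrable M X" and nonneg: "AE \<omega> in M. 0 \<le> X \<omega>" and pos: "0 < expectation X"
  defines "F \<equiv> cdf (distr M borel X)"
  shows "nonneg_distribution (excess_measure (expectation X) F)"
    and "cdf (excess_measure (expectation X) F) = excess (expectation X) F"
proof -
  let ?\<mu> = "expectation X"
  have Xm [measurable]: "X \<in> borel_measurable M" using X by simp
  have df: "distribution_function F"
    unfolding F_def by (intro distribution_function_cdf nonneg_distribution_distr Xm nonneg)
  interpret D: nonneg_distribution "distr M borel X" by (intro nonneg_distribution_distr Xm nonneg)
  have [measurable]: "F \<in> borel_measurable borel"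
    using df by (intro borel_measurable_mono) (simp add: distribution_function_def)
  have F: "0 \<le> F x" "F x \<le> 1" for x
    using D.cdf_nonneg[of x] D.cdf_bounded_prob[of x] by (auto simp: F_def)
  have "emeasure (excess_measure ?\<mu> F) UNIV = (\<integral>\<^sup>+x. ennreal (1 / ?\<mu>) * (ennreal (1 - F x) * indicator {0..} x) \<partial>lborel)"
    unfolding excess_measure_def using pos F
    by (subst emeasure_density) (auto intro!: nn_integral_cong simp: indicator_def simp flip: ennreal_mult)
  also have "\<dots> = ennreal (1 / ?\<mu>) * ennreal ?\<mu>"
    using expectation_eq_integral_tail[OF X nonneg] by (subst nn_integral_cmult) (auto simp: F_def[symmetric])
  also have "\<dots> = 1" using pos by (simp flip: ennreal_mult)
  finally interpret E: prob_space "excess_measure ?\<mu> F"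
    by (intro prob_spaceI) (simp add: excess_measure_def)
  interpret E: real_distribution "excess_measure ?\<mu> F"
    by unfold_locales (simp_all add: excess_measure_def)
  show "nonneg_distribution (excess_measure ?\<mu> F)"
  proof
    show "AE x in excess_measure ?\<mu> F. 0 \<le> x"
      unfolding excess_measure_def by (subst AE_density) (auto simp: indicator_def)
  qed
  show "cdf (excess_measure ?\<mu> F) = excess ?\<mu> F"
  proof
    fix u
    have int: "integrable lborel (\<lambda>x. indicator {0..u} x *\<^sub>R (1 - F x))"
      using set_integrable_tail[OF df] by (simp add: set_integrable_def)
    have "emeasure (excess_measure ?\<mu> F) {..u} = (\<integral>\<^sup>+x. ennreal (1 / ?\<mu>) * (ennreal (indicator {0..u} x *\<^sub>R (1 - F x))) \<partial>lborel)"
      unfolding excess_measure_def using pos F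
      by (subst emeasure_density) (auto intro!: nn_integral_cong simp: indicator_def simp flip: ennreal_mult)
    also have "\<dots> = ennreal (1 / ?\<mu>) * ennreal (LINT x:{0..u}|lborel. 1 - F x)"
      using nn_integral_eq_integral[OF int] F by (simp add: nn_integral_cmult set_lebesgue_integral_def)
    also have "\<dots> = ennreal (excess ?\<mu> F u)"
      using pos F by (simp add: excess_def set_lebesgue_integral_def ennreal_mult[symmetric] integral_nonneg_AE)
    finally show "cdf (excess_measure ?\<mu> F) u = excess ?\<mu> F u"
      using pos F by (simp add: cdf_def E.emeasure_eq_measure excess_def set_lebesgue_integral_def integral_nonneg_AE)
  qed
qed

text \<open>The density of the excess law is 1 - F up to a factor, so an exponential bound survives
  integration with the same rate.\<close>

lemma excess_measure_tail_le:
  assumes "0 < \<mu>" "0 < \<eta>" "0 \<le> u" "prob_space (excess_measure \<mu> F)"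
    and le: "\<And>x. 0 \<le> x \<Longrightarrow> 1 - F x \<le> c * exp (- \<eta> * x)" and F: "F \<in> borel_measurable borel" "\<And>x. F x \<le> 1"
  shows "tail (excess_measure \<mu> F) u \<le> c / \<mu> / \<eta> * exp (- \<eta> * u)"
proof -
  interpret prob_space "excess_measure \<mu> F" by fact
  note F(1)[measurable]
  have "0 \<le> c" using le[of 0] F(2)[of 0] by simp
  have "emeasure (excess_measure \<mu> F) {u<..} \<le> (\<integral>\<^sup>+x. ennreal (c / \<mu> * exp (- \<eta> * x)) * indicator {u..} x \<partial>lborel)"
  proof -
    have "(1 - F x) / \<mu> \<le> c / \<mu> * exp (- \<eta> * x)" if "0 \<le> x" for x
      using divide_right_mono[OF le[OF that], of \<mu>] \<open>0 < \<mu>\<close> by simp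
    then show ?thesis
      unfolding excess_measure_def using \<open>0 \<le> u\<close>
      by (subst emeasure_density) (auto intro!: nn_integral_mono ennreal_leI simp: indicator_def)
  qed
  also have "\<dots> = ennreal (0 - (- (c / \<mu> / \<eta> * exp (- \<eta> * u))))"
  proof (rule nn_integral_FTC_atLeast)
    have "((\<lambda>x. exp (- \<eta> * x)) \<longlongrightarrow> 0) at_top"
    proof (rule filterlim_compose[OF exp_at_bot])
      show "LIM u at_top. - \<eta> * u :> at_bot"
        using \<open>0 < \<eta>\<close> by (intro filterlim_tendsto_neg_mult_at_bot[OF tendsto_const _ filterlim_ident]) auto
    qed
    from tendsto_mult[OF tendsto_const[of "- (c / \<mu> / \<eta>)"] this]
    show "((\<lambda>x. - (c / \<mu> / \<eta> * exp (- \<eta> * x))) \<longlongrightarrow> 0) at_top" by simp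
    fix x
    show "((\<lambda>x. - (c / \<mu> / \<eta> * exp (- \<eta> * x))) has_real_derivative c / \<mu> * exp (- \<eta> * x)) (at x)"
      using \<open>0 < \<mu>\<close> \<open>0 < \<eta>\<close> by (auto intro!: derivative_eq_intros)
  qed (use \<open>0 \<le> c\<close> \<open>0 < \<mu>\<close> in auto)
  finally show ?thesis
    using \<open>0 \<le> c\<close> \<open>0 < \<mu>\<close> \<open>0 < \<eta>\<close> by (simp add: tail_def emeasure_eq_measure)
qed

text \<open>U is a mixture in law only, so its mean is compared through the tails. The extended
  integral comes out finite, which settles the expectation of U at the same time.\<close>

lemma (in prob_space) mixture_expectation:
  fixes B C U :: "'a \<Rightarrow> real"
  assumes B: "integrable M B" "AE \<omega> in M. 0 \<le> B \<omega>" and C: "integrable M C" "AE \<omega> in M. 0 \<le> C \<omega>"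
    and U [measurable]: "U \<in> borel_measurable M" and \<epsilon>: "0 \<le> \<epsilon>" "\<epsilon> \<le> 1"
    and mix: "\<And>x. cdf (distr M borel U) x = (1 - \<epsilon>) * cdf (distr M borel B) x + \<epsilon> * cdf (distr M borel C) x"
  shows "expectation U = (1 - \<epsilon>) * expectation B + \<epsilon> * expectation C"
proof -
  have [measurable]: "B \<in> borel_measurable M" "C \<in> borel_measurable M" using B C by simp_all
  interpret DB: nonneg_distribution "distr M borel B" by (intro nonneg_distribution_distr B) simp
  interpret DC: nonneg_distribution "distr M borel C" by (intro nonneg_distribution_distr C) simp
  interpret DU: nonneg_distribution "distr M borel U"
    using DB.tail_neg DC.tail_neg mix
    by (intro nonneg_distributionI real_distribution_distr) (auto simp: DB.tail_eq DC.tail_eq)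
  have U0: "AE \<omega> in M. 0 \<le> U \<omega>" using DU.nonneg by (simp add: AE_distr_iff)
  have tailm: "(\<lambda>t. 1 - cdf D t) \<in> borel_measurable borel" if "nonneg_distribution D" for D
    using distribution_function_cdf[OF that] by (intro tail_measurable) (simp add: distribution_function_def)
  have [measurable]: "(\<lambda>t. 1 - cdf (distr M borel B) t) \<in> borel_measurable borel"
    "(\<lambda>t. 1 - cdf (distr M borel C) t) \<in> borel_measurable borel"
    by (intro tailm; unfold_locales)+
  have le1: "0 \<le> 1 - cdf (distr M borel B) t" "0 \<le> 1 - cdf (distr M borel C) t" for t
    using DB.cdf_bounded_prob[of t] DC.cdf_bounded_prob[of t] by auto
  have "ennreal (1 - cdf (distr M borel U) t) * indicator {0..} t =
      ennreal (1 - \<epsilon>) * (ennreal (1 - cdf (distr M borel B) t) * indicator {0..} t) +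
      ennreal \<epsilon> * (ennreal (1 - cdf (distr M borel C) t) * indicator {0..} t)" for t
  proof -
    have "1 - cdf (distr M borel U) t = (1 - \<epsilon>) * (1 - cdf (distr M borel B) t) + \<epsilon> * (1 - cdf (distr M borel C) t)"
      by (simp add: mix algebra_simps)
    then show ?thesis
      using \<epsilon> le1[of t] by (simp add: ennreal_plus ennreal_mult distrib_right mult.assoc indicator_def)
  qed
  then have "(\<integral>\<^sup>+\<omega>. ennreal (U \<omega>) \<partial>M) = ennreal (1 - \<epsilon>) * ennreal (expectation B) + ennreal \<epsilon> * ennreal (expectation C)"
    unfolding nn_integral_eq_integral_tail[OF U U0] expectation_eq_integral_tail[OF B] expectation_eq_integral_tail[OF C]
    by (simp add: nn_integral_add nn_integral_cmult)
  also have "\<dots> = ennreal ((1 - \<epsilon>) * expectation B + \<epsilon> * expectation C)"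
    using \<epsilon> B C by (simp add: ennreal_plus ennreal_mult integral_nonneg_AE)
  finally have "(\<integral>\<^sup>+\<omega>. ennreal (U \<omega>) \<partial>M) = ennreal ((1 - \<epsilon>) * expectation B + \<epsilon> * expectation C)" .
  moreover have "0 \<le> (1 - \<epsilon>) * expectation B + \<epsilon> * expectation C"
    using \<epsilon> B C by (simp add: integral_nonneg_AE)
  ultimately show ?thesis
    using integral_eq_nn_integral[OF U U0] by (simp only: enn2real_ennreal)
qed

lemma excess_mixture:
  assumes "distribution_function Fp" "distribution_function Fh" "\<mu>B \<noteq> 0" "\<mu>C \<noteq> 0"
  shows "excess m (\<lambda>x. (1 - \<epsilon>) * Fp x + \<epsilon> * Fh x) u =
    ((1 - \<epsilon>) * \<mu>B * excess \<mu>B Fp u + \<epsilon> * \<mu>C * excess \<mu>C Fh u) / m"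
proof -
  have "(LINT x:{0..u}|lborel. 1 - ((1 - \<epsilon>) * Fp x + \<epsilon> * Fh x))
      = (LINT x:{0..u}|lborel. (1 - \<epsilon>) * (1 - Fp x) + \<epsilon> * (1 - Fh x))"
    by (simp add: algebra_simps)
  also have "\<dots> = (1 - \<epsilon>) * (LINT x:{0..u}|lborel. 1 - Fp x) + \<epsilon> * (LINT x:{0..u}|lborel. 1 - Fh x)"
    using set_integrable_tail[OF assms(1)] set_integrable_tail[OF assms(2)]
    by (subst set_integral_add(2)) auto
  finally show ?thesis using assms(3,4) by (simp add: excess_def)
qed

section \<open>Compound geometric laws with negligible summands\<close>

text \<open>For the copies of M: every convolution power has ratio limit 0, and the dominated series
  keeps this limit. The law is given by its distribution function alone, so nonnegativity has to be
  read off from the series too.\<close>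

lemma (in subexponential_distribution) compound_geometric_tail_negligible:
  assumes "prob_space \<Omega>" and X [measurable]: "X \<in> borel_measurable \<Omega>"
    and law: "\<And>u. measure \<Omega> {\<omega>\<in>space \<Omega>. X \<omega> \<le> u} = (1 - r) * (\<Sum>j. r ^ j * cdf (((\<star>) E ^^ j) (return borel 0)) u)"
    and r: "0 \<le> r" "r < 1" and E: "nonneg_distribution E" "((\<lambda>u. tail E u / tail F u) \<longlongrightarrow> 0) at_top"
  shows "AE \<omega> in \<Omega>. 0 \<le> X \<omega>" and "((\<lambda>u. tail (distr \<Omega> borel X) u / tail F u) \<longlongrightarrow> 0) at_top"
proof -
  interpret P: prob_space \<Omega> by fact
  define L where "L j = ((\<star>) E ^^ j) (return borel 0)" for j
  have L0: "L 0 = return borel 0" and L_Suc: "\<And>j. L (Suc j) = (E \<star> L j)" by (simp_all add: L_def)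
  have b: "((\<lambda>u. tail (L 0) u / tail F u) \<longlongrightarrow> 0) at_top"
    by (rule tendsto_eventually) (use eventually_ge_at_top[of 0] in eventually_elim, simp add: L0 tail_return_0)
  have "nonneg_distribution (L 0)" unfolding L0 by (rule nonneg_distribution_return_0)
  note L = iterated_convolution[of E L, OF E(1) this L_Suc E(2) b]
  interpret D: real_distribution "distr \<Omega> borel X" by simp
  have cdf: "cdf (distr \<Omega> borel X) u = (1 - r) * (\<Sum>j. r ^ j * cdf (L j) u)" for u
    unfolding cdf_distr[OF X] law L_def ..
  have tailL: "tail (L j) u = 1 - cdf (L j) u" for j u
    using nonneg_distribution.tail_eq[OF L(1)] .
  \<comment> \<open>The weights sum to 1, so complements may be taken term by term;
    \<open>j + 0\<close> matches the shift in \<open>geometric_sum_tail_asymp\<close>.\<close>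
  have tail_X: "1 - cdf (distr \<Omega> borel X) u = (1 - r) * (\<Sum>j. r ^ j * tail (L (j + 0)) u)" for u
  proof -
    have geo: "summable (\<lambda>j. r ^ j)" using r by (simp add: summable_geometric)
    have s: "summable (\<lambda>j. r ^ j * cdf (L j) u)"
    proof (rule summable_comparison_test'[OF geo])
      fix j
      interpret Lj: nonneg_distribution "L j" by (rule L)
      show "norm (r ^ j * cdf (L j) u) \<le> r ^ j"
        using r Lj.cdf_nonneg[of u] Lj.cdf_bounded_prob[of u] by (simp add: mult_left_le)
    qed
    have "(\<Sum>j. r ^ j * tail (L j) u) = (\<Sum>j. r ^ j - r ^ j * cdf (L j) u)"
      by (simp add: tailL right_diff_distrib)
    also have "\<dots> = 1 / (1 - r) - (\<Sum>j. r ^ j * cdf (L j) u)"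
      using suminf_diff[OF geo s] r by (simp add: suminf_geometric)
    finally show ?thesis using r by (simp add: cdf right_diff_distrib)
  qed
  have "nonneg_distribution (distr \<Omega> borel X)"
  proof (rule nonneg_distributionI)
    fix u :: real assume "u < 0"
    then have "cdf (L j) u = 0" for j
      using nonneg_distribution.tail_neg[OF L(1), of u j] by (simp add: tailL)
    then show "cdf (distr \<Omega> borel X) u = 0" by (simp add: cdf)
  qed unfold_locales
  then interpret D: nonneg_distribution "distr \<Omega> borel X" .
  show "AE \<omega> in \<Omega>. 0 \<le> X \<omega>" using D.nonneg by (simp add: AE_distr_iff)
  have "((\<lambda>u. (1 - r) * ((\<Sum>j. r ^ j * tail (L (j + 0)) u) / tail F u)) \<longlongrightarrow> (1 - r) * (\<Sum>j. r ^ j * (0 + real (j + 0) * 0))) at_top"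
    by (intro tendsto_mult tendsto_const geometric_sum_tail_asymp[where L=L and H=E])
      (fact E L_Suc b r \<open>nonneg_distribution (L 0)\<close>)+
  then show "((\<lambda>u. tail (distr \<Omega> borel X) u / tail F u) \<longlongrightarrow> 0) at_top"
    unfolding D.tail_eq tail_X by simp
qed

section \<open>Geometric sums and maxima\<close>

text \<open>The value is a E[N + 2] for geometric N: the terms (k + 1) r^k form the derivative of
  the geometric series, and one more r^k makes k + 2.\<close>

lemma sums_geometric_weight:
  assumes "0 \<le> r" "r < (1::real)"
  shows "(\<lambda>k. (1 - r) * r ^ k * (real (k + 2) * a)) sums (a * (1 + 1 / (1 - r)))"
proof -
  have eq: "t * a * (1 / t\<^sup>2 + 1 / t) = a * (1 + 1 / t)" if "t \<noteq> 0" for t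
    using that by (simp add: field_simps power2_eq_square)
  have "(\<lambda>k. real (Suc k) * r ^ k + r ^ k) sums (1 / (1 - r)\<^sup>2 + 1 / (1 - r))"
    using assms by (intro sums_add geometric_deriv_sums geometric_sums) auto
  from sums_mult[OF this, of "(1 - r) * a"]
  have "(\<lambda>k. (1 - r) * a * (real (Suc k) * r ^ k + r ^ k)) sums ((1 - r) * a * (1 / (1 - r)\<^sup>2 + 1 / (1 - r)))" .
  also have "(\<lambda>k. (1 - r) * a * (real (Suc k) * r ^ k + r ^ k)) = (\<lambda>k. (1 - r) * r ^ k * (real (k + 2) * a))"
    by (simp add: fun_eq_iff algebra_simps)
  also have "(1 - r) * a * (1 / (1 - r)\<^sup>2 + 1 / (1 - r)) = a * (1 + 1 / (1 - r))"
    using eq[of "1 - r"] assms by simp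
  finally show ?thesis .
qed

text \<open>What remains of a E[N + 2] once the values N < m are removed. With m = n - 1 the factor
  \<open>real (Suc m)\<close> is the n of the final formulas.\<close>

lemma sum_geometric_weight:
  assumes "r < (1::real)"
  shows "a * (1 + 1 / (1 - r)) - (\<Sum>k<m. (1 - r) * r ^ k * (real (k + 2) * a))
    = a * (r ^ m * (1 + real (Suc m) * (1 - r)) / (1 - r))"
proof (induction m)
  case 0
  then show ?case using assms by (simp add: field_simps)
next
  case (Suc m)
  have "a * (1 + 1 / (1 - r)) - (\<Sum>k<Suc m. (1 - r) * r ^ k * (real (k + 2) * a))
      = a * (r ^ m * (1 + real (Suc m) * (1 - r)) / (1 - r)) - (1 - r) * r ^ m * (real (m + 2) * a)"
    using Suc by simp
  also have "\<dots> = a * (r ^ Suc m * (1 + real (Suc (Suc m)) * (1 - r)) / (1 - r))"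
    using assms by (simp add: field_simps)
  finally show ?case .
qed

lemma (in prob_space) prob_random_index:
  fixes N :: "'a \<Rightarrow> nat"
  assumes N [measurable]: "N \<in> measurable M (count_space UNIV)"
    and A: "\<And>k. {\<omega>\<in>space M. A k \<omega>} \<in> events"
  shows "(\<lambda>k. prob {\<omega>\<in>space M. N \<omega> = k \<and> A k \<omega>}) sums prob {\<omega>\<in>space M. A (N \<omega>) \<omega>}"
proof -
  note A[measurable]
  have "(\<lambda>k. prob {\<omega>\<in>space M. N \<omega> = k \<and> A k \<omega>}) sums prob (\<Union>k. {\<omega>\<in>space M. N \<omega> = k \<and> A k \<omega>})"
    by (rule finite_measure_UNION) (auto simp: disjoint_family_on_def)
  also have "(\<Union>k. {\<omega>\<in>space M. N \<omega> = k \<and> A k \<omega>}) = {\<omega>\<in>space M. A (N \<omega>) \<omega>}" by auto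
  finally show ?thesis .
qed

lemma (in prob_space) indep_var_prob:
  assumes "indep_var borel X borel Y" "A \<in> sets borel" "B \<in> sets borel"
  shows "prob {\<omega>\<in>space M. X \<omega> \<in> A \<and> Y \<omega> \<in> B} = prob {\<omega>\<in>space M. X \<omega> \<in> A} * prob {\<omega>\<in>space M. Y \<omega> \<in> B}"
proof -
  have "prob ((\<lambda>x. (X x, Y x)) -` (A \<times> B) \<inter> space M) = prob (X -` A \<inter> space M) * prob (Y -` B \<inter> space M)"
    by (rule indep_varD[OF assms])
  then show ?thesis by (simp add: vimage_def Int_def conj_commute cong: conj_cong)
qed

context subexponential_distribution
begin

text \<open>Given N = k, the sum has k + 2 increments, so \<open>geometric_sum_tail_asymp\<close>
  applies with shift 2; the start R 0 adds nothing to the limit.\<close>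

lemma random_sum_tail:
  fixes N :: "'a \<Rightarrow> nat" and R X :: "nat \<Rightarrow> 'a \<Rightarrow> real"
  assumes "prob_space \<Omega>" and N [measurable]: "N \<in> measurable \<Omega> (count_space UNIV)"
    and law_N: "\<And>k. measure \<Omega> {\<omega>\<in>space \<Omega>. N \<omega> = k} = (1 - r) * r ^ k" and r: "0 \<le> r" "r < 1"
    and R_Suc: "\<And>j \<omega>. R (Suc j) \<omega> = R j \<omega> + X (Suc j) \<omega>"
    and ind_R: "\<And>j. prob_space.indep_var \<Omega> borel (X (Suc j)) borel (R j)"
    and ind_N: "\<And>j. prob_space.indep_var \<Omega> borel (\<lambda>\<omega>. real (N \<omega>)) borel (R j)"
    and law_X: "\<And>j. distr \<Omega> borel (X (Suc j)) = H" and H: "nonneg_distribution H"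
    and R0: "nonneg_distribution (distr \<Omega> borel (R 0))"
    and a: "((\<lambda>u. tail H u / tail F u) \<longlongrightarrow> a) at_top"
    and b: "((\<lambda>u. tail (distr \<Omega> borel (R 0)) u / tail F u) \<longlongrightarrow> 0) at_top"
  shows "((\<lambda>u. measure \<Omega> {\<omega>\<in>space \<Omega>. u < R (N \<omega> + 2) \<omega>} / tail F u) \<longlongrightarrow> a * (1 + 1 / (1 - r))) at_top"
proof -
  interpret P: prob_space \<Omega> by fact
  have R [measurable]: "R j \<in> borel_measurable \<Omega>" and X [measurable]: "X (Suc j) \<in> borel_measurable \<Omega>" for j
    using ind_R[of j] by (auto dest: P.indep_var_rv1 P.indep_var_rv2)
  have L_Suc: "distr \<Omega> borel (R (Suc j)) = (H \<star> distr \<Omega> borel (R j))" for j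
  proof -
    have "distr \<Omega> borel (R (Suc j)) = distr \<Omega> borel (\<lambda>\<omega>. X (Suc j) \<omega> + R j \<omega>)"
      by (simp add: R_Suc add.commute cong: distr_cong)
    also have "\<dots> = (H \<star> distr \<Omega> borel (R j))"
      using P.sum_indep_random_variable[OF ind_R X R] by (simp add: law_X)
    finally show ?thesis .
  qed
  have eq: "P.prob {\<omega>\<in>space \<Omega>. u < R (N \<omega> + 2) \<omega>} = (1 - r) * (\<Sum>k. r ^ k * tail (distr \<Omega> borel (R (k + 2))) u)" for u
  proof -
    have 1: "P.prob {\<omega>\<in>space \<Omega>. N \<omega> = k \<and> u < R (k + 2) \<omega>} = (1 - r) * (r ^ k * tail (distr \<Omega> borel (R (k + 2))) u)" for k
    proof -
      have "P.prob {\<omega>\<in>space \<Omega>. real (N \<omega>) \<in> {real k} \<and> R (k + 2) \<omega> \<in> {u<..}}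
          = P.prob {\<omega>\<in>space \<Omega>. real (N \<omega>) \<in> {real k}} * P.prob {\<omega>\<in>space \<Omega>. R (k + 2) \<omega> \<in> {u<..}}"
        by (rule P.indep_var_prob[OF ind_N]) auto
      then show ?thesis by (simp add: law_N tail_distr)
    qed
    have "(\<lambda>k. P.prob {\<omega>\<in>space \<Omega>. N \<omega> = k \<and> u < R (k + 2) \<omega>}) sums P.prob {\<omega>\<in>space \<Omega>. u < R (N \<omega> + 2) \<omega>}"
      by (rule P.prob_random_index) measurable
    then have "(\<lambda>k. (1 - r) * (r ^ k * tail (distr \<Omega> borel (R (k + 2))) u)) sums P.prob {\<omega>\<in>space \<Omega>. u < R (N \<omega> + 2) \<omega>}"
      unfolding 1 .
    moreover from this have "summable (\<lambda>k. r ^ k * tail (distr \<Omega> borel (R (k + 2))) u)"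
      using r by (auto simp: sums_iff summable_cmult_iff)
    ultimately show ?thesis by (simp add: sums_iff suminf_mult)
  qed
  have "((\<lambda>u. (1 - r) * ((\<Sum>k. r ^ k * tail (distr \<Omega> borel (R (k + 2))) u) / tail F u))
      \<longlongrightarrow> (1 - r) * (\<Sum>k. r ^ k * (0 + real (k + 2) * a))) at_top"
    by (intro tendsto_mult tendsto_const geometric_sum_tail_asymp[where L="\<lambda>j. distr \<Omega> borel (R j)" and H=H] H R0 L_Suc a b r)
  also have "(1 - r) * (\<Sum>k. r ^ k * (0 + real (k + 2) * a)) = a * (1 + 1 / (1 - r))"
  proof -
    have "(\<lambda>k. (1 - r) * (r ^ k * (0 + real (k + 2) * a))) sums (a * (1 + 1 / (1 - r)))"
      using sums_geometric_weight[OF r, of a] by (simp add: mult.assoc)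
    then show ?thesis using r by (auto simp: sums_iff summable_cmult_iff suminf_mult)
  qed
  finally show ?thesis unfolding eq by simp
qed

text \<open>Only finitely many values of N occur, so the limit passes through the sum. For each of
  them 1 - x^j = (1 - x) (1 + x + ... + x^(j-1)) with x = \<open>cdf K u\<close> tending to
  1.\<close>

lemma random_max_tail:
  fixes N :: "'a \<Rightarrow> nat" and C :: "nat \<Rightarrow> 'a \<Rightarrow> real"
  assumes "prob_space \<Omega>" and N [measurable]: "N \<in> measurable \<Omega> (count_space UNIV)"
    and C [measurable]: "\<And>i. 1 \<le> i \<Longrightarrow> C i \<in> borel_measurable \<Omega>"
    and law_N: "\<And>k. measure \<Omega> {\<omega>\<in>space \<Omega>. N \<omega> = k} = (1 - r) * r ^ k"
    and ind: "\<And>k u. measure \<Omega> {\<omega>\<in>space \<Omega>. N \<omega> = k \<and> (\<forall>i\<in>{1..k + 2}. C i \<omega> \<le> u)}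
      = measure \<Omega> {\<omega>\<in>space \<Omega>. N \<omega> = k} * cdf K u ^ (k + 2)"
    and K: "nonneg_distribution K" and a: "((\<lambda>u. tail K u / tail F u) \<longlongrightarrow> a) at_top"
  shows "((\<lambda>u. measure \<Omega> {\<omega>\<in>space \<Omega>. u < Max ((\<lambda>i. C i \<omega>) ` {1..N \<omega> + 2}) \<and> N \<omega> < m} / tail F u)
    \<longlongrightarrow> (\<Sum>k<m. (1 - r) * r ^ k * (real (k + 2) * a))) at_top"
proof -
  interpret P: prob_space \<Omega> by fact
  interpret K: nonneg_distribution K by fact
  have 1: "P.prob {\<omega>\<in>space \<Omega>. N \<omega> = k \<and> u < Max ((\<lambda>i. C i \<omega>) ` {1..k + 2})}
      = (1 - r) * r ^ k * (1 - cdf K u ^ (k + 2))" for k u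
  proof -
    have [measurable]: "{\<omega>\<in>space \<Omega>. N \<omega> = k \<and> (\<forall>i\<in>{1..k + 2}. C i \<omega> \<le> u)} \<in> P.events"
    proof -
      have "{\<omega>\<in>space \<Omega>. N \<omega> = k} \<inter> (\<Inter>i\<in>{1..k + 2}. {\<omega>\<in>space \<Omega>. C i \<omega> \<le> u}) \<in> P.events"
        by (intro sets.Int sets.finite_INT) auto
      also have "{\<omega>\<in>space \<Omega>. N \<omega> = k} \<inter> (\<Inter>i\<in>{1..k + 2}. {\<omega>\<in>space \<Omega>. C i \<omega> \<le> u}) =
          {\<omega>\<in>space \<Omega>. N \<omega> = k \<and> (\<forall>i\<in>{1..k + 2}. C i \<omega> \<le> u)}" by auto
      finally show ?thesis .
    qed
    have "{\<omega>\<in>space \<Omega>. N \<omega> = k \<and> u < Max ((\<lambda>i. C i \<omega>) ` {1..k + 2})} =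
        {\<omega>\<in>space \<Omega>. N \<omega> = k} - {\<omega>\<in>space \<Omega>. N \<omega> = k \<and> (\<forall>i\<in>{1..k + 2}. C i \<omega> \<le> u)}"
      by (subst Max_gr_iff) (auto simp flip: not_le)
    then have "P.prob {\<omega>\<in>space \<Omega>. N \<omega> = k \<and> u < Max ((\<lambda>i. C i \<omega>) ` {1..k + 2})}
        = P.prob {\<omega>\<in>space \<Omega>. N \<omega> = k} - P.prob {\<omega>\<in>space \<Omega>. N \<omega> = k \<and> (\<forall>i\<in>{1..k + 2}. C i \<omega> \<le> u)}"
      by (simp only:, intro P.finite_measure_Diff) auto
    then show ?thesis unfolding ind law_N by (simp add: right_diff_distrib)
  qed
  have eq: "P.prob {\<omega>\<in>space \<Omega>. u < Max ((\<lambda>i. C i \<omega>) ` {1..N \<omega> + 2}) \<and> N \<omega> < m}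
      = (\<Sum>k<m. (1 - r) * r ^ k * (1 - cdf K u ^ (k + 2)))" for u
  proof -
    have ev: "{\<omega>\<in>space \<Omega>. N \<omega> = k \<and> u < Max ((\<lambda>i. C i \<omega>) ` {1..k + 2})} \<in> P.events" for k
    proof -
      have "{\<omega>\<in>space \<Omega>. N \<omega> = k} \<inter> (\<Union>i\<in>{1..k + 2}. {\<omega>\<in>space \<Omega>. u < C i \<omega>}) \<in> P.events"
        by (intro sets.Int sets.finite_UN) auto
      also have "{\<omega>\<in>space \<Omega>. N \<omega> = k} \<inter> (\<Union>i\<in>{1..k + 2}. {\<omega>\<in>space \<Omega>. u < C i \<omega>}) =
          {\<omega>\<in>space \<Omega>. N \<omega> = k \<and> u < Max ((\<lambda>i. C i \<omega>) ` {1..k + 2})}"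
        by (subst Max_gr_iff) auto
      finally show ?thesis .
    qed
    have "{\<omega>\<in>space \<Omega>. u < Max ((\<lambda>i. C i \<omega>) ` {1..N \<omega> + 2}) \<and> N \<omega> < m} =
        (\<Union>k<m. {\<omega>\<in>space \<Omega>. N \<omega> = k \<and> u < Max ((\<lambda>i. C i \<omega>) ` {1..k + 2})})" by auto
    then have "P.prob {\<omega>\<in>space \<Omega>. u < Max ((\<lambda>i. C i \<omega>) ` {1..N \<omega> + 2}) \<and> N \<omega> < m}
        = (\<Sum>k<m. P.prob {\<omega>\<in>space \<Omega>. N \<omega> = k \<and> u < Max ((\<lambda>i. C i \<omega>) ` {1..k + 2})})"
      using ev by (simp only:, intro P.finite_measure_finite_Union) (auto simp: disjoint_family_on_def)
    then show ?thesis unfolding 1 .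
  qed
  have "((\<lambda>u. (1 - cdf K u ^ j) / tail F u) \<longlongrightarrow> real j * a) at_top" for j
  proof -
    have eq: "(1 - cdf K u ^ j) / tail F u = (\<Sum>i<j. cdf K u ^ i) * (tail K u / tail F u)" for u
      using one_diff_power_eq[of "cdf K u" j] by (simp add: K.tail_eq)
    have "((\<lambda>u. (\<Sum>i<j. cdf K u ^ i) * (tail K u / tail F u)) \<longlongrightarrow> (\<Sum>i<j. 1 ^ i) * a) at_top"
      by (intro tendsto_intros K.cdf_lim_at_top_prob a)
    then show ?thesis unfolding eq by simp
  qed
  from this[of "_ + 2"]
  have "((\<lambda>u. \<Sum>k<m. (1 - r) * r ^ k * ((1 - cdf K u ^ (k + 2)) / tail F u))
      \<longlongrightarrow> (\<Sum>k<m. (1 - r) * r ^ k * (real (k + 2) * a))) at_top"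
    by (intro tendsto_sum tendsto_mult tendsto_const)
  then show ?thesis unfolding eq by (simp add: sum_divide_distrib)
qed

end

section \<open>Variance of the control variate estimator\<close>

text \<open>Numerator and denominator of the coefficient both gain c^2, so it does not change. This
  reduces the estimators to observations with values 0 and 1.\<close>

lemma cv_estimator_scale:
  assumes "c \<noteq> 0"
  shows "cv_estimator \<kappa> (c * m) (\<lambda>i. c * a i) (\<lambda>i. c * b i) = c * cv_estimator \<kappa> m a b"
proof -
  have mean: "emp_mean \<kappa> (\<lambda>i. c * x i) = c * emp_mean \<kappa> x" for x
    by (simp add: emp_mean_def sum_distrib_left)
  have "cv_coefficient \<kappa> (\<lambda>i. c * a i) (\<lambda>i. c * b i) =
      - ((c\<^sup>2 * (\<Sum>i=1..\<kappa>. (a i - emp_mean \<kappa> a) * (b i - emp_mean \<kappa> b))) /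
         (c\<^sup>2 * (\<Sum>i=1..\<kappa>. (b i - emp_mean \<kappa> b)\<^sup>2)))"
    unfolding cv_coefficient_def mean
    by (simp add: sum_distrib_left power2_eq_square algebra_simps)
  also have "\<dots> = cv_coefficient \<kappa> a b"
    using assms unfolding cv_coefficient_def by simp
  finally show ?thesis by (simp add: cv_estimator_def mean algebra_simps)
qed

lemma sum_of_bool_eq_card:
  fixes a :: "'i \<Rightarrow> real"
  assumes "finite I" "\<And>i. i \<in> I \<Longrightarrow> a i = 0 \<or> a i = 1"
  shows "sum a I = real (card {i\<in>I. a i = 1})"
proof -
  have "sum a I = (\<Sum>i\<in>I. of_bool (a i = 1))" using assms(2) by (intro sum.cong) auto
  then show ?thesis using assms(1) by (simp add: Int_def)
qed

text \<open>
  Unless two of the observations hit, the estimator is the mean of \<open>a - b\<close> or, after a single hit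
  of the control, its known expectation \<open>m\<close>; \<open>(sum a)\<^sup>2 - sum a\<close> counts the ordered pairs of hits.
\<close>

lemma cv_estimator_bernoulli:
  fixes a b :: "nat \<Rightarrow> real"
  assumes \<kappa>: "2 \<le> \<kappa>" and m: "0 \<le> m" "m \<le> 1"
    and ab: "\<And>i. i \<in> {1..\<kappa>} \<Longrightarrow> (a i, b i) \<in> {(0, 0), (1, 0), (1, 1)}"
  defines "T \<equiv> (\<Sum>i=1..\<kappa>. a i)\<^sup>2 - (\<Sum>i=1..\<kappa>. a i)" and "y \<equiv> emp_mean \<kappa> (\<lambda>i. a i - b i)"
  shows "\<bar>cv_estimator \<kappa> m a b\<bar> \<le> 2" and "0 \<le> y" and "y \<le> 1"
    and "\<bar>cv_estimator \<kappa> m a b - y\<bar> \<le> 3 * T + m * (\<Sum>i=1..\<kappa>. b i)"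
    and "\<bar>(cv_estimator \<kappa> m a b)\<^sup>2 - y\<^sup>2\<bar> \<le> 5 * T + m\<^sup>2 * (\<Sum>i=1..\<kappa>. b i)"
proof -
  define A where "A = (\<Sum>i=1..\<kappa>. a i)"
  define B where "B = (\<Sum>i=1..\<kappa>. b i)"
  define k where "k = real \<kappa>"
  have "2 \<le> k" using \<kappa> by (simp add: k_def)
  have a01: "a i = 0 \<or> a i = 1" and b01: "b i = 0 \<or> b i = 1" and "b i \<le> a i" and "a i * b i = b i" and "b i * b i = b i"
    if "i \<in> {1..\<kappa>}" for i using ab[OF that] by auto
  have BA: "B \<le> A" unfolding A_def B_def using \<open>\<And>i. i \<in> {1..\<kappa>} \<Longrightarrow> b i \<le> a i\<close> by (rule sum_mono)
  obtain nA where nA: "A = real nA" unfolding A_def using sum_of_bool_eq_card[of "{1..\<kappa>}" a] a01 by auto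
  obtain nB where nB: "B = real nB" unfolding B_def using sum_of_bool_eq_card[of "{1..\<kappa>}" b] b01 by auto
  have "A \<le> (\<Sum>i=1..\<kappa>. 1)" unfolding A_def using a01 by (intro sum_mono) force
  then have Ak: "A \<le> k" by (simp add: k_def)
  have mean: "emp_mean \<kappa> a = A / k" "emp_mean \<kappa> b = B / k" by (simp_all add: emp_mean_def A_def B_def k_def)
  \<comment> \<open>Since a b = b and b b = b, all centred sums depend only on the numbers A and B
    of hits.\<close>
  have num: "(\<Sum>i=1..\<kappa>. (a i - A / k) * (b i - B / k)) = B - A * B / k"
  proof -
    have lin: "(\<Sum>i=1..\<kappa>. b i - a i * x - y * b i + y * x) = B - A * x - y * B + k * (y * x)" for x y
      by (simp add: sum.distrib sum_subtractf A_def B_def k_def sum_distrib_left sum_distrib_right)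
    have "(\<Sum>i=1..\<kappa>. (a i - A / k) * (b i - B / k)) = (\<Sum>i=1..\<kappa>. b i - a i * (B / k) - A / k * b i + A / k * (B / k))"
      using \<open>\<And>i. i \<in> {1..\<kappa>} \<Longrightarrow> a i * b i = b i\<close> by (intro sum.cong) (auto simp: algebra_simps)
    also have "\<dots> = B - A * (B / k) - A / k * B + k * (A / k * (B / k))" by (rule lin)
    also have "\<dots> = B - A * B / k" using \<open>2 \<le> k\<close> by (simp add: field_simps)
    finally show ?thesis .
  qed
  have den: "(\<Sum>i=1..\<kappa>. (b i - B / k)\<^sup>2) = B - B * B / k"
  proof -
    have lin: "(\<Sum>i=1..\<kappa>. b i - 2 * x * b i + x * x) = B - 2 * x * B + k * (x * x)" for x
      by (simp add: sum.distrib sum_subtractf B_def k_def sum_distrib_left)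
    have "(\<Sum>i=1..\<kappa>. (b i - B / k)\<^sup>2) = (\<Sum>i=1..\<kappa>. b i - 2 * (B / k) * b i + B / k * (B / k))"
      using \<open>\<And>i. i \<in> {1..\<kappa>} \<Longrightarrow> b i * b i = b i\<close>
      by (intro sum.cong) (auto simp: algebra_simps power2_eq_square)
    also have "\<dots> = B - 2 * (B / k) * B + k * (B / k * (B / k))" by (rule lin)
    also have "\<dots> = B - B * B / k" using \<open>2 \<le> k\<close> by (simp add: field_simps)
    finally show ?thesis .
  qed
  \<comment> \<open>Minus the estimated coefficient. It lies in [0, 1] because B \<le> A \<le> k;
    for B = 0 and for B = k it is 0/0 = 0.\<close>
  define \<alpha> where "\<alpha> = (B - A * B / k) / (B - B * B / k)"
  have cv: "cv_estimator \<kappa> m a b = A / k - \<alpha> * (B / k - m)"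
    unfolding cv_estimator_def cv_coefficient_def mean num den \<alpha>_def by simp
  have "0 \<le> B" using nB by simp
  have le: "B - A * B / k \<le> B - B * B / k"
    using BA \<open>0 \<le> B\<close> \<open>2 \<le> k\<close> by (simp add: divide_right_mono mult_right_mono)
  have ge: "0 \<le> B - A * B / k"
  proof -
    have "A * B / k \<le> k * B / k" using Ak \<open>0 \<le> B\<close> \<open>2 \<le> k\<close> by (intro divide_right_mono mult_right_mono) auto
    then show ?thesis using \<open>2 \<le> k\<close> by simp
  qed
  have \<alpha>: "0 \<le> \<alpha>" "\<alpha> \<le> 1" unfolding \<alpha>_def using le ge by (auto simp: divide_le_eq_1)
  have Bk: "0 \<le> B / k" "B / k \<le> 1" "0 \<le> A / k" "A / k \<le> 1"
    using \<open>0 \<le> B\<close> BA Ak \<open>2 \<le> k\<close> by auto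
  have "\<bar>\<alpha> * (B / k - m)\<bar> \<le> 1 * 1"
    unfolding abs_mult using \<alpha> Bk m by (intro mult_mono) auto
  then show abs: "\<bar>cv_estimator \<kappa> m a b\<bar> \<le> 2" unfolding cv using Bk by linarith
  have y: "y = A / k - B / k" by (simp add: y_def emp_mean_def sum_subtractf A_def B_def k_def diff_divide_distrib)
  have "B / k \<le> A / k" using BA \<open>2 \<le> k\<close> by (simp add: divide_right_mono)
  then show y01: "0 \<le> y" "y \<le> 1" unfolding y using Bk by linarith+
  have T: "T = A * (A - 1)" by (simp add: T_def A_def power2_eq_square algebra_simps)
  show "\<bar>cv_estimator \<kappa> m a b - y\<bar> \<le> 3 * T + m * (\<Sum>i=1..\<kappa>. b i)"
    "\<bar>(cv_estimator \<kappa> m a b)\<^sup>2 - y\<^sup>2\<bar> \<le> 5 * T + m\<^sup>2 * (\<Sum>i=1..\<kappa>. b i)"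
  proof (atomize (full), goal_cases)
    case 1
    consider "nB = 0" | "nB = 1" "nA = 1" | "2 \<le> nA" using BA nA nB by fastforce
    then show ?case
    proof cases
      assume "nB = 0"
      then have "cv_estimator \<kappa> m a b = y" "B = 0" by (simp_all add: cv y nB \<alpha>_def)
      moreover have "0 \<le> T" unfolding T nA by (cases nA) auto
      ultimately show ?thesis by (simp add: B_def)
    next
      \<comment> \<open>Here \<kappa> \<ge> 2 is what makes the sample variance of the control
        nonzero, so that the quotient is 1.\<close>
      assume n: "nB = 1" "nA = 1"
      then have "\<alpha> = 1" using \<open>2 \<le> k\<close> by (simp add: \<alpha>_def nA nB)
      then have "cv_estimator \<kappa> m a b = m" "y = 0" "B = 1" "T = 0" using n by (simp_all add: cv y nA nB T)
      then show ?thesis using m by (simp add: B_def)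
    next
      \<comment> \<open>The constants 3 = 2 + 1 and 5 = 4 + 1 come from the crude bounds 2 for the
        estimator and 1 for y.\<close>
      assume "2 \<le> nA"
      then have "1 * 1 \<le> T" unfolding T nA by (intro mult_mono) auto
      moreover have "0 \<le> m * B" "0 \<le> m\<^sup>2 * B" using m \<open>0 \<le> B\<close> by auto
      moreover have "(cv_estimator \<kappa> m a b)\<^sup>2 \<le> 4"
        using abs abs_le_square_iff[of "cv_estimator \<kappa> m a b" 2] by simp
      moreover have "y\<^sup>2 \<le> 1" using y01 by (simp add: power_le_one)
      moreover have "0 \<le> (cv_estimator \<kappa> m a b)\<^sup>2" "0 \<le> y\<^sup>2" by auto
      ultimately show ?thesis using abs y01 unfolding B_def[symmetric] by (intro conjI) linarith+
    qed
  qed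
qed

section \<open>From counts of hits to the variance\<close>

text \<open>The second moment is recorded besides the variance because the number of ordered pairs
  of hits has mean \<kappa> (\<kappa> - 1) q^2, which makes the error terms quadratic in the hit
  probability.\<close>

lemma (in prob_space) bernoulli_sums:
  fixes X :: "nat \<Rightarrow> 'a \<Rightarrow> real"
  assumes ind: "indep_vars (\<lambda>_. borel) X {1..\<kappa>}"
    and X01: "\<And>i. i \<in> {1..\<kappa>} \<Longrightarrow> AE \<omega> in M. X i \<omega> = 0 \<or> X i \<omega> = 1"
    and EX: "\<And>i. i \<in> {1..\<kappa>} \<Longrightarrow> expectation (X i) = q"
  shows "integrable M (\<lambda>\<omega>. \<Sum>i=1..\<kappa>. X i \<omega>)" "integrable M (\<lambda>\<omega>. (\<Sum>i=1..\<kappa>. X i \<omega>)\<^sup>2)"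
    and "expectation (\<lambda>\<omega>. \<Sum>i=1..\<kappa>. X i \<omega>) = real \<kappa> * q"
    and "expectation (\<lambda>\<omega>. (\<Sum>i=1..\<kappa>. X i \<omega>)\<^sup>2) = real \<kappa> * q + real \<kappa> * (real \<kappa> - 1) * q\<^sup>2"
    and "1 \<le> \<kappa> \<Longrightarrow> variance (\<lambda>\<omega>. emp_mean \<kappa> (\<lambda>i. X i \<omega>)) = q * (1 - q) / real \<kappa>"
proof -
  have Xm: "X i \<in> borel_measurable M" if "i \<in> {1..\<kappa>}" for i
    using ind that by (auto simp: indep_vars_def)
  have int: "integrable M (X i)" if "i \<in> {1..\<kappa>}" for i
    using X01[OF that] by (intro integrable_const_bound[where B=1] Xm that) auto
  have prod_int: "integrable M (\<lambda>\<omega>. X i \<omega> * X j \<omega>)" if ij: "i \<in> {1..\<kappa>}" "j \<in> {1..\<kappa>}" for i j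
  proof (rule integrable_const_bound[where B=1])
    show "AE \<omega> in M. norm (X i \<omega> * X j \<omega>) \<le> 1" using X01[OF ij(1)] X01[OF ij(2)] by eventually_elim auto
    show "(\<lambda>\<omega>. X i \<omega> * X j \<omega>) \<in> borel_measurable M" using ij by (intro borel_measurable_times Xm)
  qed
  have prod: "expectation (\<lambda>\<omega>. X i \<omega> * X j \<omega>) = (if i = j then q else q\<^sup>2)" if ij: "i \<in> {1..\<kappa>}" "j \<in> {1..\<kappa>}" for i j
  proof (cases "i = j")
    case True
    have "expectation (\<lambda>\<omega>. X i \<omega> * X j \<omega>) = expectation (X i)"
    proof (rule integral_cong_AE)
      show "AE \<omega> in M. X i \<omega> * X j \<omega> = X i \<omega>" using X01[OF ij(1)] by eventually_elim (use True in auto)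
    qed (use Xm ij in auto)
    then show ?thesis using True EX ij by simp
  next
    case False
    have "expectation (\<lambda>\<omega>. \<Prod>l\<in>{i, j}. X l \<omega>) = (\<Prod>l\<in>{i, j}. expectation (X l))"
      using ij int by (intro indep_vars_lebesgue_integral indep_vars_subset[OF ind]) auto
    then show ?thesis using False EX ij by (simp add: power2_eq_square)
  qed
  have sq: "(\<Sum>i=1..\<kappa>. X i \<omega>)\<^sup>2 = (\<Sum>i=1..\<kappa>. \<Sum>j=1..\<kappa>. X i \<omega> * X j \<omega>)" for \<omega>
    by (simp add: power2_eq_square sum_product)
  show i1: "integrable M (\<lambda>\<omega>. \<Sum>i=1..\<kappa>. X i \<omega>)" using int by (intro Bochner_Integration.integrable_sum)
  show i2: "integrable M (\<lambda>\<omega>. (\<Sum>i=1..\<kappa>. X i \<omega>)\<^sup>2)"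
    unfolding sq using prod_int by (intro Bochner_Integration.integrable_sum)
  show e1: "expectation (\<lambda>\<omega>. \<Sum>i=1..\<kappa>. X i \<omega>) = real \<kappa> * q"
    using int EX by (subst Bochner_Integration.integral_sum) auto
  have "expectation (\<lambda>\<omega>. (\<Sum>i=1..\<kappa>. X i \<omega>)\<^sup>2) = (\<Sum>i=1..\<kappa>. \<Sum>j=1..\<kappa>. if i = j then q else q\<^sup>2)"
    unfolding sq using prod_int prod
    by (subst Bochner_Integration.integral_sum)
      (auto intro!: Bochner_Integration.integrable_sum sum.cong simp: Bochner_Integration.integral_sum)
  also have "\<dots> = (\<Sum>i=1..\<kappa>. \<Sum>j=1..\<kappa>. q\<^sup>2 + (if i = j then q - q\<^sup>2 else 0))"
    by (intro sum.cong) auto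
  also have "\<dots> = real \<kappa> * q + real \<kappa> * (real \<kappa> - 1) * q\<^sup>2"
    by (simp add: sum.distrib algebra_simps)
  finally show e2: "expectation (\<lambda>\<omega>. (\<Sum>i=1..\<kappa>. X i \<omega>)\<^sup>2) = real \<kappa> * q + real \<kappa> * (real \<kappa> - 1) * q\<^sup>2" .
  assume "1 \<le> \<kappa>"
  have "variance (\<lambda>\<omega>. emp_mean \<kappa> (\<lambda>i. X i \<omega>)) = expectation (\<lambda>\<omega>. (\<Sum>i=1..\<kappa>. X i \<omega>)\<^sup>2 / (real \<kappa>)\<^sup>2) - (expectation (\<lambda>\<omega>. (\<Sum>i=1..\<kappa>. X i \<omega>) / real \<kappa>))\<^sup>2"
    unfolding emp_mean_def using i1 i2 by (subst variance_eq) (auto simp: power_divide)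
  also have "\<dots> = (real \<kappa> * q + real \<kappa> * (real \<kappa> - 1) * q\<^sup>2) / (real \<kappa>)\<^sup>2 - q\<^sup>2"
    using \<open>1 \<le> \<kappa>\<close> e1 e2 by simp
  also have "\<dots> = q * (1 - q) / real \<kappa>"
    using \<open>1 \<le> \<kappa>\<close> by (simp add: field_simps power2_eq_square)
  finally show "variance (\<lambda>\<omega>. emp_mean \<kappa> (\<lambda>i. X i \<omega>)) = q * (1 - q) / real \<kappa>" .
qed

lemma (in prob_space) variance_cmult:
  fixes X :: "'a \<Rightarrow> real"
  shows "variance (\<lambda>\<omega>. c * X \<omega>) = c\<^sup>2 * variance X"
  by (simp add: right_diff_distrib[symmetric] power_mult_distrib)

text \<open>The squared means differ by (E X + E Y)(E X - E Y), and the first factor is at most 2 +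
  1 in absolute value; hence the 3.\<close>

lemma (in prob_space) variance_perturbation:
  fixes X Y D1 D2 :: "'a \<Rightarrow> real"
  assumes [measurable]: "X \<in> borel_measurable M" "Y \<in> borel_measurable M"
    and X: "AE \<omega> in M. \<bar>X \<omega>\<bar> \<le> 2" and Y: "AE \<omega> in M. 0 \<le> Y \<omega> \<and> Y \<omega> \<le> 1"
    and D: "integrable M D1" "integrable M D2"
    and 1: "AE \<omega> in M. \<bar>X \<omega> - Y \<omega>\<bar> \<le> D1 \<omega>" and 2: "AE \<omega> in M. \<bar>(X \<omega>)\<^sup>2 - (Y \<omega>)\<^sup>2\<bar> \<le> D2 \<omega>"
  shows "\<bar>variance X - variance Y\<bar> \<le> expectation D2 + 3 * expectation D1"
proof -
  have iX: "integrable M X" using X by (intro integrable_const_bound[where B=2]) auto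
  have iY: "integrable M Y" using Y by (intro integrable_const_bound[where B=1]) auto
  have iX2: "integrable M (\<lambda>\<omega>. (X \<omega>)\<^sup>2)"
  proof (rule integrable_const_bound[where B=4])
    show "AE \<omega> in M. norm ((X \<omega>)\<^sup>2) \<le> 4" using X
      by eventually_elim (use abs_le_square_iff[of _ 2] in auto)
  qed simp
  have iY2: "integrable M (\<lambda>\<omega>. (Y \<omega>)\<^sup>2)"
  proof (rule integrable_const_bound[where B=1])
    show "AE \<omega> in M. norm ((Y \<omega>)\<^sup>2) \<le> 1" using Y
      by eventually_elim (auto simp: power_le_one)
  qed simp
  have "\<bar>expectation X - expectation Y\<bar> = \<bar>expectation (\<lambda>\<omega>. X \<omega> - Y \<omega>)\<bar>" using iX iY by simp
  also have "\<dots> \<le> expectation (\<lambda>\<omega>. \<bar>X \<omega> - Y \<omega>\<bar>)" by (rule integral_abs_bound)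
  also have "\<dots> \<le> expectation D1"
    using iX iY D 1 by (intro integral_mono_AE) auto
  finally have d1: "\<bar>expectation X - expectation Y\<bar> \<le> expectation D1" .
  have "\<bar>expectation (\<lambda>\<omega>. (X \<omega>)\<^sup>2) - expectation (\<lambda>\<omega>. (Y \<omega>)\<^sup>2)\<bar> = \<bar>expectation (\<lambda>\<omega>. (X \<omega>)\<^sup>2 - (Y \<omega>)\<^sup>2)\<bar>" using iX2 iY2 by simp
  also have "\<dots> \<le> expectation (\<lambda>\<omega>. \<bar>(X \<omega>)\<^sup>2 - (Y \<omega>)\<^sup>2\<bar>)" by (rule integral_abs_bound)
  also have "\<dots> \<le> expectation D2"
    using iX2 iY2 D 2 by (intro integral_mono_AE) auto
  finally have d2: "\<bar>expectation (\<lambda>\<omega>. (X \<omega>)\<^sup>2) - expectation (\<lambda>\<omega>. (Y \<omega>)\<^sup>2)\<bar> \<le> expectation D2" .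
  have eX: "\<bar>expectation X\<bar> \<le> 2"
  proof -
    have "expectation (\<lambda>\<omega>. \<bar>X \<omega>\<bar>) \<le> expectation (\<lambda>_. 2)" using iX X by (intro integral_mono_AE) auto
    then show ?thesis using prob_space by (intro order_trans[OF integral_abs_bound]) simp
  qed
  have eY: "\<bar>expectation Y\<bar> \<le> 1"
  proof -
    have "expectation (\<lambda>\<omega>. \<bar>Y \<omega>\<bar>) \<le> expectation (\<lambda>_. 1)" using iY Y by (intro integral_mono_AE) auto
    then show ?thesis using prob_space by (intro order_trans[OF integral_abs_bound]) simp
  qed
  have "\<bar>(expectation X)\<^sup>2 - (expectation Y)\<^sup>2\<bar> = \<bar>expectation X + expectation Y\<bar> * \<bar>expectation X - expectation Y\<bar>"
    by (simp add: power2_eq_square square_diff_square_factored flip: abs_mult)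
  also have "\<dots> \<le> 3 * expectation D1" using eX eY d1 by (intro mult_mono) auto
  finally have "\<bar>(expectation X)\<^sup>2 - (expectation Y)\<^sup>2\<bar> \<le> 3 * expectation D1" .
  with d2 show ?thesis unfolding variance_eq[OF iX iX2] variance_eq[OF iY iY2] by linarith
qed

text \<open>Division by c turns the observations into indicators A and B with B \<le> A, of
  probabilities p and r. The leading term is the variance of the mean of A - B. The error is
  quadratic because two hits have probability of order p^2, and a single hit of the control, of
  probability of order r, replaces the mean by a number r.\<close>

theorem
  fixes Z W :: "'w \<Rightarrow> real" and Zs Ws :: "nat \<Rightarrow> 'v \<Rightarrow> real"
  assumes "prob_space P" and ZW [measurable]: "Z \<in> borel_measurable P" "W \<in> borel_measurable P"
    and "prob_space Q" and iid: "iid_copies P Z W Q \<kappa> Zs Ws" and \<kappa>: "2 \<le> \<kappa>" and "0 < c"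
    and vals: "AE \<omega> in P. (Z \<omega>, W \<omega>) \<in> {(0, 0), (c, 0), (c, c)}"
    and p: "prob_space.expectation P Z = c * p" and r: "prob_space.expectation P W = c * r"
  shows variance_cv_estimator: "\<bar>prob_space.variance Q (\<lambda>\<omega>. cv_estimator \<kappa> (prob_space.expectation P W) (\<lambda>i. Zs i \<omega>) (\<lambda>i. Ws i \<omega>))
      - c\<^sup>2 * ((p - r) * (1 - (p - r)) / real \<kappa>)\<bar> \<le> c\<^sup>2 * (18 * (real \<kappa>)\<^sup>2 * p\<^sup>2)"
    and variance_emp_mean: "prob_space.variance Q (\<lambda>\<omega>. emp_mean \<kappa> (\<lambda>i. Zs i \<omega>)) = c\<^sup>2 * (p * (1 - p) / real \<kappa>)"
proof -
  interpret P: prob_space P by fact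
  interpret Q: prob_space Q by fact
  let ?I = "{1..\<kappa>}" and ?B2 = "borel \<Otimes>\<^sub>M borel :: (real \<times> real) measure"
  let ?V = "{(0, 0), (1, 0), (1, 1)} :: (real \<times> real) set"
  define A where "A i \<omega> = Zs i \<omega> / c" for i \<omega>
  define B where "B i \<omega> = Ws i \<omega> / c" for i \<omega>
  have ind: "Q.indep_vars (\<lambda>_. ?B2) (\<lambda>i \<omega>. (Zs i \<omega>, Ws i \<omega>)) ?I"
    and law: "\<And>i. i \<in> ?I \<Longrightarrow> distr Q ?B2 (\<lambda>\<omega>. (Zs i \<omega>, Ws i \<omega>)) = distr P ?B2 (\<lambda>\<omega>. (Z \<omega>, W \<omega>))"
    using iid by (auto simp: iid_copies_def)
  have pair_m: "(\<lambda>\<omega>. (Zs i \<omega>, Ws i \<omega>)) \<in> measurable Q ?B2" if "i \<in> ?I" for i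
    using ind that by (auto simp: Q.indep_vars_def)
  have Zm: "Zs i \<in> borel_measurable Q" and Wm: "Ws i \<in> borel_measurable Q" if "i \<in> ?I" for i
    using measurable_compose[OF pair_m[OF that] measurable_fst] measurable_compose[OF pair_m[OF that] measurable_snd] by simp_all
  have transfer: "Q.expectation (\<lambda>\<omega>. f (Zs i \<omega>, Ws i \<omega>)) = P.expectation (\<lambda>\<omega>. f (Z \<omega>, W \<omega>))"
    if "f \<in> borel_measurable ?B2" "i \<in> ?I" for f :: "real \<times> real \<Rightarrow> real" and i
    using arg_cong[OF law[OF that(2)], of "\<lambda>M. integral\<^sup>L M f"] that pair_m[OF that(2)]
    by (simp add: integral_distr)
  have ABV: "AE \<omega> in Q. (A i \<omega>, B i \<omega>) \<in> ?V" if "i \<in> ?I" for i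
  proof -
    let ?V' = "{(0, 0), (c, 0), (c, c)} :: (real \<times> real) set"
    have "{x \<in> space ?B2. x \<in> ?V'} = ?V'" by (auto simp: space_pair_measure)
    moreover have "?V' \<in> sets ?B2" unfolding borel_prod by (intro borel_closed finite_imp_closed) auto
    ultimately have V': "{x \<in> space ?B2. x \<in> ?V'} \<in> sets ?B2" by (simp only:)
    have "AE x in distr P ?B2 (\<lambda>\<omega>. (Z \<omega>, W \<omega>)). x \<in> ?V'"
      using vals by (subst AE_distr_iff[OF _ V']) auto
    then have "AE x in distr Q ?B2 (\<lambda>\<omega>. (Zs i \<omega>, Ws i \<omega>)). x \<in> ?V'" unfolding law[OF that] .
    then have "AE \<omega> in Q. (Zs i \<omega>, Ws i \<omega>) \<in> ?V'" by (subst (asm) AE_distr_iff[OF pair_m[OF that] V'])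
    then show ?thesis by eventually_elim (use \<open>0 < c\<close> in \<open>auto simp: A_def B_def\<close>)
  qed
  have indA: "Q.indep_vars (\<lambda>_. borel) A ?I"
    unfolding A_def using Q.indep_vars_compose2[OF ind, of "\<lambda>_ x. fst x / c" "\<lambda>_. borel"] by simp
  have indB: "Q.indep_vars (\<lambda>_. borel) B ?I"
    unfolding B_def using Q.indep_vars_compose2[OF ind, of "\<lambda>_ x. snd x / c" "\<lambda>_. borel"] by simp
  have indD: "Q.indep_vars (\<lambda>_. borel) (\<lambda>i \<omega>. A i \<omega> - B i \<omega>) ?I"
    unfolding A_def B_def using Q.indep_vars_compose2[OF ind, of "\<lambda>_ x. fst x / c - snd x / c" "\<lambda>_. borel"] by simp
  have Am: "A i \<in> borel_measurable Q" and Bm: "B i \<in> borel_measurable Q" if "i \<in> ?I" for i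
    using indA indB that by (auto simp: Q.indep_vars_def)
  have EA: "Q.expectation (A i) = p" if "i \<in> ?I" for i
    using transfer[of "\<lambda>x. fst x / c" i] that p \<open>0 < c\<close> by (simp add: A_def[abs_def])
  have EB: "Q.expectation (B i) = r" if "i \<in> ?I" for i
    using transfer[of "\<lambda>x. snd x / c" i] that r \<open>0 < c\<close> by (simp add: B_def[abs_def])
  have A01: "AE \<omega> in Q. A i \<omega> = 0 \<or> A i \<omega> = 1" if "i \<in> ?I" for i
    using ABV[OF that] by eventually_elim auto
  have B01: "AE \<omega> in Q. B i \<omega> = 0 \<or> B i \<omega> = 1" if "i \<in> ?I" for i
    using ABV[OF that] by eventually_elim auto
  have D01: "AE \<omega> in Q. A i \<omega> - B i \<omega> = 0 \<or> A i \<omega> - B i \<omega> = 1" if "i \<in> ?I" for i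
    using ABV[OF that] by eventually_elim auto
  have intA: "integrable Q (A i)" and intB: "integrable Q (B i)" if "i \<in> ?I" for i
    using A01[OF that] B01[OF that] Am[OF that] Bm[OF that]
    by (auto intro!: Q.integrable_const_bound[where B=1])
  have ED: "Q.expectation (\<lambda>\<omega>. A i \<omega> - B i \<omega>) = p - r" if "i \<in> ?I" for i
    using EA EB intA intB that by simp
  note sumA = Q.bernoulli_sums[OF indA A01 EA]
  note sumB = Q.bernoulli_sums[OF indB B01 EB]
  note sumD = Q.bernoulli_sums[OF indD D01 ED]
  have 1: "1 \<in> ?I" using \<kappa> by auto
  have pr: "0 \<le> r" "r \<le> p" "p \<le> 1"
  proof -
    have "0 \<le> Q.expectation (B 1)" using B01[OF 1] by (intro integral_nonneg_AE) auto
    then show "0 \<le> r" using EB[OF 1] by simp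
    have "Q.expectation (B 1) \<le> Q.expectation (A 1)"
      using ABV[OF 1] intA[OF 1] intB[OF 1] by (intro integral_mono_AE) auto
    then show "r \<le> p" using EA[OF 1] EB[OF 1] by simp
    have "Q.expectation (A 1) \<le> Q.expectation (\<lambda>_. 1)"
      using A01[OF 1] intA[OF 1] by (intro integral_mono_AE) auto
    then show "p \<le> 1" using EA[OF 1] Q.prob_space by simp
  qed
  have "emp_mean \<kappa> (\<lambda>i. Zs i \<omega>) = c * emp_mean \<kappa> (\<lambda>i. A i \<omega>)" for \<omega>
    using \<open>0 < c\<close> by (simp add: emp_mean_def A_def sum_distrib_left)
  then show "Q.variance (\<lambda>\<omega>. emp_mean \<kappa> (\<lambda>i. Zs i \<omega>)) = c\<^sup>2 * (p * (1 - p) / real \<kappa>)"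
    using Q.variance_cmult[of c "\<lambda>\<omega>. emp_mean \<kappa> (\<lambda>i. A i \<omega>)"] sumA(5) \<kappa> by simp
  define X where "X \<omega> = cv_estimator \<kappa> r (\<lambda>i. A i \<omega>) (\<lambda>i. B i \<omega>)" for \<omega>
  define Y where "Y \<omega> = emp_mean \<kappa> (\<lambda>i. A i \<omega> - B i \<omega>)" for \<omega>
  define SA where "SA \<omega> = (\<Sum>i=1..\<kappa>. A i \<omega>)" for \<omega>
  define SB where "SB \<omega> = (\<Sum>i=1..\<kappa>. B i \<omega>)" for \<omega>
  have eq: "cv_estimator \<kappa> (P.expectation W) (\<lambda>i. Zs i \<omega>) (\<lambda>i. Ws i \<omega>) = c * X \<omega>" for \<omega>
  proof -
    have "Zs i \<omega> = c * A i \<omega>" "Ws i \<omega> = c * B i \<omega>" for i using \<open>0 < c\<close> by (simp_all add: A_def B_def)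
    then show ?thesis
      using cv_estimator_scale[of c \<kappa> r "\<lambda>i. A i \<omega>" "\<lambda>i. B i \<omega>"] r \<open>0 < c\<close> by (simp add: X_def)
  qed
  have AEV: "AE \<omega> in Q. \<forall>i\<in>?I. (A i \<omega>, B i \<omega>) \<in> ?V"
    using ABV by (intro AE_finite_allI) auto
  have meas: "X \<in> borel_measurable Q" "Y \<in> borel_measurable Q"
    unfolding X_def Y_def cv_estimator_def cv_coefficient_def emp_mean_def
    using Am Bm
    by (auto intro!: borel_measurable_add borel_measurable_times borel_measurable_divide borel_measurable_sum
        borel_measurable_diff borel_measurable_power borel_measurable_uminus)
  have intT: "integrable Q SA" "integrable Q (\<lambda>\<omega>. (SA \<omega>)\<^sup>2)" "integrable Q SB"
    using sumA(1,2) sumB(1) by (simp_all add: SA_def[abs_def] SB_def[abs_def])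
  have "\<bar>Q.variance X - Q.variance Y\<bar> \<le> Q.expectation (\<lambda>\<omega>. 5 * ((SA \<omega>)\<^sup>2 - SA \<omega>) + r\<^sup>2 * SB \<omega>)
      + 3 * Q.expectation (\<lambda>\<omega>. 3 * ((SA \<omega>)\<^sup>2 - SA \<omega>) + r * SB \<omega>)"
  proof (rule Q.variance_perturbation[OF meas])
    note bern = cv_estimator_bernoulli[OF \<kappa> pr(1) order_trans[OF pr(2,3)]]
    show "AE \<omega> in Q. \<bar>X \<omega>\<bar> \<le> 2" using AEV unfolding X_def by eventually_elim (rule bern, blast)
    show "AE \<omega> in Q. 0 \<le> Y \<omega> \<and> Y \<omega> \<le> 1" using AEV unfolding Y_def
      by eventually_elim (intro conjI bern(2,3), blast+)
    show "AE \<omega> in Q. \<bar>X \<omega> - Y \<omega>\<bar> \<le> 3 * ((SA \<omega>)\<^sup>2 - SA \<omega>) + r * SB \<omega>"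
      using AEV unfolding X_def Y_def SA_def SB_def by eventually_elim (rule bern, blast)
    show "AE \<omega> in Q. \<bar>(X \<omega>)\<^sup>2 - (Y \<omega>)\<^sup>2\<bar> \<le> 5 * ((SA \<omega>)\<^sup>2 - SA \<omega>) + r\<^sup>2 * SB \<omega>"
      using AEV unfolding X_def Y_def SA_def SB_def by eventually_elim (rule bern, blast)
  qed (use intT in auto)
  also have "Q.expectation (\<lambda>\<omega>. 5 * ((SA \<omega>)\<^sup>2 - SA \<omega>) + r\<^sup>2 * SB \<omega>)
      = 5 * (real \<kappa> * (real \<kappa> - 1) * p\<^sup>2) + r\<^sup>2 * (real \<kappa> * r)"
    using intT sumA(3,4)[folded SA_def] sumB(3)[folded SB_def] by (simp add: algebra_simps)
  also have "Q.expectation (\<lambda>\<omega>. 3 * ((SA \<omega>)\<^sup>2 - SA \<omega>) + r * SB \<omega>)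
      = 3 * (real \<kappa> * (real \<kappa> - 1) * p\<^sup>2) + r * (real \<kappa> * r)"
    using intT sumA(3,4)[folded SA_def] sumB(3)[folded SB_def] by (simp add: algebra_simps)
  also have "5 * (real \<kappa> * (real \<kappa> - 1) * p\<^sup>2) + r\<^sup>2 * (real \<kappa> * r)
      + 3 * (3 * (real \<kappa> * (real \<kappa> - 1) * p\<^sup>2) + r * (real \<kappa> * r)) \<le> 18 * (real \<kappa>)\<^sup>2 * p\<^sup>2"
  proof -
    have k: "real \<kappa> * (real \<kappa> - 1) * p\<^sup>2 \<le> (real \<kappa>)\<^sup>2 * p\<^sup>2"
      by (intro mult_right_mono) (auto simp: power2_eq_square algebra_simps)
    have "r\<^sup>2 \<le> p\<^sup>2" using pr by (intro power_mono) auto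
    moreover have "real \<kappa> \<le> (real \<kappa>)\<^sup>2" using \<kappa> by (simp add: power2_eq_square)
    ultimately have k1: "real \<kappa> * r\<^sup>2 \<le> (real \<kappa>)\<^sup>2 * p\<^sup>2" by (intro mult_mono) auto
    have "real \<kappa> * r\<^sup>2 * r \<le> real \<kappa> * r\<^sup>2" using pr by (intro mult_left_le) auto
    then have k2: "r\<^sup>2 * (real \<kappa> * r) \<le> real \<kappa> * r\<^sup>2" by (simp add: mult_ac)
    have e: "r * (real \<kappa> * r) = real \<kappa> * r\<^sup>2" by (simp add: power2_eq_square)
    \<comment> \<open>Pairs of hits account for 5 + 9 = 14 of the 18, single hits of the control for
      1 + 3 = 4.\<close>
    have lin: "5 * x + y + 3 * (3 * x + z) \<le> 18 * w" if "x \<le> w" "y \<le> z" "z \<le> w" for x y z w :: real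
      using that by (simp add: algebra_simps)
    show ?thesis unfolding e mult.assoc[of 18] by (rule lin[OF k k2 k1])
  qed
  also have "Q.variance Y = (p - r) * (1 - (p - r)) / real \<kappa>"
    unfolding Y_def using sumD(5) \<kappa> by simp
  finally have "\<bar>Q.variance X - (p - r) * (1 - (p - r)) / real \<kappa>\<bar> \<le> 18 * (real \<kappa>)\<^sup>2 * p\<^sup>2" .
  then have "c\<^sup>2 * \<bar>Q.variance X - (p - r) * (1 - (p - r)) / real \<kappa>\<bar> \<le> c\<^sup>2 * (18 * (real \<kappa>)\<^sup>2 * p\<^sup>2)"
    by (intro mult_left_mono) auto
  moreover have "c\<^sup>2 * \<bar>Q.variance X - (p - r) * (1 - (p - r)) / real \<kappa>\<bar>
      = \<bar>c\<^sup>2 * Q.variance X - c\<^sup>2 * ((p - r) * (1 - (p - r)) / real \<kappa>)\<bar>"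
    by (simp only: right_diff_distrib[symmetric] abs_mult) simp
  ultimately show "\<bar>Q.variance (\<lambda>\<omega>. cv_estimator \<kappa> (P.expectation W) (\<lambda>i. Zs i \<omega>) (\<lambda>i. Ws i \<omega>))
      - c\<^sup>2 * ((p - r) * (1 - (p - r)) / real \<kappa>)\<bar> \<le> c\<^sup>2 * (18 * (real \<kappa>)\<^sup>2 * p\<^sup>2)"
    unfolding eq Q.variance_cmult by simp
qed

section \<open>Asymptotic variances for an abstract expansion\<close>

context subexponential_distribution
begin

text \<open>Common form of both expansions: R is a random walk started in R 0, and each increment X
  dominates a nonnegative C that enters the control. The laws H of X and K of C share the constant
  a, so for every value of N sum and maximum agree to first order, and only the values N \<ge> n - 1
  remain in the difference of the two probabilities. W is prescribed for u \<ge> 0 only: for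
  negative u the value 0 of the truncated maximum would count as a hit.\<close>

theorem
  fixes N :: "'a \<Rightarrow> nat" and R X C :: "nat \<Rightarrow> 'a \<Rightarrow> real" and Z W :: "real \<Rightarrow> 'a \<Rightarrow> real"
    and Zs Ws :: "real \<Rightarrow> nat \<Rightarrow> 'v \<Rightarrow> real"
  assumes ps: "prob_space \<Omega>" and N [measurable]: "N \<in> measurable \<Omega> (count_space UNIV)"
    and law_N: "\<And>k. measure \<Omega> {\<omega>\<in>space \<Omega>. N \<omega> = k} = (1 - r) * r ^ k" and r: "0 \<le> r" "r < 1"
    and R_Suc: "\<And>j \<omega>. R (Suc j) \<omega> = R j \<omega> + X (Suc j) \<omega>"
    and ind_R: "\<And>j. prob_space.indep_var \<Omega> borel (X (Suc j)) borel (R j)"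
    and ind_N: "\<And>j. prob_space.indep_var \<Omega> borel (\<lambda>\<omega>. real (N \<omega>)) borel (R j)"
    and law_X: "\<And>j. distr \<Omega> borel (X (Suc j)) = H" and H: "nonneg_distribution H"
    and a: "((\<lambda>u. tail H u / tail F u) \<longlongrightarrow> a) at_top"
    and R0: "AE \<omega> in \<Omega>. 0 \<le> R 0 \<omega>"
    and b: "((\<lambda>u. tail (distr \<Omega> borel (R 0)) u / tail F u) \<longlongrightarrow> 0) at_top"
    and C [measurable]: "\<And>i. 1 \<le> i \<Longrightarrow> C i \<in> borel_measurable \<Omega>"
    and ind_C: "\<And>k u. measure \<Omega> {\<omega>\<in>space \<Omega>. N \<omega> = k \<and> (\<forall>i\<in>{1..k + 2}. C i \<omega> \<le> u)}
      = measure \<Omega> {\<omega>\<in>space \<Omega>. N \<omega> = k} * cdf K u ^ (k + 2)"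
    and K: "nonneg_distribution K" "((\<lambda>u. tail K u / tail F u) \<longlongrightarrow> a) at_top"
    and CX: "\<And>j. AE \<omega> in \<Omega>. 0 \<le> C (Suc j) \<omega> \<and> C (Suc j) \<omega> \<le> X (Suc j) \<omega>"
    and c: "0 < c" and n: "1 \<le> n" and \<kappa>: "2 \<le> \<kappa>"
    and Z: "\<And>u. Z u = (\<lambda>\<omega>. c * of_bool (u < R (N \<omega> + 2) \<omega>))"
    and W: "\<And>u. 0 \<le> u \<Longrightarrow>
      W u = (\<lambda>\<omega>. c * of_bool (u < Max ((\<lambda>i. C i \<omega>) ` {1..N \<omega> + 2}) \<and> N \<omega> < n - 1))"
    and S: "prob_space S" and iid: "\<And>u. iid_copies \<Omega> (Z u) (W u) S \<kappa> (Zs u) (Ws u)"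
  shows variance_cv_estimator_asymp:
    "((\<lambda>u. prob_space.variance S (\<lambda>\<omega>. cv_estimator \<kappa> (prob_space.expectation \<Omega> (W u))
        (\<lambda>i. Zs u i \<omega>) (\<lambda>i. Ws u i \<omega>)) / tail F u)
      \<longlongrightarrow> c\<^sup>2 * (a * (r ^ (n - 1) * (1 + real n * (1 - r)) / (1 - r)) / real \<kappa>)) at_top"
    and variance_emp_mean_asymp:
    "((\<lambda>u. prob_space.variance S (\<lambda>\<omega>. emp_mean \<kappa> (\<lambda>i. Zs u i \<omega>)) / tail F u)
      \<longlongrightarrow> c\<^sup>2 * (a * (1 + 1 / (1 - r)) / real \<kappa>)) at_top"
proof -
  interpret P: prob_space \<Omega> by fact
  interpret S: prob_space S by fact
  have R [measurable]: "R j \<in> borel_measurable \<Omega>" for j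
    using P.indep_var_rv2[OF ind_R[of j]] .
  have RN [measurable]: "(\<lambda>\<omega>. R (N \<omega> + 2) \<omega>) \<in> borel_measurable \<Omega>"
    by (rule measurable_compose_countable[OF _ N]) measurable
  have MN [measurable]: "(\<lambda>\<omega>. Max ((\<lambda>i. C i \<omega>) ` {1..N \<omega> + 2})) \<in> borel_measurable \<Omega>"
    by (rule measurable_compose_countable[OF _ N]) (auto intro!: borel_measurable_Max)
  define p where "p u = P.prob {\<omega>\<in>space \<Omega>. u < R (N \<omega> + 2) \<omega>}" for u
  define w where "w u = P.prob {\<omega>\<in>space \<Omega>. u < Max ((\<lambda>i. C i \<omega>) ` {1..N \<omega> + 2}) \<and> N \<omega> < n - 1}" for u
  have EZ: "P.expectation (Z u) = c * p u" for u
  proof -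
    have "P.expectation (Z u) = P.expectation (\<lambda>\<omega>. c * indicator {\<omega>\<in>space \<Omega>. u < R (N \<omega> + 2) \<omega>} \<omega>)"
      unfolding Z by (intro Bochner_Integration.integral_cong) (auto simp: indicator_def)
    then show ?thesis by (simp add: p_def)
  qed
  have EW: "P.expectation (W u) = c * w u" if "0 \<le> u" for u
  proof -
    have "P.expectation (W u) = P.expectation (\<lambda>\<omega>. c * indicator {\<omega>\<in>space \<Omega>. u < Max ((\<lambda>i. C i \<omega>) ` {1..N \<omega> + 2}) \<and> N \<omega> < n - 1} \<omega>)"
      unfolding W[OF that] by (intro Bochner_Integration.integral_cong) (auto simp: indicator_def)
    then show ?thesis by (simp add: w_def)
  qed
  \<comment> \<open>A hit of the control is thereby a hit of Z, which excludes the observation (0,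
    c).\<close>
  have Max_le: "AE \<omega> in \<Omega>. Max ((\<lambda>i. C i \<omega>) ` {1..N \<omega> + 2}) \<le> R (N \<omega> + 2) \<omega>"
  proof -
    have "AE \<omega> in \<Omega>. \<forall>j. 0 \<le> C (Suc j) \<omega> \<and> C (Suc j) \<omega> \<le> X (Suc j) \<omega>"
      using CX by (simp add: AE_all_countable)
    with R0 show ?thesis
    proof eventually_elim
      case (elim \<omega>)
      have "0 \<le> R k \<omega> \<and> (\<forall>i\<in>{1..k}. C i \<omega> \<le> R k \<omega>)" for k
      proof (induction k)
        case (Suc k)
        have X: "0 \<le> C (Suc k) \<omega>" "C (Suc k) \<omega> \<le> X (Suc k) \<omega>" using elim by auto
        have "C i \<omega> \<le> R (Suc k) \<omega>" if "i \<in> {1..Suc k}" for i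
        proof (cases "i = Suc k")
          case True
          then show ?thesis using Suc X by (simp add: R_Suc)
        next
          case False
          then have "C i \<omega> \<le> R k \<omega>" using that Suc by auto
          then show ?thesis using X by (simp add: R_Suc)
        qed
        then show ?case using Suc X by (simp add: R_Suc)
      qed (use elim in simp)
      then show ?case by (subst Max_le_iff) auto
    qed
  qed
  have vals: "AE \<omega> in \<Omega>. (Z u \<omega>, W u \<omega>) \<in> {(0, 0), (c, 0), (c, c)}" if "0 \<le> u" for u
    using Max_le
  proof eventually_elim
    case (elim \<omega>)
    have gen: "(c * of_bool Q, c * of_bool Q') \<in> {(0, 0), (c, 0), (c, c)}" if "Q' \<Longrightarrow> Q" for Q Q'
      using that by auto
    then show ?case
      unfolding Z W[OF that] by (intro gen less_le_trans[OF _ elim]) (rule conjunct1)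
  qed
  have Zm: "Z u \<in> borel_measurable \<Omega>" for u unfolding Z by measurable
  have Wm: "W u \<in> borel_measurable \<Omega>" if "0 \<le> u" for u unfolding W[OF that] by measurable
  have R0': "nonneg_distribution (distr \<Omega> borel (R 0))" by (intro P.nonneg_distribution_distr R R0)
  define A where "A = a * (1 + 1 / (1 - r))"
  define D where "D = a * (r ^ (n - 1) * (1 + real n * (1 - r)) / (1 - r))"
  have p_lim: "((\<lambda>u. p u / tail F u) \<longlongrightarrow> A) at_top"
    unfolding p_def A_def
    by (rule random_sum_tail[where R=R and X=X and H=H]) (fact ps N law_N r R_Suc ind_R ind_N law_X H R0' a b)+
  have "((\<lambda>u. w u / tail F u) \<longlongrightarrow> (\<Sum>k<n - 1. (1 - r) * r ^ k * (real (k + 2) * a))) at_top"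
    unfolding w_def by (rule random_max_tail[where K=K]) (fact ps N C law_N ind_C K)+
  from tendsto_diff[OF p_lim this]
  have s_lim: "((\<lambda>u. (p u - w u) / tail F u) \<longlongrightarrow> D) at_top"
    using sum_geometric_weight[OF r(2), of a "n - 1"] n by (simp add: A_def D_def diff_divide_distrib)
  \<comment> \<open>Anything of the order of the tail vanishes; this removes the factors 1 - p and 1
    - (p - w) in the limit.\<close>
  have vanish: "(f \<longlongrightarrow> 0) at_top" if "((\<lambda>u. f u / tail F u) \<longlongrightarrow> l) at_top" for f l
    using tendsto_mult[OF that tail_tendsto_0] tail_pos by (simp add: less_imp_neq[symmetric])
  note p0 = vanish[OF p_lim] and s0 = vanish[OF s_lim]
  have "((\<lambda>u. c\<^sup>2 * ((p u / tail F u) * (1 - p u) / real \<kappa>)) \<longlongrightarrow> c\<^sup>2 * (A * (1 - 0) / real \<kappa>)) at_top"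
    using \<kappa> by (intro tendsto_intros p_lim p0) auto
  moreover have "\<forall>\<^sub>F u in at_top. c\<^sup>2 * ((p u / tail F u) * (1 - p u) / real \<kappa>)
      = S.variance (\<lambda>\<omega>. emp_mean \<kappa> (\<lambda>i. Zs u i \<omega>)) / tail F u"
    using eventually_ge_at_top[of 0]
  proof eventually_elim
    case (elim u)
    show ?case
      unfolding variance_emp_mean[OF ps Zm Wm[OF elim] S iid \<kappa> c vals[OF elim] EZ EW[OF elim]] by simp
  qed
  ultimately show "((\<lambda>u. S.variance (\<lambda>\<omega>. emp_mean \<kappa> (\<lambda>i. Zs u i \<omega>)) / tail F u)
      \<longlongrightarrow> c\<^sup>2 * (a * (1 + 1 / (1 - r)) / real \<kappa>)) at_top"
    unfolding A_def by (simp add: tendsto_cong)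
  define v where "v u = S.variance (\<lambda>\<omega>. cv_estimator \<kappa> (P.expectation (W u)) (\<lambda>i. Zs u i \<omega>) (\<lambda>i. Ws u i \<omega>))" for u
  define g where "g u = c\<^sup>2 * ((p u - w u) * (1 - (p u - w u)) / real \<kappa>)" for u
  \<comment> \<open>The error p^2, divided by the tail, is the convergent ratio p / tail times p,
    which tends to 0.\<close>
  have bound: "\<forall>\<^sub>F u in at_top. norm ((v u - g u) / tail F u) \<le> c\<^sup>2 * (18 * (real \<kappa>)\<^sup>2 * (p u / tail F u * p u))"
    using eventually_ge_at_top[of 0]
  proof eventually_elim
    case (elim u)
    have "\<bar>v u - g u\<bar> \<le> c\<^sup>2 * (18 * (real \<kappa>)\<^sup>2 * (p u)\<^sup>2)"
      unfolding v_def g_def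
      by (rule variance_cv_estimator[OF ps Zm Wm[OF elim] S iid \<kappa> c vals[OF elim] EZ EW[OF elim]])
    from divide_right_mono[OF this, of "tail F u"] tail_pos[of u]
    show ?case by (simp add: power2_eq_square mult_ac)
  qed
  have "((\<lambda>u. c\<^sup>2 * (18 * (real \<kappa>)\<^sup>2 * (p u / tail F u * p u))) \<longlongrightarrow> c\<^sup>2 * (18 * (real \<kappa>)\<^sup>2 * (A * 0))) at_top"
    by (intro tendsto_intros p_lim p0)
  then have "((\<lambda>u. (v u - g u) / tail F u) \<longlongrightarrow> 0) at_top"
    by (intro Lim_null_comparison[OF bound]) simp
  moreover have "((\<lambda>u. c\<^sup>2 * (((p u - w u) / tail F u) * (1 - (p u - w u)) / real \<kappa>)) \<longlongrightarrow> c\<^sup>2 * (D * (1 - 0) / real \<kappa>)) at_top"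
    using \<kappa> by (intro tendsto_intros s_lim s0) auto
  ultimately have "((\<lambda>u. (v u - g u) / tail F u + c\<^sup>2 * (((p u - w u) / tail F u) * (1 - (p u - w u)) / real \<kappa>))
      \<longlongrightarrow> 0 + c\<^sup>2 * (D * (1 - 0) / real \<kappa>)) at_top"
    by (rule tendsto_add)
  moreover have "(v u - g u) / tail F u + c\<^sup>2 * (((p u - w u) / tail F u) * (1 - (p u - w u)) / real \<kappa>) = v u / tail F u" for u
  proof -
    have "c\<^sup>2 * (((p u - w u) / tail F u) * (1 - (p u - w u)) / real \<kappa>) = g u / tail F u"
      by (simp add: g_def mult_ac)
    then show ?thesis by (simp add: diff_divide_distrib)
  qed
  ultimately have "((\<lambda>u. v u / tail F u) \<longlongrightarrow> c\<^sup>2 * (D / real \<kappa>)) at_top" by simp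
  then show "((\<lambda>u. S.variance (\<lambda>\<omega>. cv_estimator \<kappa> (P.expectation (W u)) (\<lambda>i. Zs u i \<omega>) (\<lambda>i. Ws u i \<omega>)) / tail F u)
      \<longlongrightarrow> c\<^sup>2 * (a * (r ^ (n - 1) * (1 + real n * (1 - r)) / (1 - r)) / real \<kappa>)) at_top"
    by (simp add: v_def D_def)
qed

end

section \<open>The two expansions\<close>

lemma (in prob_space) indep_var_restrict_compose:
  assumes "indep_vars (\<lambda>_. borel) Y I" "A \<inter> B = {}" "A \<subseteq> I" "B \<subseteq> I"
    and "f \<in> borel_measurable (PiM A (\<lambda>_. borel))" "g \<in> borel_measurable (PiM B (\<lambda>_. borel))"
  shows "indep_var borel (\<lambda>\<omega>. f (restrict (\<lambda>i. Y i \<omega>) A)) borel (\<lambda>\<omega>. g (restrict (\<lambda>i. Y i \<omega>) B))"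
  using indep_var_compose[OF indep_var_restrict[OF assms(1-4)] assms(5,6)] by (simp add: comp_def)

text \<open>\<open>c\<close> is the index of the count and \<open>e\<close> places the claims in the
  family, so that both input families are covered.\<close>

lemma (in prob_space) indep_count_and_bounds:
  assumes ind: "indep_vars (\<lambda>_. borel) Y I" and c: "c \<in> I" "c \<notin> e ` {1..m}"
    and e: "e ` {1..m} \<subseteq> I" "inj_on e {1..m}"
    and K: "\<And>i. i \<in> {1..m} \<Longrightarrow> prob {\<omega>\<in>space M. Y (e i) \<omega> \<le> u} = K"
  shows "prob {\<omega>\<in>space M. Y c \<omega> = (x::real) \<and> (\<forall>i\<in>{1..m}. Y (e i) \<omega> \<le> u)} = prob {\<omega>\<in>space M. Y c \<omega> = x} * K ^ m"
proof -
  let ?J = "insert c (e ` {1..m})" and ?A = "\<lambda>i. if i = c then {x} else {..u}"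
  have eq: "Y i -` ?A i \<inter> space M = (if i = c then {\<omega>\<in>space M. Y c \<omega> = x} else {\<omega>\<in>space M. Y i \<omega> \<le> u})" for i
    by auto
  have "prob (\<Inter>i\<in>?J. Y i -` ?A i \<inter> space M) = (\<Prod>i\<in>?J. prob (Y i -` ?A i \<inter> space M))"
    using c e by (intro indep_varsD[OF ind]) auto
  also have "(\<Inter>i\<in>?J. Y i -` ?A i \<inter> space M) = {\<omega>\<in>space M. Y c \<omega> = x \<and> (\<forall>i\<in>{1..m}. Y (e i) \<omega> \<le> u)}"
    unfolding eq using c by auto
  also have "(\<Prod>i\<in>?J. prob (Y i -` ?A i \<inter> space M)) = prob {\<omega>\<in>space M. Y c \<omega> = x} * (\<Prod>i\<in>e ` {1..m}. prob {\<omega>\<in>space M. Y i \<omega> \<le> u})"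
    unfolding eq using c by (subst prod.insert) (auto intro!: prod.cong)
  also have "(\<Prod>i\<in>e ` {1..m}. prob {\<omega>\<in>space M. Y i \<omega> \<le> u}) = K ^ m"
    using e K by (subst prod.reindex) (auto simp: o_def)
  finally show ?thesis .
qed

text \<open>The input families store the count as a real number; rounding down recovers it.\<close>

lemma measurable_real_nat:
  fixes N :: "'a \<Rightarrow> nat"
  assumes "(\<lambda>\<omega>. real (N \<omega>)) \<in> borel_measurable M"
  shows "N \<in> measurable M (count_space UNIV)"
proof -
  have "(\<lambda>\<omega>. nat \<lfloor>real (N \<omega>)\<rfloor>) \<in> measurable M (count_space UNIV)"
    using assms by measurable
  then show ?thesis by simp
qed

lemma (in prob_space) new_inputs_indep:
  assumes ind: "indep_vars (\<lambda>_. borel) (new_inputs N Mb Ce) (UNIV - {Excess 0})"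
  shows "Mb k \<in> borel_measurable M" and "1 \<le> k \<Longrightarrow> Ce k \<in> borel_measurable M"
    and "N \<in> measurable M (count_space UNIV)"
    and "indep_var borel (Mb (Suc j)) borel (Ce (Suc j))"
    and "indep_var borel (\<lambda>\<omega>. Mb (Suc j) \<omega> + Ce (Suc j) \<omega>) borel (\<lambda>\<omega>. Mb 0 \<omega> + (\<Sum>i=1..j. Mb i \<omega> + Ce i \<omega>))"
    and "indep_var borel (\<lambda>\<omega>. real (N \<omega>)) borel (\<lambda>\<omega>. Mb 0 \<omega> + (\<Sum>i=1..j. Mb i \<omega> + Ce i \<omega>))"
proof -
  have rv: "new_inputs N Mb Ce s \<in> borel_measurable M" if "s \<noteq> Excess 0" for s
    using ind that by (auto simp: indep_vars_def)
  show "Mb k \<in> borel_measurable M" using rv[of "Base k"] by (simp add: new_inputs_def)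
  show "1 \<le> k \<Longrightarrow> Ce k \<in> borel_measurable M" using rv[of "Excess k"] by (simp add: new_inputs_def)
  show "N \<in> measurable M (count_space UNIV)"
    using rv[of Count] by (intro measurable_real_nat) (simp add: new_inputs_def)
  have "indep_var borel (\<lambda>\<omega>. (\<lambda>x. x (Base (Suc j))) (restrict (\<lambda>s. new_inputs N Mb Ce s \<omega>) {Base (Suc j)}))
      borel (\<lambda>\<omega>. (\<lambda>x. x (Excess (Suc j))) (restrict (\<lambda>s. new_inputs N Mb Ce s \<omega>) {Excess (Suc j)}))"
    by (rule indep_var_restrict_compose[OF ind]) (auto intro!: measurable_component_singleton)
  then show "indep_var borel (Mb (Suc j)) borel (Ce (Suc j))"
    by (simp add: new_inputs_def)
  \<comment> \<open>The inputs of the j-th partial sum, disjoint both from those of the next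
    increment and from the count.\<close>
  let ?B = "Base ` {0..j} \<union> Excess ` {1..j}"
  let ?g = "\<lambda>x. x (Base 0) + (\<Sum>i=1..j. x (Base i) + x (Excess i)) :: real"
  have g: "?g \<in> borel_measurable (PiM ?B (\<lambda>_. borel))"
    by (intro borel_measurable_add borel_measurable_sum measurable_component_singleton) auto
  have eqg: "?g (restrict (\<lambda>s. new_inputs N Mb Ce s \<omega>) ?B) = Mb 0 \<omega> + (\<Sum>i=1..j. Mb i \<omega> + Ce i \<omega>)" for \<omega>
    by (auto simp: new_inputs_def intro!: sum.cong)
  have "indep_var borel (\<lambda>\<omega>. (\<lambda>x. x (Base (Suc j)) + x (Excess (Suc j))) (restrict (\<lambda>s. new_inputs N Mb Ce s \<omega>) {Base (Suc j), Excess (Suc j)}))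
      borel (\<lambda>\<omega>. ?g (restrict (\<lambda>s. new_inputs N Mb Ce s \<omega>) ?B))"
    by (rule indep_var_restrict_compose[OF ind _ _ _ _ g])
      (auto intro!: borel_measurable_add measurable_component_singleton)
  then show "indep_var borel (\<lambda>\<omega>. Mb (Suc j) \<omega> + Ce (Suc j) \<omega>) borel (\<lambda>\<omega>. Mb 0 \<omega> + (\<Sum>i=1..j. Mb i \<omega> + Ce i \<omega>))"
    unfolding eqg by (simp add: new_inputs_def)
  have "indep_var borel (\<lambda>\<omega>. (\<lambda>x. x Count) (restrict (\<lambda>s. new_inputs N Mb Ce s \<omega>) {Count}))
      borel (\<lambda>\<omega>. ?g (restrict (\<lambda>s. new_inputs N Mb Ce s \<omega>) ?B))"
    by (rule indep_var_restrict_compose[OF ind _ _ _ _ g])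
      (auto intro!: measurable_component_singleton)
  then show "indep_var borel (\<lambda>\<omega>. real (N \<omega>)) borel (\<lambda>\<omega>. Mb 0 \<omega> + (\<Sum>i=1..j. Mb i \<omega> + Ce i \<omega>))"
    unfolding eqg by (simp add: new_inputs_def)
qed

lemma (in prob_space) pk_inputs_indep:
  assumes ind: "indep_vars (\<lambda>_. borel) (pk_inputs N Ue) UNIV"
  shows "1 \<le> k \<Longrightarrow> Ue k \<in> borel_measurable M"
    and "N \<in> measurable M (count_space UNIV)"
    and "indep_var borel (Ue (Suc j)) borel (\<lambda>\<omega>. \<Sum>i=1..j. Ue i \<omega>)"
    and "indep_var borel (\<lambda>\<omega>. real (N \<omega>)) borel (\<lambda>\<omega>. \<Sum>i=1..j. Ue i \<omega>)"
proof -
  have rv: "pk_inputs N Ue s \<in> borel_measurable M" for s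
    using ind by (auto simp: indep_vars_def)
  show "1 \<le> k \<Longrightarrow> Ue k \<in> borel_measurable M" using rv[of k] by (simp add: pk_inputs_def)
  show "N \<in> measurable M (count_space UNIV)"
    using rv[of 0] by (intro measurable_real_nat) (simp add: pk_inputs_def)
  have eq: "(\<Sum>i=1..j. pk_inputs N Ue i \<omega>) = (\<Sum>i=1..j. Ue i \<omega>)" for \<omega>
    by (intro sum.cong) (auto simp: pk_inputs_def)
  \<comment> \<open>In \<open>pk_inputs\<close> index 0 holds the count, so a sum over 1..j is
    independent of the entry at Suc j and of the entry at 0.\<close>
  show "indep_var borel (Ue (Suc j)) borel (\<lambda>\<omega>. \<Sum>i=1..j. Ue i \<omega>)"
    using indep_vars_sum[of "{1..j}" "Suc j" "pk_inputs N Ue"] indep_vars_subset[OF ind]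
    unfolding eq by (simp add: pk_inputs_def)
  show "indep_var borel (\<lambda>\<omega>. real (N \<omega>)) borel (\<lambda>\<omega>. \<Sum>i=1..j. Ue i \<omega>)"
    using indep_vars_sum[of "{1..j}" 0 "pk_inputs N Ue"] indep_vars_subset[OF ind]
    unfolding eq by (simp add: pk_inputs_def)
qed

lemma (in prob_space) AE_nonneg_of_distr:
  assumes "X \<in> borel_measurable M" "distr M borel X = K" "nonneg_distribution K"
  shows "AE \<omega> in M. 0 \<le> X \<omega>"
proof -
  interpret K: nonneg_distribution K by fact
  have "AE x in distr M borel X. 0 \<le> x" unfolding assms(2) by (rule K.nonneg)
  then show ?thesis using assms(1) by (simp add: AE_distr_iff)
qed

section \<open>The two instances of the abstract expansion\<close>

context subexponential_distribution
begin

text \<open>The walk starts in \<open>Mb 0\<close> and has increments \<open>Mb k + Ce k\<close>.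
  Since M is negligible against \<open>F\<close>, the increments have the same tail asymptotics as
  \<open>Ce k\<close> alone, so a = 1.\<close>

lemma
  assumes ps: "prob_space \<Omega>" and ind: "prob_space.indep_vars \<Omega> (\<lambda>_. borel) (new_inputs N Mb Ce) (UNIV - {Excess 0})"
    and law_N: "\<And>k. measure \<Omega> {\<omega>\<in>space \<Omega>. N \<omega> = k} = (1 - r) * r ^ k" and r: "0 < r" "r < 1"
    and law_Mb: "\<And>k. distr \<Omega> borel (Mb k) = M" and law_Ce: "\<And>k. 1 \<le> k \<Longrightarrow> distr \<Omega> borel (Ce k) = F"
    and M: "nonneg_distribution M" "((\<lambda>u. tail M u / tail F u) \<longlongrightarrow> 0) at_top"
    and n: "1 \<le> n" and \<kappa>: "2 \<le> \<kappa>"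
    and Z: "Z = (\<lambda>u \<omega>. r\<^sup>2 * of_bool (V_new N Mb Ce \<omega> > u))"
    and W: "W = (\<lambda>u \<omega>. r\<^sup>2 * of_bool (Vn_new n N Ce \<omega> > u))"
    and S: "prob_space S" and iid: "\<And>u. iid_copies \<Omega> (Z u) (W u) S \<kappa> (Zs u) (Ws u)"
  shows variance_cv_estimator_new:
    "((\<lambda>u. prob_space.variance S (\<lambda>\<omega>. cv_estimator \<kappa> (prob_space.expectation \<Omega> (W u))
        (\<lambda>i. Zs u i \<omega>) (\<lambda>i. Ws u i \<omega>)) / tail F u)
      \<longlongrightarrow> (r\<^sup>2)\<^sup>2 * (1 * (r ^ (n - 1) * (1 + real n * (1 - r)) / (1 - r)) / real \<kappa>)) at_top"
    and variance_emp_mean_new: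
    "((\<lambda>u. prob_space.variance S (\<lambda>\<omega>. emp_mean \<kappa> (\<lambda>i. Zs u i \<omega>)) / tail F u)
      \<longlongrightarrow> (r\<^sup>2)\<^sup>2 * (1 * (1 + 1 / (1 - r)) / real \<kappa>)) at_top"
proof -
  interpret P: prob_space \<Omega> by fact
  interpret M: nonneg_distribution M by fact
  interpret MF: nonneg_pair M F ..
  note indep = P.new_inputs_indep[OF ind]
  have tail_one: "((\<lambda>u. tail F u / tail F u) \<longlongrightarrow> 1) at_top"
    using tail_pos by (simp add: less_imp_neq[symmetric])
  define R where "R j \<omega> = Mb 0 \<omega> + (\<Sum>i=1..j. Mb i \<omega> + Ce i \<omega>)" for j \<omega>
  define X where "X j \<omega> = Mb j \<omega> + Ce j \<omega>" for j \<omega>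
  have law_X: "distr \<Omega> borel (X (Suc j)) = (M \<star> F)" for j
    unfolding X_def using P.sum_indep_random_variable[OF indep(4) indep(1) indep(2)] by (simp add: law_Mb law_Ce)
  have R_0: "R 0 = Mb 0" by (simp add: R_def fun_eq_iff)
  have tail_MF: "((\<lambda>u. tail (M \<star> F) u / tail F u) \<longlongrightarrow> 1) at_top"
    using tail_convolution_asymp[OF M(1) nonneg_distribution_axioms M(2) tail_one] by simp
  have V: "V_new N Mb Ce \<omega> = R (N \<omega> + 2) \<omega>" for \<omega>
    unfolding V_new_def R_def by (subst sum.atLeast_Suc_atMost) (auto simp: numeral_2_eq_2)
  have Z': "Z u = (\<lambda>\<omega>. r\<^sup>2 * of_bool (u < R (N \<omega> + 2) \<omega>))" for u by (simp add: Z V)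
  have W': "W u = (\<lambda>\<omega>. r\<^sup>2 * of_bool (u < Max ((\<lambda>i. Ce i \<omega>) ` {1..N \<omega> + 2}) \<and> N \<omega> < n - 1))"
    if "0 \<le> u" for u
  proof
    fix \<omega>
    have "N \<omega> + 2 \<le> n \<longleftrightarrow> N \<omega> < n - 1" using n by linarith
    then show "W u \<omega> = r\<^sup>2 * of_bool (u < Max ((\<lambda>i. Ce i \<omega>) ` {1..N \<omega> + 2}) \<and> N \<omega> < n - 1)"
      using that by (cases "N \<omega> < n - 1") (simp_all add: W Vn_new_def)
  qed
  have Mb_nonneg: "AE \<omega> in \<Omega>. 0 \<le> Mb k \<omega>" for k
    using P.AE_nonneg_of_distr[OF indep(1) law_Mb M(1)] .
  have Ce_nonneg: "AE \<omega> in \<Omega>. 0 \<le> Ce (Suc k) \<omega>" for k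
    using P.AE_nonneg_of_distr[OF indep(2) law_Ce nonneg_distribution_axioms] by simp
  have ind_C: "P.prob {\<omega>\<in>space \<Omega>. N \<omega> = k \<and> (\<forall>i\<in>{1..k + 2}. Ce i \<omega> \<le> u)}
      = P.prob {\<omega>\<in>space \<Omega>. N \<omega> = k} * cdf F u ^ (k + 2)" for k u
  proof -
    have "P.prob {\<omega>\<in>space \<Omega>. new_inputs N Mb Ce Count \<omega> = real k \<and> (\<forall>i\<in>{1..k + 2}. new_inputs N Mb Ce (Excess i) \<omega> \<le> u)}
        = P.prob {\<omega>\<in>space \<Omega>. new_inputs N Mb Ce Count \<omega> = real k} * cdf F u ^ (k + 2)"
    proof (rule P.indep_count_and_bounds[OF ind])
      fix i assume i: "i \<in> {1..k + 2}"
      then show "P.prob {\<omega>\<in>space \<Omega>. new_inputs N Mb Ce (Excess i) \<omega> \<le> u} = cdf F u"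
        using cdf_distr[OF indep(2)[of i]] law_Ce[of i] by (simp add: new_inputs_def)
    qed (auto simp: inj_on_def)
    then show ?thesis by (simp add: new_inputs_def)
  qed
  have CX: "AE \<omega> in \<Omega>. 0 \<le> Ce (Suc j) \<omega> \<and> Ce (Suc j) \<omega> \<le> X (Suc j) \<omega>" for j
    using Ce_nonneg[of j] Mb_nonneg[of "Suc j"] by eventually_elim (simp add: X_def)
  have R_Suc: "R (Suc j) \<omega> = R j \<omega> + X (Suc j) \<omega>" for j \<omega> by (simp add: R_def X_def)
  have ind_R: "P.indep_var borel (X (Suc j)) borel (R j)" for j
    using indep(5)[of j] by (simp add: R_def[abs_def] X_def[abs_def])
  have ind_N: "P.indep_var borel (\<lambda>\<omega>. real (N \<omega>)) borel (R j)" for j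
    using indep(6)[of j] by (simp add: R_def[abs_def])
  have R0: "AE \<omega> in \<Omega>. 0 \<le> R 0 \<omega>" using Mb_nonneg by (simp add: R_0)
  have b: "((\<lambda>u. tail (distr \<Omega> borel (R 0)) u / tail F u) \<longlongrightarrow> 0) at_top"
    using M(2) by (simp add: R_0 law_Mb)
  note facts = ps indep(3) law_N less_imp_le[OF r(1)] r(2) R_Suc ind_R ind_N law_X
    MF.nonneg_distribution_convolution tail_MF R0 b indep(2) ind_C nonneg_distribution_axioms tail_one CX
    zero_less_power[OF r(1)] n \<kappa> Z' W' S iid
  show "((\<lambda>u. prob_space.variance S (\<lambda>\<omega>. cv_estimator \<kappa> (prob_space.expectation \<Omega> (W u))
        (\<lambda>i. Zs u i \<omega>) (\<lambda>i. Ws u i \<omega>)) / tail F u)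
      \<longlongrightarrow> (r\<^sup>2)\<^sup>2 * (1 * (r ^ (n - 1) * (1 + real n * (1 - r)) / (1 - r)) / real \<kappa>)) at_top"
    by (rule variance_cv_estimator_asymp[where R=R and X=X and H="M \<star> F" and K=F and C=Ce]) (fact facts)+
  show "((\<lambda>u. prob_space.variance S (\<lambda>\<omega>. emp_mean \<kappa> (\<lambda>i. Zs u i \<omega>)) / tail F u)
      \<longlongrightarrow> (r\<^sup>2)\<^sup>2 * (1 * (1 + 1 / (1 - r)) / real \<kappa>)) at_top"
    by (rule variance_emp_mean_asymp[where R=R and X=X and H="M \<star> F" and K=F and C=Ce]) (fact facts)+
qed

text \<open>The walk starts in 0, and the increments themselves enter the control, so X = C and H =
  K; the constant a is left open.\<close>

lemma
  assumes ps: "prob_space \<Omega>" and ind: "prob_space.indep_vars \<Omega> (\<lambda>_. borel) (pk_inputs N Ue) UNIV"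
    and law_N: "\<And>k. measure \<Omega> {\<omega>\<in>space \<Omega>. N \<omega> = k} = (1 - r) * r ^ k" and r: "0 < r" "r < 1"
    and law_Ue: "\<And>k. 1 \<le> k \<Longrightarrow> distr \<Omega> borel (Ue k) = H"
    and H: "nonneg_distribution H" "((\<lambda>u. tail H u / tail F u) \<longlongrightarrow> a) at_top"
    and n: "1 \<le> n" and \<kappa>: "2 \<le> \<kappa>"
    and Z: "Z = (\<lambda>u \<omega>. r\<^sup>2 * of_bool (V_pk N Ue \<omega> > u))"
    and W: "W = (\<lambda>u \<omega>. r\<^sup>2 * of_bool (Vn_pk n N Ue \<omega> > u))"
    and S: "prob_space S" and iid: "\<And>u. iid_copies \<Omega> (Z u) (W u) S \<kappa> (Zs u) (Ws u)"
  shows variance_cv_estimator_pk: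
    "((\<lambda>u. prob_space.variance S (\<lambda>\<omega>. cv_estimator \<kappa> (prob_space.expectation \<Omega> (W u))
        (\<lambda>i. Zs u i \<omega>) (\<lambda>i. Ws u i \<omega>)) / tail F u)
      \<longlongrightarrow> (r\<^sup>2)\<^sup>2 * (a * (r ^ (n - 1) * (1 + real n * (1 - r)) / (1 - r)) / real \<kappa>)) at_top"
    and variance_emp_mean_pk:
    "((\<lambda>u. prob_space.variance S (\<lambda>\<omega>. emp_mean \<kappa> (\<lambda>i. Zs u i \<omega>)) / tail F u)
      \<longlongrightarrow> (r\<^sup>2)\<^sup>2 * (a * (1 + 1 / (1 - r)) / real \<kappa>)) at_top"
proof -
  interpret P: prob_space \<Omega> by fact
  interpret H: nonneg_distribution H by fact
  note indep = P.pk_inputs_indep[OF ind]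
  define R where "R j \<omega> = (\<Sum>i=1..j. Ue i \<omega>)" for j \<omega>
  have R_0: "R 0 = (\<lambda>\<omega>. 0)" by (simp add: R_def fun_eq_iff)
  have Z': "Z u = (\<lambda>\<omega>. r\<^sup>2 * of_bool (u < R (N \<omega> + 2) \<omega>))" for u by (simp add: Z V_pk_def R_def)
  have W': "W u = (\<lambda>\<omega>. r\<^sup>2 * of_bool (u < Max ((\<lambda>i. Ue i \<omega>) ` {1..N \<omega> + 2}) \<and> N \<omega> < n - 1))"
    if "0 \<le> u" for u
  proof
    fix \<omega>
    have "int (N \<omega>) \<le> int n - 2 \<longleftrightarrow> N \<omega> < n - 1" using n by linarith
    then show "W u \<omega> = r\<^sup>2 * of_bool (u < Max ((\<lambda>i. Ue i \<omega>) ` {1..N \<omega> + 2}) \<and> N \<omega> < n - 1)"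
      using that by (cases "N \<omega> < n - 1") (simp_all add: W Vn_pk_def)
  qed
  have Ue_nonneg: "AE \<omega> in \<Omega>. 0 \<le> Ue (Suc k) \<omega>" for k
    using P.AE_nonneg_of_distr[OF indep(1) law_Ue H(1)] by simp
  have ind_C: "P.prob {\<omega>\<in>space \<Omega>. N \<omega> = k \<and> (\<forall>i\<in>{1..k + 2}. Ue i \<omega> \<le> u)}
      = P.prob {\<omega>\<in>space \<Omega>. N \<omega> = k} * cdf H u ^ (k + 2)" for k u
  proof -
    have "P.prob {\<omega>\<in>space \<Omega>. pk_inputs N Ue 0 \<omega> = real k \<and> (\<forall>i\<in>{1..k + 2}. pk_inputs N Ue i \<omega> \<le> u)}
        = P.prob {\<omega>\<in>space \<Omega>. pk_inputs N Ue 0 \<omega> = real k} * cdf H u ^ (k + 2)"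
    proof (rule P.indep_count_and_bounds[OF ind, where e="\<lambda>i. i"])
      fix i assume i: "i \<in> {1..k + 2}"
      then show "P.prob {\<omega>\<in>space \<Omega>. pk_inputs N Ue i \<omega> \<le> u} = cdf H u"
        using cdf_distr[OF indep(1)[of i]] law_Ue[of i] by (simp add: pk_inputs_def)
    qed (auto simp: inj_on_def)
    then show ?thesis by (simp add: pk_inputs_def)
  qed
  have CX: "AE \<omega> in \<Omega>. 0 \<le> Ue (Suc j) \<omega> \<and> Ue (Suc j) \<omega> \<le> Ue (Suc j) \<omega>" for j
    using Ue_nonneg[of j] by eventually_elim simp
  have R_Suc: "R (Suc j) \<omega> = R j \<omega> + Ue (Suc j) \<omega>" for j \<omega> by (simp add: R_def)
  have ind_R: "P.indep_var borel (Ue (Suc j)) borel (R j)" for j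
    using indep(3)[of j] by (simp add: R_def[abs_def])
  have ind_N: "P.indep_var borel (\<lambda>\<omega>. real (N \<omega>)) borel (R j)" for j
    using indep(4)[of j] by (simp add: R_def[abs_def])
  have law_X: "distr \<Omega> borel (Ue (Suc j)) = H" for j by (rule law_Ue) simp
  have R0: "AE \<omega> in \<Omega>. 0 \<le> R 0 \<omega>" by (simp add: R_0)
  have b: "((\<lambda>u. tail (distr \<Omega> borel (R 0)) u / tail F u) \<longlongrightarrow> 0) at_top"
    by (rule tendsto_eventually)
      (use eventually_ge_at_top[of 0] in eventually_elim, simp add: R_0 tail_return_0)
  note facts = ps indep(2) law_N less_imp_le[OF r(1)] r(2) R_Suc ind_R ind_N law_X
    H(1) H(2) R0 b indep(1) ind_C CX zero_less_power[OF r(1)] n \<kappa> Z' W' S iid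
  show "((\<lambda>u. prob_space.variance S (\<lambda>\<omega>. cv_estimator \<kappa> (prob_space.expectation \<Omega> (W u))
        (\<lambda>i. Zs u i \<omega>) (\<lambda>i. Ws u i \<omega>)) / tail F u)
      \<longlongrightarrow> (r\<^sup>2)\<^sup>2 * (a * (r ^ (n - 1) * (1 + real n * (1 - r)) / (1 - r)) / real \<kappa>)) at_top"
    by (rule variance_cv_estimator_asymp[where R=R and X=Ue and H=H and K=H and C=Ue]) (fact facts)+
  show "((\<lambda>u. prob_space.variance S (\<lambda>\<omega>. emp_mean \<kappa> (\<lambda>i. Zs u i \<omega>)) / tail F u)
      \<longlongrightarrow> (r\<^sup>2)\<^sup>2 * (a * (1 + 1 / (1 - r)) / real \<kappa>)) at_top"
    by (rule variance_emp_mean_asymp[where R=R and X=Ue and H=H and K=H and C=Ue]) (fact facts)+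
qed

end

section \<open>Identification of the model quantities and the final limits\<close>

lemma (in prob_space) distr_eqI_cdf:
  assumes [measurable]: "X \<in> borel_measurable M" and K: "real_distribution K"
    and law: "\<And>u. prob {\<omega>\<in>space M. X \<omega> \<le> u} = cdf K u"
  shows "distr M borel X = K"
proof (rule cdf_unique)
  show "cdf (distr M borel X) = cdf K" by (simp add: fun_eq_iff cdf_distr law)
qed (use K in auto)

theorem corollary3p8:
  fixes \<epsilon> lam \<mu>B \<mu>C \<delta> \<theta> \<rho>b \<rho> q :: real
    and \<kappa> n :: nat
    and P :: "'p measure" and B C U :: "'p \<Rightarrow> real"
    and Fp Fh G Fpe Fhe Ge :: "real \<Rightarrow> real"
    and \<Omega> :: "'a measure" and N :: "'a \<Rightarrow> nat" and Mb Ce :: "nat \<Rightarrow> 'a \<Rightarrow> real"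
    and \<Omega>0 :: "'b measure" and N0 :: "'b \<Rightarrow> nat" and Ue :: "nat \<Rightarrow> 'b \<Rightarrow> real"
    and Z W :: "real \<Rightarrow> 'a \<Rightarrow> real" and Z0 W0 :: "real \<Rightarrow> 'b \<Rightarrow> real"
    and S :: "'c measure" and Zs Ws :: "real \<Rightarrow> nat \<Rightarrow> 'c \<Rightarrow> real"
    and S0 :: "'d measure" and Zs0 Ws0 :: "real \<Rightarrow> nat \<Rightarrow> 'd \<Rightarrow> real"
    and zhat phihat :: "real \<Rightarrow> 'c \<Rightarrow> real" and zhat0 phihat0 :: "real \<Rightarrow> 'd \<Rightarrow> real"
  \<comment> \<open>the claim size distribution and the model parameters\<close>
  assumes "0 < \<epsilon>" "\<epsilon> < 1" "0 < lam"
    and "prob_space P"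
    and "phase_type P B" "integrable P B" "\<mu>B = prob_space.expectation P B" "0 < \<mu>B"
    and "Fp = cdf (distr P borel B)"
    and "integrable P C" "\<mu>C = prob_space.expectation P C"
    and "Fh = cdf (distr P borel C)" "subexponential Fh"
    and "U \<in> borel_measurable P" "G = cdf (distr P borel U)"
    and "G = (\<lambda>x. (1 - \<epsilon>) * Fp x + \<epsilon> * Fh x)"
    and "\<delta> = lam * \<mu>B" "\<theta> = lam * \<mu>C" "\<rho>b = (1 - \<epsilon>) * \<delta>"
    and "\<rho> = lam * prob_space.expectation P U" "\<rho> < 1"
    and "q = \<epsilon> * \<theta> / (1 - \<rho>b)"
    and "Fpe = excess \<mu>B Fp" "Fhe = excess \<mu>C Fh" "Ge = excess (prob_space.expectation P U) G"
    and "subexponential Fhe"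
  \<comment> \<open>the new series expansion\<close>
    and "prob_space \<Omega>"
    and "\<And>k. measure \<Omega> {\<omega>\<in>space \<Omega>. N \<omega> = k} = (1 - \<rho>) / (1 - \<rho>b) * q ^ k"
    and "\<And>k u. measure \<Omega> {\<omega>\<in>space \<Omega>. Mb k \<omega> \<le> u} = (1 - \<rho>b) * (\<Sum>j. \<rho>b ^ j * conv_power Fpe j u)"
    and "\<And>k u. k \<ge> 1 \<Longrightarrow> measure \<Omega> {\<omega>\<in>space \<Omega>. Ce k \<omega> \<le> u} = Fhe u"
    and "prob_space.indep_vars \<Omega> (\<lambda>_. borel) (new_inputs N Mb Ce) (UNIV - {Excess 0})"
    and "Z = (\<lambda>u \<omega>. q\<^sup>2 * of_bool (V_new N Mb Ce \<omega> > u))"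
    and "W = (\<lambda>u \<omega>. q\<^sup>2 * of_bool (Vn_new n N Ce \<omega> > u))"
  \<comment> \<open>the Pollaczek--Khinchine expansion\<close>
    and "prob_space \<Omega>0"
    and "\<And>k. measure \<Omega>0 {\<omega>\<in>space \<Omega>0. N0 \<omega> = k} = (1 - \<rho>) * \<rho> ^ k"
    and "\<And>k u. k \<ge> 1 \<Longrightarrow> measure \<Omega>0 {\<omega>\<in>space \<Omega>0. Ue k \<omega> \<le> u} = Ge u"
    and "prob_space.indep_vars \<Omega>0 (\<lambda>_. borel) (pk_inputs N0 Ue) UNIV"
    and "Z0 = (\<lambda>u \<omega>. \<rho>\<^sup>2 * of_bool (V_pk N0 Ue \<omega> > u))"
    and "W0 = (\<lambda>u \<omega>. \<rho>\<^sup>2 * of_bool (Vn_pk n N0 Ue \<omega> > u))"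
  \<comment> \<open>the simulations and the estimators\<close>
    and "1 \<le> n" "2 \<le> \<kappa>"
    and "prob_space S" "\<And>u. iid_copies \<Omega> (Z u) (W u) S \<kappa> (Zs u) (Ws u)"
    and "prob_space S0" "\<And>u. iid_copies \<Omega>0 (Z0 u) (W0 u) S0 \<kappa> (Zs0 u) (Ws0 u)"
    and "zhat = (\<lambda>u \<omega>. emp_mean \<kappa> (\<lambda>i. Zs u i \<omega>))"
    and "zhat0 = (\<lambda>u \<omega>. emp_mean \<kappa> (\<lambda>i. Zs0 u i \<omega>))"
    and "phihat = (\<lambda>u \<omega>. cv_estimator \<kappa> (prob_space.expectation \<Omega> (W u)) (\<lambda>i. Zs u i \<omega>) (\<lambda>i. Ws u i \<omega>))"
    and "phihat0 = (\<lambda>u \<omega>. cv_estimator \<kappa> (prob_space.expectation \<Omega>0 (W0 u)) (\<lambda>i. Zs0 u i \<omega>) (\<lambda>i. Ws0 u i \<omega>))"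
  shows "ratio_sim
           (\<lambda>u. prob_space.variance S (phihat u) / prob_space.variance S0 (phihat0 u))
           (\<lambda>u. (\<epsilon> * \<theta> / (1 - \<rho>b) / \<rho>) ^ (n + 2) *
                ((1 + real n * ((1 - \<rho>) / (1 - \<rho>b))) / (1 + real n * (1 - \<rho>))))
       \<and> ((\<lambda>u. (prob_space.variance S (phihat u) / prob_space.variance S (zhat u)) *
                inverse (prob_space.variance S0 (phihat0 u) / prob_space.variance S0 (zhat0 u)))
          \<longlongrightarrow> (\<epsilon> * \<theta> / (1 - \<rho>b) / \<rho>) ^ (n - 1) *
              ((1 + real n * ((1 - \<rho>) / (1 - \<rho>b))) / (1 + real n * (1 - \<rho>))) *
              ((1 + (1 - \<rho>)) / (1 + (1 - \<rho>) / (1 - \<rho>b)))) at_top"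
proof -
  interpret P: prob_space P by fact
  interpret \<Omega>: prob_space \<Omega> by fact
  interpret \<Omega>0: prob_space \<Omega>0 by fact
  interpret S: prob_space S by fact
  interpret S0: prob_space S0 by fact
  note \<mu>B = \<open>\<mu>B = P.expectation B\<close> and \<mu>C = \<open>\<mu>C = P.expectation C\<close>
    and Fp = \<open>Fp = cdf (distr P borel B)\<close> and Fh = \<open>Fh = cdf (distr P borel C)\<close>
    and intB = \<open>integrable P B\<close> and intC = \<open>integrable P C\<close>
  note [measurable] = borel_measurable_integrable[OF intB] borel_measurable_integrable[OF intC]
  have B0: "AE \<omega> in P. 0 \<le> B \<omega>"
    by (rule phase_type_tail(1)) (use \<open>prob_space P\<close> \<open>phase_type P B\<close> in auto)
  obtain c\<^sub>0 \<eta> where \<eta>: "0 < \<eta>" and B_tail: "\<And>u. 0 \<le> u \<Longrightarrow> P.prob {\<omega>\<in>space P. u < B \<omega>} \<le> c\<^sub>0 * exp (- \<eta> * u)"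
    using phase_type_tail(2)[OF \<open>prob_space P\<close> _ \<open>phase_type P B\<close>] intB by auto
  have dfFh: "distribution_function Fh" and dfFhe: "distribution_function Fhe"
    using \<open>subexponential Fh\<close> \<open>subexponential Fhe\<close> by (auto simp: subexponential_def)
  interpret DB: nonneg_distribution "distr P borel B" by (rule P.nonneg_distribution_distr[OF _ B0]) simp
  \<comment> \<open>Unlike for B, nonnegativity of C is read off from Fh, which vanishes on the
    negative half-line.\<close>
  interpret DC: nonneg_distribution "distr P borel C"
    using dfFh by (intro nonneg_distributionI P.real_distribution_distr) (auto simp: distribution_function_def Fh)
  have C0: "AE \<omega> in P. 0 \<le> C \<omega>" using DC.nonneg by (simp add: AE_distr_iff)
  have dfFp: "distribution_function Fp"
    unfolding Fp by (rule distribution_function_cdf) (rule DB.nonneg_distribution_axioms)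
  \<comment> \<open>If the mean were 0, then 1/0 = 0 would make Fhe identically 0, although it tends
    to 1.\<close>
  have "0 < \<mu>C"
  proof -
    have "0 \<le> \<mu>C" using C0 by (simp add: \<mu>C integral_nonneg_AE)
    moreover have "\<mu>C \<noteq> 0"
    proof
      assume "\<mu>C = 0"
      then have "Fhe = (\<lambda>_. 0)" using \<open>Fhe = excess \<mu>C Fh\<close> by (simp add: excess_def fun_eq_iff)
      with dfFhe have "((\<lambda>_::real. 0::real) \<longlongrightarrow> 1) at_top" by (simp add: distribution_function_def)
      then show False by (simp add: tendsto_const_iff)
    qed
    ultimately show ?thesis by simp
  qed
  have EU: "P.expectation U = (1 - \<epsilon>) * \<mu>B + \<epsilon> * \<mu>C"
    unfolding \<mu>B \<mu>C
    by (rule P.mixture_expectation[OF intB B0 intC C0 \<open>U \<in> borel_measurable P\<close>])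
      (use \<open>0 < \<epsilon>\<close> \<open>\<epsilon> < 1\<close> \<open>G = (\<lambda>x. (1 - \<epsilon>) * Fp x + \<epsilon> * Fh x)\<close> \<open>G = cdf (distr P borel U)\<close> Fp Fh in \<open>auto simp: fun_eq_iff\<close>)
  have "0 < \<delta>" "0 < \<theta>" using \<open>0 < lam\<close> \<open>0 < \<mu>B\<close> \<open>0 < \<mu>C\<close> \<open>\<delta> = lam * \<mu>B\<close> \<open>\<theta> = lam * \<mu>C\<close> by simp_all
  have \<rho>: "\<rho> = \<rho>b + \<epsilon> * \<theta>"
    using \<open>\<rho> = lam * P.expectation U\<close> EU \<open>\<rho>b = (1 - \<epsilon>) * \<delta>\<close> \<open>\<delta> = lam * \<mu>B\<close> \<open>\<theta> = lam * \<mu>C\<close>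
    by (simp add: algebra_simps)
  have "0 < \<rho>b" "0 < \<epsilon> * \<theta>" using \<open>0 < \<delta>\<close> \<open>0 < \<theta>\<close> \<open>0 < \<epsilon>\<close> \<open>\<epsilon> < 1\<close> \<open>\<rho>b = (1 - \<epsilon>) * \<delta>\<close> by simp_all
  then have "0 < \<rho>" "\<rho>b < 1" using \<rho> \<open>\<rho> < 1\<close> by simp_all
  have q: "0 < q" "q < 1" "1 - q = (1 - \<rho>) / (1 - \<rho>b)"
  proof -
    show "0 < q"
      unfolding \<open>q = \<epsilon> * \<theta> / (1 - \<rho>b)\<close> using \<open>0 < \<epsilon> * \<theta>\<close> \<open>\<rho>b < 1\<close> by (intro divide_pos_pos) auto
    show "q < 1"
      unfolding \<open>q = \<epsilon> * \<theta> / (1 - \<rho>b)\<close> using \<open>\<rho>b < 1\<close> \<open>\<rho> < 1\<close> \<rho> by (simp add: divide_less_eq)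
    \<comment> \<open>Identifies the law of N as geometric with parameter q.\<close>
    show "1 - q = (1 - \<rho>) / (1 - \<rho>b)"
      unfolding \<open>q = \<epsilon> * \<theta> / (1 - \<rho>b)\<close> using \<open>\<rho>b < 1\<close> \<rho> by (simp add: field_simps)
  qed
  interpret F: subexponential_distribution "interval_measure Fhe"
    by (rule subexponential_distribution_interval_measure) fact
  have tail_F: "tail (interval_measure Fhe) u = 1 - Fhe u" for u
    by (simp add: F.tail_eq cdf_interval_measure_distribution_function[OF dfFhe])

  have E: "nonneg_distribution (excess_measure \<mu>B Fp)" "cdf (excess_measure \<mu>B Fp) = Fpe"
    using P.excess_measure[OF intB B0] \<open>0 < \<mu>B\<close> \<open>Fpe = excess \<mu>B Fp\<close> by (simp_all add: \<mu>B Fp)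
  interpret E: nonneg_distribution "excess_measure \<mu>B Fp" by (rule E)
  \<comment> \<open>The convolution powers are formed with \<open>interval_measure\<close>, the tail
    estimate with the density; uniqueness of distribution functions joins them.\<close>
  have Fpe: "interval_measure Fpe = excess_measure \<mu>B Fp"
  proof (rule cdf_unique)
    have df: "distribution_function Fpe" using distribution_function_cdf[OF E(1)] by (simp add: E(2))
    show "real_distribution (interval_measure Fpe)"
      using nonneg_distribution_interval_measure[OF df] by (simp add: nonneg_distribution_def)
    show "cdf (interval_measure Fpe) = cdf (excess_measure \<mu>B Fp)"
      by (simp add: cdf_interval_measure_distribution_function[OF df] E(2))
  qed unfold_locales
  have tail_E: "((\<lambda>u. tail (excess_measure \<mu>B Fp) u / tail (interval_measure Fhe) u) \<longlongrightarrow> 0) at_top"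
  proof (rule F.exponential_tail_negligible[OF \<eta> _ E.tail_nonneg])
    fix u :: real assume "0 \<le> u"
    then show "tail (excess_measure \<mu>B Fp) u \<le> c\<^sub>0 / \<mu>B / \<eta> * exp (- \<eta> * u)"
    proof (rule excess_measure_tail_le[OF \<open>0 < \<mu>B\<close> \<eta>])
      show "prob_space (excess_measure \<mu>B Fp)" by unfold_locales
      show "1 - Fp x \<le> c\<^sub>0 * exp (- \<eta> * x)" if "0 \<le> x" for x
        using B_tail[OF that] by (simp add: Fp tail_distr flip: DB.tail_eq)
      show "Fp \<in> borel_measurable borel"
        using dfFp by (intro borel_measurable_mono) (simp add: distribution_function_def)
      show "Fp x \<le> 1" for x using DB.cdf_bounded_prob by (simp add: Fp)
    qed
  qed
  have Mb_m: "Mb k \<in> borel_measurable \<Omega>" and Ce_m: "1 \<le> k \<Longrightarrow> Ce k \<in> borel_measurable \<Omega>" for k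
    using \<Omega>.new_inputs_indep(1,2)[OF \<open>\<Omega>.indep_vars (\<lambda>_. borel) (new_inputs N Mb Ce) (UNIV - {Excess 0})\<close>] by auto
  have law_Mb: "\<Omega>.prob {\<omega>\<in>space \<Omega>. Mb k \<omega> \<le> u}
      = (1 - \<rho>b) * (\<Sum>j. \<rho>b ^ j * cdf (((\<star>) (excess_measure \<mu>B Fp) ^^ j) (return borel 0)) u)" for k u
    using assms(29)[of k u] by (simp add: conv_power_def Fpe)
  note Mb_tail = F.compound_geometric_tail_negligible[OF \<open>prob_space \<Omega>\<close> Mb_m law_Mb
      less_imp_le[OF \<open>0 < \<rho>b\<close>] \<open>\<rho>b < 1\<close> E(1) tail_E]
  have Mb_law: "distr \<Omega> borel (Mb k) = distr \<Omega> borel (Mb 0)" for k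
  proof (rule \<Omega>.distr_eqI_cdf[OF Mb_m])
    show "real_distribution (distr \<Omega> borel (Mb 0))" using Mb_m by simp
    show "\<Omega>.prob {\<omega>\<in>space \<Omega>. Mb k \<omega> \<le> u} = cdf (distr \<Omega> borel (Mb 0)) u" for u
      unfolding cdf_distr[OF Mb_m] law_Mb ..
  qed
  have Ce_law: "distr \<Omega> borel (Ce k) = interval_measure Fhe" if "1 \<le> k" for k
    using assms(30)[OF that]
    by (intro \<Omega>.distr_eqI_cdf Ce_m that F.real_distribution_axioms) (simp add: cdf_interval_measure_distribution_function[OF dfFhe])
  have N_law: "\<Omega>.prob {\<omega>\<in>space \<Omega>. N \<omega> = k} = (1 - q) * q ^ k" for k
    using assms(28)[of k] q(3) by simp
  note new_facts = \<open>prob_space \<Omega>\<close> \<open>\<Omega>.indep_vars (\<lambda>_. borel) (new_inputs N Mb Ce) (UNIV - {Excess 0})\<close>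
    N_law q(1,2) Mb_law Ce_law \<Omega>.nonneg_distribution_distr[OF Mb_m Mb_tail(1)] Mb_tail(2)
    \<open>1 \<le> n\<close> \<open>2 \<le> \<kappa>\<close> \<open>Z = _\<close> \<open>W = _\<close> \<open>prob_space S\<close> assms(43)
  note new_cv = F.variance_cv_estimator_new[OF new_facts] and new_mean = F.variance_emp_mean_new[OF new_facts]

  have Ue_m: "1 \<le> k \<Longrightarrow> Ue k \<in> borel_measurable \<Omega>0" for k
    using \<Omega>0.pk_inputs_indep(1)[OF \<open>\<Omega>0.indep_vars (\<lambda>_. borel) (pk_inputs N0 Ue) UNIV\<close>] .
  define H where "H = distr \<Omega>0 borel (Ue 1)"
  interpret H: real_distribution H unfolding H_def using Ue_m by simp
  have Ge: "Ge u = ((1 - \<epsilon>) * \<mu>B * Fpe u + \<epsilon> * \<mu>C * Fhe u) / P.expectation U" for u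
    using excess_mixture[OF dfFp dfFh, of \<mu>B \<mu>C "P.expectation U" \<epsilon> u] \<open>0 < \<mu>B\<close> \<open>0 < \<mu>C\<close>
      \<open>Ge = _\<close> \<open>G = (\<lambda>x. (1 - \<epsilon>) * Fp x + \<epsilon> * Fh x)\<close> \<open>Fpe = _\<close> \<open>Fhe = _\<close> by simp
  have cdf_H: "cdf H u = Ge u" for u
    using assms(36)[of 1 u] by (simp add: H_def cdf_distr Ue_m)
  have "nonneg_distribution H"
  proof (rule nonneg_distributionI)
    fix x :: real assume "x < 0"
    then have "Fpe x = 0" "Fhe x = 0" using \<open>Fpe = _\<close> \<open>Fhe = _\<close> by (simp_all add: excess_def set_lebesgue_integral_def)
    then show "cdf H x = 0" by (simp add: cdf_H Ge)
  qed unfold_locales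
  then interpret H: nonneg_distribution H .
  have EU_pos: "0 < P.expectation U"
    using EU \<open>0 < \<mu>B\<close> \<open>0 < \<mu>C\<close> \<open>0 < \<epsilon>\<close> \<open>\<epsilon> < 1\<close> by (simp add: add_pos_pos)
  \<comment> \<open>The weight \<epsilon> \<mu>C / E U of the heavy component in the mixture Ge; the
    phase-type component is negligible.\<close>
  define a where "a = \<epsilon> * \<theta> / \<rho>"
  have "0 < a" using \<open>0 < \<epsilon> * \<theta>\<close> \<open>0 < \<rho>\<close> by (simp add: a_def)
  have tail_H: "((\<lambda>u. tail H u / tail (interval_measure Fhe) u) \<longlongrightarrow> a) at_top"
  proof -
    have eq: "tail H u / tail (interval_measure Fhe) u =
        (1 - \<epsilon>) * \<mu>B / P.expectation U * (tail (excess_measure \<mu>B Fp) u / tail (interval_measure Fhe) u)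
        + \<epsilon> * \<mu>C / P.expectation U" for u
    proof -
      have "tail H u = ((1 - \<epsilon>) * \<mu>B * tail (excess_measure \<mu>B Fp) u + \<epsilon> * \<mu>C * tail (interval_measure Fhe) u) / P.expectation U"
        using EU_pos by (simp add: H.tail_eq cdf_H Ge E.tail_eq E(2) tail_F field_simps) (simp add: EU algebra_simps)
      then show ?thesis using F.tail_pos[of u] by (simp add: add_divide_distrib)
    qed
    have "((\<lambda>u. (1 - \<epsilon>) * \<mu>B / P.expectation U * (tail (excess_measure \<mu>B Fp) u / tail (interval_measure Fhe) u)
        + \<epsilon> * \<mu>C / P.expectation U) \<longlongrightarrow> (1 - \<epsilon>) * \<mu>B / P.expectation U * 0 + \<epsilon> * \<mu>C / P.expectation U) at_top"
      by (intro tendsto_intros tail_E)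
    moreover have "\<epsilon> * \<mu>C / P.expectation U = a"
      using \<open>0 < lam\<close> EU_pos by (simp add: a_def \<open>\<theta> = lam * \<mu>C\<close> \<open>\<rho> = lam * P.expectation U\<close>)
    ultimately show ?thesis unfolding eq by simp
  qed
  have Ue_law: "distr \<Omega>0 borel (Ue k) = H" if "1 \<le> k" for k
    using assms(36)[OF that] by (intro \<Omega>0.distr_eqI_cdf Ue_m that H.real_distribution_axioms) (simp add: cdf_H)
  note pk_facts = \<open>prob_space \<Omega>0\<close> \<open>\<Omega>0.indep_vars (\<lambda>_. borel) (pk_inputs N0 Ue) UNIV\<close>
    assms(35) \<open>0 < \<rho>\<close> \<open>\<rho> < 1\<close> Ue_law H.nonneg_distribution_axioms tail_H
    \<open>1 \<le> n\<close> \<open>2 \<le> \<kappa>\<close> \<open>Z0 = _\<close> \<open>W0 = _\<close> \<open>prob_space S0\<close> assms(45)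
  note pk_cv = F.variance_cv_estimator_pk[OF pk_facts] and pk_mean = F.variance_emp_mean_pk[OF pk_facts]

  define d where "d = 1 - q"
  define \<beta> where "\<beta> = 1 - \<rho>b"
  have "0 < d" "0 < \<beta>" "real \<kappa> > 0" using q \<open>\<rho>b < 1\<close> \<open>2 \<le> \<kappa>\<close> by (simp_all add: d_def \<beta>_def)
  \<comment> \<open>Both sets of parameters in terms of q, \<rho>, d and \<beta>, so that the limits
    can be compared by cancellation.\<close>
  have d: "(1 - \<rho>) / (1 - \<rho>b) = d" "1 - \<rho> = d * \<beta>" and a: "a = q * \<beta> / \<rho>" and q_eq: "\<epsilon> * \<theta> / (1 - \<rho>b) = q"
    using q(3) \<open>0 < \<beta>\<close> \<open>q = _\<close> by (simp_all add: d_def \<beta>_def a_def)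
  obtain m where m: "n = Suc m" using \<open>1 \<le> n\<close> by (cases n) auto
  let ?t = "\<lambda>u. tail (interval_measure Fhe) u"
  have quot: "((\<lambda>u. f u / g u) \<longlongrightarrow> l / l') at_top"
    if "((\<lambda>u. f u / ?t u) \<longlongrightarrow> l) at_top" "((\<lambda>u. g u / ?t u) \<longlongrightarrow> l') at_top" "l' \<noteq> 0" for f g l l'
    using tendsto_divide[OF that] F.tail_pos by (simp add: less_imp_neq[symmetric])
  define A where "A = 1 + real n * d"
  define A' where "A' = 1 + real n * (1 - \<rho>)"
  have "0 < A" "0 < A'" using \<open>0 < d\<close> \<open>\<rho> < 1\<close> by (simp_all add: A_def A'_def add_pos_nonneg)
  note pos = \<open>0 < q\<close> \<open>0 < \<rho>\<close> \<open>0 < d\<close> \<open>0 < \<beta>\<close> \<open>0 < real \<kappa>\<close> \<open>0 < A\<close> \<open>0 < A'\<close>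
  let ?L = "(q / \<rho>) ^ (n + 2) * (A / A')"
  \<comment> \<open>The powers give (q/\<rho>)^(n+3), and the remaining factor (1 - \<rho>) / (d a)
    = \<rho>/q lowers the exponent by one.\<close>
  have L: "(q\<^sup>2)\<^sup>2 * (1 * (q ^ (n - 1) * A / d) / real \<kappa>) / ((\<rho>\<^sup>2)\<^sup>2 * (a * (\<rho> ^ (n - 1) * A' / (1 - \<rho>)) / real \<kappa>)) = ?L"
    using pos unfolding a d(2) m by (simp add: power_divide power2_eq_square field_simps)
  have "((\<lambda>u. S.variance (phihat u) / S0.variance (phihat0 u)) \<longlongrightarrow>
      (q\<^sup>2)\<^sup>2 * (1 * (q ^ (n - 1) * A / d) / real \<kappa>) / ((\<rho>\<^sup>2)\<^sup>2 * (a * (\<rho> ^ (n - 1) * A' / (1 - \<rho>)) / real \<kappa>))) at_top"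
    using quot[OF new_cv pk_cv] pos \<open>0 < a\<close> \<open>\<rho> < 1\<close>
    unfolding \<open>phihat = _\<close> \<open>phihat0 = _\<close> by (simp add: A_def A'_def d_def)
  then have lim1: "((\<lambda>u. S.variance (phihat u) / S0.variance (phihat0 u)) \<longlongrightarrow> ?L) at_top"
    unfolding L .
  have "?L \<noteq> 0" using pos by simp
  have first: "ratio_sim (\<lambda>u. S.variance (phihat u) / S0.variance (phihat0 u)) (\<lambda>u. ?L)"
    unfolding ratio_sim_def using tendsto_divide[OF lim1 tendsto_const[of ?L]] \<open>?L \<noteq> 0\<close> by simp

  have lim2: "((\<lambda>u. S.variance (phihat u) / S.variance (zhat u)) \<longlongrightarrow>
      (q\<^sup>2)\<^sup>2 * (1 * (q ^ (n - 1) * A / d) / real \<kappa>) / ((q\<^sup>2)\<^sup>2 * (1 * (1 + 1 / d) / real \<kappa>))) at_top"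
    using quot[OF new_cv new_mean] pos
    unfolding \<open>phihat = _\<close> \<open>zhat = _\<close> by (simp add: A_def d_def add_pos_pos less_imp_neq[symmetric])
  have lim3: "((\<lambda>u. S0.variance (phihat0 u) / S0.variance (zhat0 u)) \<longlongrightarrow>
      (\<rho>\<^sup>2)\<^sup>2 * (a * (\<rho> ^ (n - 1) * A' / (1 - \<rho>)) / real \<kappa>) / ((\<rho>\<^sup>2)\<^sup>2 * (a * (1 + 1 / (1 - \<rho>)) / real \<kappa>))) at_top"
    using quot[OF pk_cv pk_mean] pos \<open>0 < a\<close> \<open>\<rho> < 1\<close>
    unfolding \<open>phihat0 = _\<close> \<open>zhat0 = _\<close> by (simp add: A'_def add_pos_pos less_imp_neq[symmetric])
  \<comment> \<open>Within one expansion the prefactor, the tail constant a and \<kappa>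
    cancel.\<close>
  have cancel: "x * (y * (z / t) / k) / (x * (y * (1 + 1 / t) / k)) = z / (1 + t)"
    if "0 < x" "0 < y" "0 < t" "0 < k" for x y z t k :: real
  proof -
    have "1 + 1 / t = (1 + t) / t" "1 + t \<noteq> 0" using \<open>0 < t\<close> by (simp_all add: field_simps)
    then show ?thesis using that by simp
  qed
  have e2: "(q\<^sup>2)\<^sup>2 * (1 * (q ^ (n - 1) * A / d) / real \<kappa>) / ((q\<^sup>2)\<^sup>2 * (1 * (1 + 1 / d) / real \<kappa>)) = q ^ (n - 1) * A / (1 + d)"
    using pos by (intro cancel) auto
  have e3: "(\<rho>\<^sup>2)\<^sup>2 * (a * (\<rho> ^ (n - 1) * A' / (1 - \<rho>)) / real \<kappa>) / ((\<rho>\<^sup>2)\<^sup>2 * (a * (1 + 1 / (1 - \<rho>)) / real \<kappa>))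
      = \<rho> ^ (n - 1) * A' / (1 + (1 - \<rho>))"
    using pos \<open>0 < a\<close> \<open>\<rho> < 1\<close> by (intro cancel) auto
  have "((\<lambda>u. (S.variance (phihat u) / S.variance (zhat u)) * inverse (S0.variance (phihat0 u) / S0.variance (zhat0 u)))
      \<longlongrightarrow> q ^ (n - 1) * A / (1 + d) * inverse (\<rho> ^ (n - 1) * A' / (1 + (1 - \<rho>)))) at_top"
    using pos \<open>\<rho> < 1\<close> by (intro tendsto_mult tendsto_inverse lim2[unfolded e2] lim3[unfolded e3]) auto
  also have "q ^ (n - 1) * A / (1 + d) * inverse (\<rho> ^ (n - 1) * A' / (1 + (1 - \<rho>)))
      = (q / \<rho>) ^ (n - 1) * (A / A') * ((1 + (1 - \<rho>)) / (1 + d))"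
    by (simp add: power_divide)
  finally have second: "((\<lambda>u. (S.variance (phihat u) / S.variance (zhat u)) * inverse (S0.variance (phihat0 u) / S0.variance (zhat0 u)))
      \<longlongrightarrow> (q / \<rho>) ^ (n - 1) * (A / A') * ((1 + (1 - \<rho>)) / (1 + d))) at_top" .
  show ?thesis
    unfolding q_eq d(1) A_def[symmetric] A'_def[symmetric] using first second by (rule conjI)
qed

end
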